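(* (1) The map $\mu\mapsto W(\infty,\mu)$ induces a bijection between $\Lambda^+(r)$ and the set of isomorphism classes of irreducible weight ${\boldsymbol{\mathcal S}}(\infty,r)$-modules. (2) Every weight ${\boldsymbol{\mathcal S}}(\infty,r)$-module is completely reducible.
   Context: $v$ indeterminate. ${\bf\Omega}_\infty$ is the $\mathbb Q(v)$-space with basis $\{\omega_i\}_{i\in\mathbb Z}$. ${\boldsymbol{\mathcal H}}$ is the Hecke algebra of $\mathfrak S_r$ over $\mathbb Q(v)$ with basis $\{\mathcal T_w\}$: $\mathcal T_s\mathcal T_w=\mathcal T_{sw}$ if $\ell(sw)>\ell(w)$, $=(v-v^{-1})\mathcal T_w+\mathcal T_{sw}$ otherwise; $T_w=v^{\ell(w)}\mathcal T_w$. ${\boldsymbol{\mathcal H}}$ acts on the right of ${\bf\Omega}_\infty^{\otimes r}$ by $(\omega_{i_1}\cdots\omega_{i_r})\mathcal T_{(j,j+1)}=\omega_{i_1}\cdots\omega_{i_{j+1}}\omega_{i_j}\cdots\omega_{i_r}$ if $i_j<i_{j+1}$; $=v\,\omega_{i_1}\cdots\omega_{i_r}$ if $i_j=i_{j+1}$; $=(v-v^{-1})\omega_{i_1}\cdots\omega_{i_r}+\omega_{i_1}\cdots\omega_{i_{j+1}}\omega_{i_j}\cdots\omega_{i_r}$ if $i_j>i_{j+1}$. ${\boldsymbol{\mathcal S}}(\infty,r)=\operatorname{End}_{\boldsymbol{\mathcal H}}({\bf\Omega}_\infty^{\otimes r})$. $\Lambda(\infty,r)$: finitely supported $\lambda\in\mathbb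 N^{\mathbb Z}$ with $\sum\lambda_i=r$; $\Lambda^+(r)$: partitions of $r$ viewed in $\Lambda(\infty,r)$ ($\lambda_i=0$ for $i\le0$, $\lambda_1\ge\lambda_2\ge\cdots$). For $\lambda\in\Lambda(\infty,r)$, $\Omega_\lambda$ is the span of the $\omega_{i_1}\otimes\cdots\otimes\omega_{i_r}$ with $\#\{j:i_j=k\}=\lambda_k$ for all $k$; it is an ${\boldsymbol{\mathcal H}}$-submodule and ${\bf\Omega}_\infty^{\otimes r}=\bigoplus_\lambda\Omega_\lambda$. Let $\mathtt k_\lambda\in{\boldsymbol{\mathcal S}}(\infty,r)$ be the projection onto $\Omega_\lambda$ along $\bigoplus_{\nu\ne\lambda}\Omega_\nu$. An ${\boldsymbol{\mathcal S}}(\infty,r)$-module $M$ is a weight module if $M=\bigoplus_{\lambda\in\Lambda(\infty,r)}\mathtt k_\lambda M$. Weyl modules: $\omega_\lambda$ is the basis tensor in $\Omega_\lambda$ with weakly increasing indices; $\mathfrak S_\lambda$ the Young subgroup stabilizing consecutive blocks of $\{1,\dots,r\}$ of sizes $\lambda_i$ (increasing $i$); $x_\lambda=\sum_{w\in\mathfrak S_\lambda}T_w$; $\varpi_i=1$ for $1\le i\le r$ and $0$ otherwise; $\omega_\varpi=\omega_1\otimes\cdots\otimes\omega_r$ generates $\Omega_\varpi$ freely over ${\boldsymbol{\mathcal H}}$. $\lambda^t_i=\#\{j:\lambda_j\ge i\}$ for $i\ge1$, $0$ for $i\le0$; $w_\lambda$ the unique distinguished $(\mathfrak S_\lambda,\mathfrak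 S_{\lambda^t})$-double coset representative with $w_\lambda^{-1}\mathfrak S_\lambda w_\lambda\cap\mathfrak S_{\lambda^t}=\{1\}$; $y_{\lambda^t}=\sum_{w\in\mathfrak S_{\lambda^t}}(-v^2)^{-\ell(w)}T_w$. $z_\mu\in{\boldsymbol{\mathcal S}}(\infty,r)$ vanishes on $\Omega_\nu$ for $\nu\ne\varpi$ and $z_\mu(\omega_\varpi h)=\omega_\mu T_{w_\mu}y_{\mu^t}h$. $W(\infty,\mu)={\boldsymbol{\mathcal S}}(\infty,r)z_\mu$. *)

theory Defs
  imports Main "HOL-Library.Function_Algebras" "HOL-Computational_Algebra.Polynomial"
    "HOL-Computational_Algebra.Fraction_Field" "HOL-Combinatorics.Permutations"
begin

type_synonym qv = "rat poly fract"

definition vv :: qv where "vv = Fract [:0, 1:] 1"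

text \<open>Vectors of Omega_infty tensor power r: functions from index sequences (int lists)
  to Q(v), finitely supported, supported on lists of length r.
  The basis tensor omega_{i_1} ... omega_{i_r} is the indicator of the list [i_1,...,i_r].\<close>

type_synonym vec = "int list \<Rightarrow> qv"

definition Vsp :: "nat \<Rightarrow> vec set" where
  "Vsp r = {x. finite {w. x w \<noteq> 0} \<and> (\<forall>w. length w \<noteq> r \<longrightarrow> x w = 0)}"

definition ebas :: "int list \<Rightarrow> vec" where
  "ebas w = (\<lambda>u. if u = w then 1 else 0)"

definition sm :: "qv \<Rightarrow> vec \<Rightarrow> vec" where
  "sm c x = (\<lambda>w. c * x w)"

definition swp :: "nat \<Rightarrow> int list \<Rightarrow> int list" where
  "swp j w = w[j := w ! Suc j, Suc j := w ! j]"

text \<open>Right action of the generator T_{(j+1,j+2)} (positions j, j+1, 0-indexed) on basis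
  tensors, and its linear extension.\<close>

definition tbas :: "nat \<Rightarrow> int list \<Rightarrow> vec" where
  "tbas j w = (if w ! j < w ! Suc j then ebas (swp j w)
               else if w ! j = w ! Suc j then sm vv (ebas w)
               else sm (vv - inverse vv) (ebas w) + ebas (swp j w))"

definition tact :: "nat \<Rightarrow> vec \<Rightarrow> vec" where
  "tact j x = (\<lambda>u. \<Sum>w\<in>{w. x w \<noteq> 0}. x w * tbas j w u)"

definition perms :: "nat \<Rightarrow> (nat \<Rightarrow> nat) set" where
  "perms r = {\<sigma>. \<sigma> permutes {0..<r}}"

definition len :: "nat \<Rightarrow> (nat \<Rightarrow> nat) \<Rightarrow> nat" where
  "len r \<sigma> = card {(i, j). i < j \<and> j < r \<and> \<sigma> j < \<sigma> i}"

definition adj :: "nat \<Rightarrow> nat \<Rightarrow> nat" where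
  "adj j = (\<lambda>p. if p = j then Suc j else if p = Suc j then j else p)"

definition rword :: "nat \<Rightarrow> (nat \<Rightarrow> nat) \<Rightarrow> nat list" where
  "rword r \<sigma> = (SOME js. (\<forall>j\<in>set js. Suc j < r) \<and> length js = len r \<sigma>
                       \<and> foldr (\<lambda>j f. adj j \<circ> f) js id = \<sigma>)"

text \<open>x |-> x * cal_T_sigma, and x |-> x * T_sigma with T_sigma = v^l(sigma) cal_T_sigma.\<close>
definition hT :: "nat \<Rightarrow> (nat \<Rightarrow> nat) \<Rightarrow> vec \<Rightarrow> vec" where
  "hT r \<sigma> x = fold tact (rword r \<sigma>) x"

definition Tw :: "nat \<Rightarrow> (nat \<Rightarrow> nat) \<Rightarrow> vec \<Rightarrow> vec" where
  "Tw r \<sigma> x = sm (vv ^ len r \<sigma>) (hT r \<sigma> x)"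

definition cnt :: "int list \<Rightarrow> int \<Rightarrow> nat" where
  "cnt w = (\<lambda>k. count_list w k)"

definition Lam :: "nat \<Rightarrow> (int \<Rightarrow> nat) set" where
  "Lam r = {\<kappa>. finite {i. \<kappa> i \<noteq> 0} \<and> (\<Sum>i\<in>{i. \<kappa> i \<noteq> 0}. \<kappa> i) = r}"

definition partitions :: "nat \<Rightarrow> (int \<Rightarrow> nat) set" where
  "partitions r = {\<kappa>\<in>Lam r. (\<forall>i\<le>0. \<kappa> i = 0) \<and> (\<forall>i j. 1 \<le> i \<longrightarrow> i \<le> j \<longrightarrow> \<kappa> j \<le> \<kappa> i)}"

definition varpi :: "nat \<Rightarrow> int \<Rightarrow> nat" where
  "varpi r = (\<lambda>i. if 1 \<le> i \<and> i \<le> int r then 1 else 0)"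

definition omega_varpi :: "nat \<Rightarrow> int list" where
  "omega_varpi r = [1..int r]"

definition transp :: "(int \<Rightarrow> nat) \<Rightarrow> int \<Rightarrow> nat" where
  "transp \<kappa> = (\<lambda>i. if 1 \<le> i then card {j. int (\<kappa> j) \<ge> i} else 0)"

definition omega_lam :: "nat \<Rightarrow> (int \<Rightarrow> nat) \<Rightarrow> int list" where
  "omega_lam r \<kappa> = (THE w. sorted w \<and> length w = r \<and> cnt w = \<kappa>)"

text \<open>Young subgroup: permutations preserving the consecutive blocks of sizes lambda_i
  (i increasing), i.e. the blocks of equal entries of omega_lambda.\<close>
definition young :: "nat \<Rightarrow> (int \<Rightarrow> nat) \<Rightarrow> (nat \<Rightarrow> nat) set" where
  "young r \<kappa> = {\<sigma>\<in>perms r. \<forall>p<r. omega_lam r \<kappa> ! (\<sigma> p) = omega_lam r \<kappa> ! p}"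

definition dcoset :: "nat \<Rightarrow> (int \<Rightarrow> nat) \<Rightarrow> (int \<Rightarrow> nat) \<Rightarrow> (nat \<Rightarrow> nat) \<Rightarrow> (nat \<Rightarrow> nat) set" where
  "dcoset r \<kappa> \<nu> w = {a \<circ> w \<circ> b | a b. a \<in> young r \<kappa> \<and> b \<in> young r \<nu>}"

definition distinguished :: "nat \<Rightarrow> (int \<Rightarrow> nat) \<Rightarrow> (int \<Rightarrow> nat) \<Rightarrow> (nat \<Rightarrow> nat) \<Rightarrow> bool" where
  "distinguished r \<kappa> \<nu> w \<longleftrightarrow> w \<in> perms r \<and> (\<forall>u\<in>dcoset r \<kappa> \<nu> w. len r w \<le> len r u)"

definition wlam :: "nat \<Rightarrow> (int \<Rightarrow> nat) \<Rightarrow> nat \<Rightarrow> nat" where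
  "wlam r \<kappa> = (THE w. distinguished r \<kappa> (transp \<kappa>) w \<and>
      {inv w \<circ> a \<circ> w | a. a \<in> young r \<kappa>} \<inter> young r (transp \<kappa>) = {id})"

text \<open>u_mu = omega_mu T_{w_mu} y_{mu^t}, with y = sum (-v^2)^{-l(w)} T_w.\<close>
definition umu :: "nat \<Rightarrow> (int \<Rightarrow> nat) \<Rightarrow> vec" where
  "umu r \<mu> = (\<Sum>\<sigma>\<in>young r (transp \<mu>).
      sm (inverse ((- (vv ^ 2)) ^ len r \<sigma>)) (Tw r \<sigma> (Tw r (wlam r \<mu>) (ebas (omega_lam r \<mu>)))))"

section \<open>The q-Schur algebra S(infty,r) = End_H(Omega^{tensor r})\<close>

text \<open>Endomorphisms are represented as functions vec => vec, normalised to be 0 off the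
  tensor space; H-linearity is commuting with the generators cal_T_{(j,j+1)}.\<close>
definition Send :: "nat \<Rightarrow> (vec \<Rightarrow> vec) set" where
  "Send r = {\<phi>. (\<forall>x\<in>Vsp r. \<phi> x \<in> Vsp r)
      \<and> (\<forall>x\<in>Vsp r. \<forall>y\<in>Vsp r. \<phi> (x + y) = \<phi> x + \<phi> y)
      \<and> (\<forall>c. \<forall>x\<in>Vsp r. \<phi> (sm c x) = sm c (\<phi> x))
      \<and> (\<forall>j. Suc j < r \<longrightarrow> (\<forall>x\<in>Vsp r. \<phi> (tact j x) = tact j (\<phi> x)))
      \<and> (\<forall>x. x \<notin> Vsp r \<longrightarrow> \<phi> x = 0)}"

definition oneS :: "nat \<Rightarrow> vec \<Rightarrow> vec" where
  "oneS r = (\<lambda>x. if x \<in> Vsp r then x else 0)"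

definition kproj :: "nat \<Rightarrow> (int \<Rightarrow> nat) \<Rightarrow> vec \<Rightarrow> vec" where
  "kproj r \<kappa> = (\<lambda>x. if x \<in> Vsp r then (\<lambda>w. if cnt w = \<kappa> then x w else 0) else 0)"

text \<open>z_mu: vanishes on Omega_nu (nu /= varpi), and z_mu(omega_varpi h) = u_mu h, where
  h = sum_sigma c_sigma cal_T_sigma.\<close>
definition zmu :: "nat \<Rightarrow> (int \<Rightarrow> nat) \<Rightarrow> vec \<Rightarrow> vec" where
  "zmu r \<mu> x = (if x \<in> Vsp r then
      (let c = (SOME c. kproj r (varpi r) x =
                  (\<Sum>\<sigma>\<in>perms r. sm (c \<sigma>) (hT r \<sigma> (ebas (omega_varpi r)))))
       in (\<Sum>\<sigma>\<in>perms r. sm (c \<sigma>) (hT r \<sigma> (umu r \<mu>))))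
    else 0)"

definition Wmod :: "nat \<Rightarrow> (int \<Rightarrow> nat) \<Rightarrow> (vec \<Rightarrow> vec) set" where
  "Wmod r \<mu> = {\<phi> \<circ> zmu r \<mu> | \<phi>. \<phi> \<in> Send r}"

definition smod :: "nat \<Rightarrow> 'm::ab_group_add set \<Rightarrow> ((vec \<Rightarrow> vec) \<Rightarrow> 'm \<Rightarrow> 'm) \<Rightarrow> bool" where
  "smod r M a \<longleftrightarrow> 0 \<in> M \<and> (\<forall>x\<in>M. \<forall>y\<in>M. x + y \<in> M) \<and> (\<forall>x\<in>M. - x \<in> M)
     \<and> (\<forall>\<phi>\<in>Send r. \<forall>x\<in>M. a \<phi> x \<in> M)
     \<and> (\<forall>\<phi>\<in>Send r. \<forall>x\<in>M. \<forall>y\<in>M. a \<phi> (x + y) = a \<phi> x + a \<phi> y)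
     \<and> (\<forall>\<phi>\<in>Send r. \<forall>\<psi>\<in>Send r. \<forall>x\<in>M. a (\<phi> + \<psi>) x = a \<phi> x + a \<psi> x)
     \<and> (\<forall>\<phi>\<in>Send r. \<forall>\<psi>\<in>Send r. \<forall>x\<in>M. a (\<phi> \<circ> \<psi>) x = a \<phi> (a \<psi> x))
     \<and> (\<forall>x\<in>M. a (oneS r) x = x)"

definition weight_mod :: "nat \<Rightarrow> 'm::ab_group_add set \<Rightarrow> ((vec \<Rightarrow> vec) \<Rightarrow> 'm \<Rightarrow> 'm) \<Rightarrow> bool" where
  "weight_mod r M a \<longleftrightarrow>
     (\<forall>x\<in>M. \<exists>F f. finite F \<and> F \<subseteq> Lam r \<and> (\<forall>\<kappa>\<in>F. f \<kappa> \<in> a (kproj r \<kappa>) ` M)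
                 \<and> x = (\<Sum>\<kappa>\<in>F. f \<kappa>))
   \<and> (\<forall>F f. finite F \<and> F \<subseteq> Lam r \<and> (\<forall>\<kappa>\<in>F. f \<kappa> \<in> a (kproj r \<kappa>) ` M)
                 \<and> (\<Sum>\<kappa>\<in>F. f \<kappa>) = 0 \<longrightarrow> (\<forall>\<kappa>\<in>F. f \<kappa> = 0))"

definition irreducible_mod :: "nat \<Rightarrow> 'm::ab_group_add set \<Rightarrow> ((vec \<Rightarrow> vec) \<Rightarrow> 'm \<Rightarrow> 'm) \<Rightarrow> bool" where
  "irreducible_mod r M a \<longleftrightarrow> smod r M a \<and> M \<noteq> {0}
     \<and> (\<forall>N. N \<subseteq> M \<and> smod r N a \<longrightarrow> N = {0} \<or> N = M)"

definition iso_mod :: "nat \<Rightarrow> 'm::ab_group_add set \<Rightarrow> ((vec \<Rightarrow> vec) \<Rightarrow> 'm \<Rightarrow> 'm)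
     \<Rightarrow> 'n::ab_group_add set \<Rightarrow> ((vec \<Rightarrow> vec) \<Rightarrow> 'n \<Rightarrow> 'n) \<Rightarrow> bool" where
  "iso_mod r M a N b \<longleftrightarrow> (\<exists>f. bij_betw f M N \<and> (\<forall>x\<in>M. \<forall>y\<in>M. f (x + y) = f x + f y)
     \<and> (\<forall>\<phi>\<in>Send r. \<forall>x\<in>M. f (a \<phi> x) = b \<phi> (f x)))"

definition compl_red :: "nat \<Rightarrow> 'm::ab_group_add set \<Rightarrow> ((vec \<Rightarrow> vec) \<Rightarrow> 'm \<Rightarrow> 'm) \<Rightarrow> bool" where
  "compl_red r M a \<longleftrightarrow> (\<exists>\<N>. (\<forall>N\<in>\<N>. N \<subseteq> M \<and> irreducible_mod r N a)
     \<and> (\<forall>x\<in>M. \<exists>F g. finite F \<and> F \<subseteq> \<N> \<and> (\<forall>N\<in>F. g N \<in> N) \<and> x = (\<Sum>N\<in>F. g N))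
     \<and> (\<forall>F g. finite F \<and> F \<subseteq> \<N> \<and> (\<forall>N\<in>F. g N \<in> N) \<and> (\<Sum>N\<in>F. g N) = 0
            \<longrightarrow> (\<forall>N\<in>F. g N = 0)))"

end

theory Submission
  imports Defs
begin

text \<open>The generators act by symmetric matrices with respect to the basis of tensors, and \<open>Q(v)\<close> is an
  ordered field. So every finite-dimensional $\mathcal H$-submodule of tensor space has an orthogonal
  complement, the projections onto simple submodules lie in the Schur algebra, and weight modules are
  sums of the simple modules generated by these projections.

  It remains to classify the simple submodules. The space $\Omega_\mu y_{\mu^t}$ is the line through
  $u_\mu = \omega_\mu T_{w_\mu} y_{\mu^t}$, because $\Omega_\nu y_{\mu^t}$ is spanned by words that
  increase strictly in the blocks of $\mu^t$; such words exist only for $\nu$ below $\mu$ in the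
  dominance order, and there is just one for $\nu = \mu$. This makes $u_\mu \mathcal H$ simple and
  separates different $\mu$. Conversely, the weights of the Jucys--Murphy operators on a simple
  submodule \<open>N\<close> are analysed as by Okounkov and Vershik: the lexicographically largest and smallest
  weights are the row and column reading of the contents of one partition \<open>\<mu>\<close>, so \<open>N\<close> is a quotient
  of $\Omega_\mu$ with $N y_{\mu^t} \ne 0$, and hence isomorphic to $u_\mu \mathcal H$.\<close>

text \<open>In general the identity of the Schur algebra is not a finite sum of weight projections,
  so the algebra itself cannot simply be split into simple pieces. A single weight space of tensor
  space, however, is finite-dimensional; its projection therefore splits inside the algebra, and
  abstract modules are studied only through their elements of the form \<open>a (pr r P) x\<close>.

  The order on Q(v) does more than make the form definite. It shows that the Poincare polynomials by
  which symmetrisers multiply are nonzero, being sums of squares, and that distinct powers of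
  \<open>vv\<close> differ.

  Eigenvectors need not exist over Q(v) without an argument. The intertwiners supply it: by
  recursion, every Jucys-Murphy operator is annihilated by a product of linear factors whose roots
  are even powers of \<open>vv\<close>. After that a single weight of \<open>N\<close> and its
  rearrangements suffice, with no count of dimensions or of simple modules. The row reading yields a
  homomorphism from a weight space onto \<open>N\<close>, and the column reading shows that it does
  not kill \<open>umu r \<mu>\<close>.\<close>

lemma vv_gt_1: "(1::qv) < vv"
proof -
  \<comment> \<open>A polynomial is positive when its leading coefficient is, so \<open>vv\<close>
    exceeds every rational number.\<close>
  have "(0::rat poly) < [:-1, 1:]"
    by (simp add: less_poly_def pos_poly_def)
  then show ?thesis
    unfolding vv_def One_fract_def by (simp add: less_poly_def one_pCons)
qed

abbreviation hh :: qv where "hh \<equiv> vv - inverse vv"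

lemma vv_pos: "0 < vv" and vv_nz [simp]: "vv \<noteq> 0" and hh_pos: "0 < hh"
proof -
  show "0 < vv" "vv \<noteq> 0" using vv_gt_1 by auto
  have "inverse vv < 1" using vv_gt_1 by (simp add: inverse_less_1_iff)
  then show "0 < hh" using vv_gt_1 by simp
qed

lemma vv_quad: "vv * vv = 1 + hh * vv"
  by (simp add: algebra_simps)

lemma vv_powi_inj: "vv powi m = vv powi n \<longleftrightarrow> m = n"
  using power_int_strict_increasing[OF _ vv_gt_1] by (metis linorder_neqE order_less_irrefl)

section \<open>Tensor space as a vector space over Q(v)\<close>

lemma sm_simps [simp]: "sm 0 x = 0" "sm 1 x = x" "sm c 0 = 0" "sm c (sm d x) = sm (c * d) x"
  by (auto simp: sm_def fun_eq_iff)

lemma sm_apply: "sm c x w = c * x w"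
  by (simp add: sm_def)

lemma sm_distribs: "sm c (x + y) = sm c x + sm c y" "sm c (x - y) = sm c x - sm c y"
  "sm (c + d) x = sm c x + sm d x" "sm (c - d) x = sm c x - sm d x" "sm c (- x) = - sm c x"
  "sm (- c) x = - sm c x"
  by (auto simp: sm_def fun_eq_iff algebra_simps)

lemma sum_fun_apply: "(\<Sum>i\<in>A. f i) w = (\<Sum>i\<in>A. f i w)" for f :: "'i \<Rightarrow> vec"
  by (induction A rule: infinite_finite_induct) auto

lemma sm_sum: "sm c (\<Sum>i\<in>A. f i) = (\<Sum>i\<in>A. sm c (f i))" for f :: "'i \<Rightarrow> vec"
  by (rule ext) (simp add: sm_def sum_fun_apply sum_distrib_left)

lemma sm_sum_left: "sm (\<Sum>i\<in>A. c i) x = (\<Sum>i\<in>A. sm (c i) x)"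
  by (rule ext) (simp add: sm_def sum_fun_apply sum_distrib_right)

interpretation qvs: vector_space sm
  by unfold_locales (auto simp: sm_distribs)

lemma sm_eq_0_iff: "sm c x = 0 \<longleftrightarrow> c = 0 \<or> x = 0"
  by simp

lemma Vsp_subspace: "qvs.subspace (Vsp r)"
proof (rule qvs.subspaceI)
  show "x + y \<in> Vsp r" if "x \<in> Vsp r" "y \<in> Vsp r" for x y
  proof -
    have "{w. (x + y) w \<noteq> 0} \<subseteq> {w. x w \<noteq> 0} \<union> {w. y w \<noteq> 0}" by auto
    with that show ?thesis unfolding Vsp_def
      by (auto intro: finite_subset)
  qed
  show "sm c x \<in> Vsp r" if "x \<in> Vsp r" for c x
  proof -
    have "{w. sm c x w \<noteq> 0} \<subseteq> {w. x w \<noteq> 0}" by (auto simp: sm_def)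
    with that show ?thesis unfolding Vsp_def
      by (auto intro: finite_subset simp: sm_def)
  qed
qed (simp add: Vsp_def)

lemmas Vsp_0 [simp] = qvs.subspace_0[OF Vsp_subspace]
  and Vsp_add [intro, simp] = qvs.subspace_add[OF Vsp_subspace]
  and Vsp_sm [intro, simp] = qvs.subspace_scale[OF Vsp_subspace]
  and Vsp_diff [intro, simp] = qvs.subspace_diff[OF Vsp_subspace]
  and Vsp_sum [intro] = qvs.subspace_sum[OF Vsp_subspace]

lemma Vsp_finite: "x \<in> Vsp r \<Longrightarrow> finite {w. x w \<noteq> 0}"
  by (simp add: Vsp_def)

lemma Vsp_length: "x \<in> Vsp r \<Longrightarrow> x w \<noteq> 0 \<Longrightarrow> length w = r"
  by (auto simp: Vsp_def)

lemma ebas_apply: "ebas w u = (if u = w then 1 else 0)"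
  by (simp add: ebas_def)

lemma ebas_Vsp: "ebas w \<in> Vsp r \<longleftrightarrow> length w = r"
  by (auto simp: Vsp_def ebas_def)

lemma Vsp_expand:
  assumes "finite B" "\<And>w. x w \<noteq> 0 \<Longrightarrow> w \<in> B"
  shows "x = (\<Sum>w\<in>B. sm (x w) (ebas w))"
proof (rule ext)
  fix u
  have "(\<Sum>w\<in>B. sm (x w) (ebas w)) u = (\<Sum>w\<in>B. if w = u then x w else 0)"
    by (auto simp: sum_fun_apply sm_apply ebas_apply intro!: sum.cong)
  also have "\<dots> = x u" using assms by (auto simp: sum.delta)
  finally show "x u = (\<Sum>w\<in>B. sm (x w) (ebas w)) u" by simp
qed

section \<open>The generators of the Hecke algebra on tensor space\<close>

lemma length_swp [simp]: "length (swp j w) = length w"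
  by (simp add: swp_def)

lemma swp_nth: "Suc j < length w \<Longrightarrow> p < length w \<Longrightarrow> swp j w ! p = w ! adj j p"
  by (auto simp: swp_def adj_def nth_list_update)

lemma swp_swp [simp]: "Suc j < length w \<Longrightarrow> swp j (swp j w) = w"
  by (rule nth_equalityI) (auto simp: swp_nth adj_def)

lemma mset_swp: "Suc j < length w \<Longrightarrow> mset (swp j w) = mset w"
  unfolding swp_def using mset_swap[of j w "Suc j"] by (simp add: list_update_swap[of j "Suc j"])

lemma cnt_mset: "cnt w = cnt u \<longleftrightarrow> mset w = mset u"
  by (auto simp: cnt_def fun_eq_iff multiset_eq_iff count_mset)

lemma cnt_swp: "Suc j < length w \<Longrightarrow> cnt (swp j w) = cnt w"
  by (simp add: cnt_mset mset_swp)

text \<open>Letting every generator act by the same scalar on words of the wrong length makes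
  the operator linear, and the Hecke relations valid, on the whole function space.\<close>
definition TT :: "nat \<Rightarrow> nat \<Rightarrow> vec \<Rightarrow> vec" where
  "TT r j x = (\<lambda>u. if length u = r then
      (if u ! j < u ! Suc j then x (swp j u)
       else if u ! j = u ! Suc j then vv * x u
       else hh * x u + x (swp j u)) else vv * x u)"

lemma TT_linear: "TT r j (x + y) = TT r j x + TT r j y" "TT r j (sm c x) = sm c (TT r j x)"
  "TT r j (x - y) = TT r j x - TT r j y" "TT r j 0 = 0" "TT r j (- x) = - TT r j x"
  by (auto simp: TT_def sm_def fun_eq_iff algebra_simps)

lemma TT_sum: "TT r j (\<Sum>i\<in>A. f i) = (\<Sum>i\<in>A. TT r j (f i))" for f :: "'i \<Rightarrow> vec"
  by (rule ext) (auto simp: TT_def sum_fun_apply sum_distrib_left sum.distrib)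

lemma TT_quad:
  assumes "Suc j < r" shows "TT r j (TT r j x) = x + sm hh (TT r j x)"
proof
  fix u
  show "TT r j (TT r j x) u = (x + sm hh (TT r j x)) u"
  proof (cases "length u = r")
    case True
    then show ?thesis using assms
      by (auto simp: TT_def sm_def swp_nth adj_def vv_quad algebra_simps)
  qed (auto simp: TT_def sm_def vv_quad algebra_simps)
qed

lemma swp_commute: "Suc j < k \<Longrightarrow> Suc k < length w \<Longrightarrow> swp j (swp k w) = swp k (swp j w)"
  by (rule nth_equalityI) (auto simp: swp_nth adj_def)

lemma swp_braid: "Suc (Suc j) < length w \<Longrightarrow>
    swp j (swp (Suc j) (swp j w)) = swp (Suc j) (swp j (swp (Suc j) w))"
  by (rule nth_equalityI) (auto simp: swp_nth adj_def)

lemma swp_eq_self: "Suc j < length w \<Longrightarrow> w ! j = w ! Suc j \<Longrightarrow> swp j w = w"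
  by (rule nth_equalityI) (auto simp: swp_nth adj_def)

lemma TT_commute:
  assumes "Suc j < k" "Suc k < r" shows "TT r j (TT r k x) = TT r k (TT r j x)"
proof
  fix u
  show "TT r j (TT r k x) u = TT r k (TT r j x) u"
  proof (cases "length u = r")
    case True
    then show ?thesis using assms swp_commute[of j k u]
      by (auto simp: TT_def swp_nth adj_def algebra_simps)
  qed (auto simp: TT_def)
qed

text \<open>Only the order of the three letters involved matters: two of them coincide, or they are
  in one of six strict orders. A coincidence makes one of the swaps fix a word of the orbit, which
  \<open>e1\<close> to \<open>e3\<close> record; the strict orders need just the braid relation of
  the swaps.\<close>

lemma TT_braid:
  assumes "Suc (Suc j) < r"
  shows "TT r j (TT r (Suc j) (TT r j x)) = TT r (Suc j) (TT r j (TT r (Suc j) x))"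
proof
  fix u
  show "TT r j (TT r (Suc j) (TT r j x)) u = TT r (Suc j) (TT r j (TT r (Suc j) x)) u"
  proof (cases "length u = r")
    case True
    have e1: "u ! j = u ! Suc j \<Longrightarrow> swp j u = u" "u ! Suc j = u ! Suc (Suc j) \<Longrightarrow> swp (Suc j) u = u"
      using True assms by (auto simp: swp_eq_self)
    have e2: "u ! Suc j = u ! Suc (Suc j) \<Longrightarrow> swp j (swp (Suc j) (swp j u)) = swp (Suc j) (swp j u)"
      "u ! j = u ! Suc j \<Longrightarrow> swp (Suc j) (swp j (swp (Suc j) u)) = swp j (swp (Suc j) u)"
      using True assms e1 swp_braid[of j u] by auto
    have e3: "u ! j = u ! Suc (Suc j) \<Longrightarrow> swp (Suc j) (swp j u) = swp j u"
       "u ! j = u ! Suc (Suc j) \<Longrightarrow> swp j (swp (Suc j) u) = swp (Suc j) u"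
      using True assms by (auto simp: swp_eq_self swp_nth adj_def)
    have q: "vv * (inverse vv * y) = y" "inverse vv * (vv * y) = y" for y :: qv
      by (simp_all flip: mult.assoc)
    consider "u ! j = u ! Suc j" | "u ! Suc j = u ! Suc (Suc j)" | "u ! j = u ! Suc (Suc j)"
      | "u ! j < u ! Suc j" "u ! Suc j < u ! Suc (Suc j)" | "u ! j < u ! Suc (Suc j)" "u ! Suc (Suc j) < u ! Suc j"
      | "u ! Suc j < u ! j" "u ! j < u ! Suc (Suc j)" | "u ! Suc j < u ! Suc (Suc j)" "u ! Suc (Suc j) < u ! j"
      | "u ! Suc (Suc j) < u ! j" "u ! j < u ! Suc j" | "u ! Suc (Suc j) < u ! Suc j" "u ! Suc j < u ! j"
      by linarith
    then show ?thesis
    proof cases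
      case 1
      then show ?thesis using True assms e1 e2
        by (auto simp: TT_def swp_nth adj_def q algebra_simps)
    next
      case 2
      then show ?thesis using True assms e1 e2
        by (auto simp: TT_def swp_nth adj_def q algebra_simps)
    next
      case 3
      then show ?thesis using True assms e3
        by (auto simp: TT_def swp_nth adj_def q algebra_simps)
    qed (use True assms swp_braid[of j u] in \<open>simp_all add: TT_def swp_nth adj_def q algebra_simps\<close>)
  qed (auto simp: TT_def)
qed

text \<open>\<open>TT\<close> lists the rows of the matrix of a generator and \<open>tbas\<close>
  its columns; they agree because the matrix is symmetric.\<close>

lemma TT_ebas:
  assumes "length w = r" "Suc j < r"
  shows "TT r j (ebas w) = tbas j w"
proof -
  have s': "ebas w (swp j u) = ebas (swp j w) u" if "length u = r" for u
    using that assms swp_swp by (auto simp: ebas_apply)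
  have d: "ebas w u = 0" "ebas (swp j w) u = 0" if "length u \<noteq> r" for u
    using that assms by (auto simp: ebas_apply)
  have e: "swp j w ! j = w ! Suc j" "swp j w ! Suc j = w ! j" using assms by (auto simp: swp_nth adj_def)
  show ?thesis
  proof
    fix u
    show "TT r j (ebas w) u = tbas j w u"
    proof (cases "length u = r")
      case True
      consider "u = w" | "u = swp j w" "u \<noteq> w" | "u \<noteq> w" "u \<noteq> swp j w" by blast
      then show ?thesis
      proof cases
        case 1
        then show ?thesis using True assms s'[of w] swp_eq_self[of j w]
          by (auto simp: TT_def tbas_def ebas_apply sm_apply)
      next
        case 2
        then show ?thesis using True assms e swp_eq_self[of j w]
          by (auto simp: TT_def tbas_def ebas_apply sm_apply)
      next
        case 3
        then show ?thesis using True s'[of u] by (auto simp: TT_def tbas_def ebas_apply sm_apply)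
      qed
    qed (use d in \<open>auto simp: TT_def tbas_def sm_apply\<close>)
  qed
qed

lemma tact_eq_TT:
  assumes "x \<in> Vsp r" "Suc j < r" shows "tact j x = TT r j x"
proof -
  have "TT r j x = TT r j (\<Sum>w\<in>{w. x w \<noteq> 0}. sm (x w) (ebas w))"
    using Vsp_expand[of "{w. x w \<noteq> 0}" x] Vsp_finite[OF assms(1)] by simp
  also have "\<dots> = (\<Sum>w\<in>{w. x w \<noteq> 0}. sm (x w) (tbas j w))"
    using assms by (auto simp: TT_sum TT_linear TT_ebas Vsp_length[OF assms(1)] intro!: sum.cong)
  finally show ?thesis by (auto simp: tact_def fun_eq_iff sum_fun_apply sm_apply)
qed

lemma TT_Vsp [intro]:
  assumes "x \<in> Vsp r" "Suc j < r" shows "TT r j x \<in> Vsp r"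
proof -
  have "{u. TT r j x u \<noteq> 0} \<subseteq> {w. x w \<noteq> 0} \<union> swp j ` {w. x w \<noteq> 0}"
  proof
    fix u assume u: "u \<in> {u. TT r j x u \<noteq> 0}"
    show "u \<in> {w. x w \<noteq> 0} \<union> swp j ` {w. x w \<noteq> 0}"
    proof (cases "length u = r \<and> x (swp j u) \<noteq> 0")
      case True
      then have "u = swp j (swp j u)" using assms by simp
      with True show ?thesis by blast
    next
      case False
      with u show ?thesis by (auto simp: TT_def split: if_splits)
    qed
  qed
  moreover have "finite ({w. x w \<noteq> 0} \<union> swp j ` {w. x w \<noteq> 0})"
    using Vsp_finite[OF assms(1)] by simp
  ultimately have "finite {u. TT r j x u \<noteq> 0}" by (rule finite_subset)
  moreover have "TT r j x u = 0" if "length u \<noteq> r" for u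
    using assms that by (auto simp: TT_def Vsp_def)
  ultimately show ?thesis by (auto simp: Vsp_def)
qed

subsection \<open>The contravariant form\<close>

text \<open>Summing over the support of the first argument makes the form linear in the second on
  all functions. Linearity in the first then comes from symmetry, which needs finite
  supports.\<close>

definition ip :: "vec \<Rightarrow> vec \<Rightarrow> qv" where
  "ip x y = (\<Sum>w\<in>{w. x w \<noteq> 0}. x w * y w)"

lemma ip_superset:
  assumes "finite B" "\<And>w. x w \<noteq> 0 \<Longrightarrow> y w \<noteq> 0 \<Longrightarrow> w \<in> B" "finite {w. x w \<noteq> 0}"
  shows "ip x y = (\<Sum>w\<in>B. x w * y w)"
  unfolding ip_def by (rule sum.mono_neutral_cong) (use assms in auto)

lemma ip_commute: "x \<in> Vsp r \<Longrightarrow> y \<in> Vsp r \<Longrightarrow> ip x y = ip y x"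
  using ip_superset[of "{w. x w \<noteq> 0}" y x] by (simp add: ip_def mult.commute Vsp_finite)

lemma ip_add_right: "ip x (y + z) = ip x y + ip x z"
  and ip_sm_right: "ip x (sm c y) = c * ip x y"
  and ip_diff_right: "ip x (y - z) = ip x y - ip x z"
  and ip_0_right [simp]: "ip x 0 = 0"
  by (simp_all add: ip_def sm_def algebra_simps sum.distrib sum_subtractf sum_distrib_left)

lemma ip_sum_right: "ip x (\<Sum>i\<in>A. f i) = (\<Sum>i\<in>A. ip x (f i))" for f :: "'i \<Rightarrow> vec"
  unfolding ip_def by (subst sum.swap) (simp add: sum_fun_apply sum_distrib_left)

lemma ip_add_left: "x \<in> Vsp r \<Longrightarrow> y \<in> Vsp r \<Longrightarrow> z \<in> Vsp r \<Longrightarrow> ip (x + y) z = ip x z + ip y z"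
  by (simp add: ip_commute[of _ r z] ip_add_right)

lemma ip_diff_left: "x \<in> Vsp r \<Longrightarrow> y \<in> Vsp r \<Longrightarrow> z \<in> Vsp r \<Longrightarrow> ip (x - y) z = ip x z - ip y z"
  by (simp add: ip_commute[of _ r z] ip_diff_right)

lemma ip_sm_left: "x \<in> Vsp r \<Longrightarrow> z \<in> Vsp r \<Longrightarrow> ip (sm c x) z = c * ip x z"
  by (simp add: ip_commute[of _ r z] ip_sm_right)

lemma ip_0_left [simp]: "ip 0 x = 0"
  by (simp add: ip_def)

text \<open>A finite sum of squares in an ordered field vanishes only if every term does.\<close>

lemma ip_definite: "x \<in> Vsp r \<Longrightarrow> ip x x = 0 \<Longrightarrow> x = 0"
proof -
  assume x: "x \<in> Vsp r" "ip x x = 0"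
  then have "\<forall>w\<in>{w. x w \<noteq> 0}. x w * x w = 0"
    unfolding ip_def using sum_nonneg_eq_0_iff[of "{w. x w \<noteq> 0}" "\<lambda>w. x w * x w"]
      Vsp_finite[OF x(1)] by simp
  then show "x = 0" by (auto simp: fun_eq_iff)
qed

lemma ip_ebas_left [simp]: "ip (ebas w) x = x w"
  by (simp add: ip_def ebas_def)

lemma TT_selfadjoint:
  assumes "x \<in> Vsp r" "y \<in> Vsp r" "Suc j < r"
  shows "ip (TT r j x) y = ip x (TT r j y)"
proof -
  \<comment> \<open>A finite set that contains both supports and is stable under the swap, so that a
    sum over it can be reindexed.\<close>
  define B where "B = {w. x w \<noteq> 0} \<union> {w. y w \<noteq> 0} \<union> swp j ` ({w. x w \<noteq> 0} \<union> {w. y w \<noteq> 0})"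
  have B: "finite B" "\<And>w. w \<in> B \<Longrightarrow> length w = r" using assms by (auto simp: B_def Vsp_length Vsp_finite)
  have inv: "swp j ` B = B"
  proof -
    have "swp j ` (swp j ` A) = A" if "A \<subseteq> {w. length w = r}" for A
      using that assms by (auto simp: image_image subset_eq)
    moreover have "{w. x w \<noteq> 0} \<union> {w. y w \<noteq> 0} \<subseteq> {w. length w = r}"
      using assms by (auto simp: Vsp_length)
    ultimately show ?thesis unfolding B_def by (metis (no_types, lifting) image_Un sup_commute)
  qed
  have inj: "inj_on (swp j) B" using B assms by (metis inj_onI swp_swp)
  \<comment> \<open>The operator is a diagonal part \<open>d\<close> plus the swap weighted by
    \<open>e\<close>. Since \<open>e\<close> takes the same value on a word and its swap, moving the
    swap to the other factor changes nothing.\<close>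
  define d where "d u = (if u ! j < u ! Suc j then 0 else if u ! j = u ! Suc j then vv else hh)" for u :: "int list"
  define e where "e u = (if u ! j = u ! Suc j then 0 else 1::qv)" for u :: "int list"
  have T: "TT r j z u = d u * z u + e u * z (swp j u)" if "length u = r" for z u
    using that by (simp add: TT_def d_def e_def)
  have es: "e (swp j u) = e u" if "length u = r" for u using that assms by (auto simp: e_def swp_nth adj_def)
  have "ip (TT r j x) y = (\<Sum>w\<in>B. TT r j x w * y w)"
    using assms by (intro ip_superset) (auto simp: B_def Vsp_finite Vsp_finite[OF TT_Vsp])
  also have "\<dots> = (\<Sum>w\<in>B. d w * x w * y w) + (\<Sum>w\<in>B. e w * x (swp j w) * y w)"
    using B by (simp add: T algebra_simps sum.distrib)
  also have "(\<Sum>w\<in>B. e w * x (swp j w) * y w) = (\<Sum>w\<in>swp j ` B. e w * x (swp j w) * y w)"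
    by (simp add: inv)
  also have "\<dots> = (\<Sum>w\<in>B. e w * x w * y (swp j w))"
    using inj B assms by (subst sum.reindex) (auto simp: es intro!: sum.cong)
  also have "(\<Sum>w\<in>B. d w * x w * y w) + \<dots> = (\<Sum>w\<in>B. x w * TT r j y w)"
    using B by (simp add: T algebra_simps sum.distrib)
  also have "\<dots> = ip x (TT r j y)"
    using assms by (intro ip_superset[symmetric]) (auto simp: B_def Vsp_finite)
  finally show ?thesis .
qed

subsection \<open>Reduced words\<close>

lemma adj_simps [simp]: "adj j j = Suc j" "adj j (Suc j) = j" "p \<noteq> j \<Longrightarrow> p \<noteq> Suc j \<Longrightarrow> adj j p = p"
  by (auto simp: adj_def)

lemma adj_adj [simp]: "adj j (adj j p) = p"
  by (auto simp: adj_def)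

lemma adj_comp_adj [simp]: "adj j \<circ> adj j = id" "f \<circ> adj j \<circ> adj j = f" "adj j \<circ> (adj j \<circ> f) = f"
  by (auto simp: fun_eq_iff)

lemma perms_permutes: "\<sigma> \<in> perms r \<longleftrightarrow> \<sigma> permutes {..<r}"
  by (simp add: perms_def lessThan_atLeast0)

lemma adj_perms [intro]: "Suc j < r \<Longrightarrow> adj j \<in> perms r"
  unfolding perms_permutes
  by (intro bij_imp_permutes bij_betw_byWitness[where f' = "adj j"]) (auto simp: adj_def)

lemma perms_id [intro, simp]: "id \<in> perms r"
  by (simp add: perms_def permutes_id)

lemma perms_comp [intro]: "\<sigma> \<in> perms r \<Longrightarrow> \<tau> \<in> perms r \<Longrightarrow> \<sigma> \<circ> \<tau> \<in> perms r"
  by (simp add: perms_def permutes_compose)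

lemma perms_inv [intro]: "\<sigma> \<in> perms r \<Longrightarrow> inv \<sigma> \<in> perms r"
  by (simp add: perms_def permutes_inv)

lemma finite_perms [simp]: "finite (perms r)"
  by (simp add: perms_def finite_permutations)

lemma perms_less_iff: "\<sigma> \<in> perms r \<Longrightarrow> \<sigma> p < r \<longleftrightarrow> p < r"
  using permutes_in_image[of \<sigma> "{..<r}" p] by (auto simp: perms_permutes)

lemma perms_inj: "\<sigma> \<in> perms r \<Longrightarrow> \<sigma> p = \<sigma> q \<longleftrightarrow> p = q"
  by (auto simp: perms_def dest: permutes_inj injD)

lemma perms_inv_apply:
  assumes "\<sigma> \<in> perms r" shows "\<sigma> (inv \<sigma> p) = p" "inv \<sigma> (\<sigma> p) = p"
  using assms by (auto simp: perms_def permutes_inverses)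

lemma perms_bij: "\<sigma> \<in> perms r \<Longrightarrow> bij \<sigma>"
  by (auto simp: perms_def permutes_bij)

text \<open>Without descents \<open>p \<le> \<sigma> p\<close> for every \<open>p < r\<close>, while
  both sides have the same sum.\<close>

lemma perms_ascending_id:
  assumes "\<sigma> \<in> perms r" "\<And>j. Suc j < r \<Longrightarrow> \<not> \<sigma> (Suc j) < \<sigma> j"
  shows "\<sigma> = id"
proof -
  have step: "\<sigma> j < \<sigma> (Suc j)" if "Suc j < r" for j
    using assms(2)[OF that] perms_inj[OF assms(1), of j "Suc j"] by linarith
  have ge: "p < r \<Longrightarrow> p \<le> \<sigma> p" for p
  proof (induction p)
    case (Suc p)
    then show ?case using step[of p] by linarith
  qed simp
  have "sum \<sigma> {..<r} = sum id {..<r}"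
    using sum.permute[of \<sigma> "{..<r}" id] assms(1) by (simp add: perms_permutes)
  then have "\<sigma> p = p" if "p < r" for p
    using sum_mono_inv[of id "{..<r}" \<sigma> p] ge that by auto
  moreover have "\<sigma> p = p" if "\<not> p < r" for p
    using assms(1) that by (auto simp: perms_permutes permutes_def)
  ultimately show ?thesis by (auto simp: fun_eq_iff)
qed

text \<open>Stated for maps into any linear order because inversions of words are counted as well as
  those of permutations.\<close>

definition invs :: "nat \<Rightarrow> (nat \<Rightarrow> 'a::linorder) \<Rightarrow> nat" where
  "invs r f = card {(i, j). i < j \<and> j < r \<and> f j < f i}"

lemma len_invs: "len r \<sigma> = invs r \<sigma>"
  by (simp add: len_def invs_def)

lemma finite_invs: "finite {(i, j). i < j \<and> j < r \<and> f j < f i}" for f :: "nat \<Rightarrow> 'a::linorder"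
  by (rule finite_subset[of _ "{..<r} \<times> {..<r}"]) (auto intro: less_trans)

text \<open>Apart from the pair \<open>(j, Suc j)\<close>, the adjacent swap carries inversions
  bijectively to inversions.\<close>

lemma invs_adj:
  assumes "Suc j < r" "f (Suc j) < f j"
  shows "invs r f = Suc (invs r (f \<circ> adj j))"
proof -
  let ?I = "\<lambda>f. {(i, k). i < k \<and> k < r \<and> f k < (f i :: 'a)}"
  have "?I f = insert (j, Suc j) (map_prod (adj j) (adj j) ` ?I (f \<circ> adj j))"
  proof (intro set_eqI iffI)
    fix x assume x: "x \<in> ?I f"
    obtain a b where ab: "x = (a, b)" by fastforce
    show "x \<in> insert (j, Suc j) (map_prod (adj j) (adj j) ` ?I (f \<circ> adj j))"
    proof (cases "x = (j, Suc j)")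
      case False
      then have "adj j a < adj j b" "adj j b < r" using x assms ab by (auto simp: adj_def)
      then have "(adj j a, adj j b) \<in> ?I (f \<circ> adj j)" using x ab by simp
      moreover have "x = map_prod (adj j) (adj j) (adj j a, adj j b)" using ab by simp
      ultimately show ?thesis by blast
    qed simp
  next
    fix x assume "x \<in> insert (j, Suc j) (map_prod (adj j) (adj j) ` ?I (f \<circ> adj j))"
    then show "x \<in> ?I f"
    proof
      assume "x \<in> map_prod (adj j) (adj j) ` ?I (f \<circ> adj j)"
      then obtain a b where ab: "x = (adj j a, adj j b)" "a < b" "b < r" "f (adj j b) < f (adj j a)" by auto
      have "\<not> (a = j \<and> b = Suc j)" using ab assms by auto
      then have "adj j a < adj j b" "adj j b < r" using ab assms by (auto simp: adj_def)
      then show ?thesis using ab by auto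
    qed (use assms in auto)
  qed
  moreover have "(j, Suc j) \<notin> map_prod (adj j) (adj j) ` ?I (f \<circ> adj j)"
    using assms by (auto simp: adj_def split: if_splits)
  moreover have "inj_on (map_prod (adj j) (adj j)) A" for A
    by (rule inj_on_inverseI[of _ "map_prod (adj j) (adj j)"]) auto
  ultimately show ?thesis unfolding invs_def
    using finite_invs[of r "f \<circ> adj j"] by (simp add: card_image)
qed

lemma len_desc: "Suc j < r \<Longrightarrow> \<sigma> (Suc j) < \<sigma> j \<Longrightarrow> len r \<sigma> = Suc (len r (\<sigma> \<circ> adj j))"
  by (simp add: len_invs invs_adj)

lemma len_asc: "Suc j < r \<Longrightarrow> \<sigma> j < \<sigma> (Suc j) \<Longrightarrow> len r (\<sigma> \<circ> adj j) = Suc (len r \<sigma>)"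
  using len_desc[of j r "\<sigma> \<circ> adj j"] by simp

lemma len_id [simp]: "len r id = 0"
  by (simp add: len_def) (metis (mono_tags, lifting) Collect_empty_eq card.empty case_prodE not_less_iff_gr_or_eq)

lemma len_inv:
  assumes "\<sigma> \<in> perms r" shows "len r (inv \<sigma>) = len r \<sigma>"
proof -
  note s = perms_inv_apply[OF assms] perms_less_iff[OF assms] perms_less_iff[OF perms_inv[OF assms]]
  have "bij_betw (\<lambda>x. (\<sigma> (snd x), \<sigma> (fst x))) {(i, j). i < j \<and> j < r \<and> \<sigma> j < \<sigma> i}
     {(i, j). i < j \<and> j < r \<and> inv \<sigma> j < inv \<sigma> i}"
    by (rule bij_betw_byWitness[where f' = "\<lambda>x. (inv \<sigma> (snd x), inv \<sigma> (fst x))"])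
      (auto simp: s)
  from bij_betw_same_card[OF this] show ?thesis unfolding len_def by simp
qed

lemma inv_adj_comp: "\<sigma> \<in> perms r \<Longrightarrow> inv (adj j \<circ> \<sigma>) = inv \<sigma> \<circ> adj j"
proof -
  assume "\<sigma> \<in> perms r"
  moreover have "bij (adj j)" by (auto intro!: o_bij[of "adj j"])
  moreover have "inv (adj j) = adj j" by (rule inv_unique_comp) auto
  ultimately show ?thesis using o_inv_distrib perms_bij by metis
qed

lemma len_left_asc:
  assumes "\<sigma> \<in> perms r" "Suc j < r" "inv \<sigma> j < inv \<sigma> (Suc j)"
  shows "len r (adj j \<circ> \<sigma>) = Suc (len r \<sigma>)"
  using len_asc[of j r "inv \<sigma>"] assms len_inv[of \<sigma> r] len_inv[of "adj j \<circ> \<sigma>" r]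
  by (simp add: inv_adj_comp perms_comp adj_perms)

definition prodw :: "nat list \<Rightarrow> nat \<Rightarrow> nat" where
  "prodw js = foldr (\<lambda>j f. adj j \<circ> f) js id"

lemma prodw_simps [simp]: "prodw [] = id" "prodw (j # js) = adj j \<circ> prodw js"
  by (auto simp: prodw_def)

lemma prodw_append: "prodw (js @ ks) = prodw js \<circ> prodw ks"
  by (induction js) (auto simp: comp_assoc)

lemma prodw_perms: "(\<And>j. j \<in> set js \<Longrightarrow> Suc j < r) \<Longrightarrow> prodw js \<in> perms r"
  by (induction js) (auto intro!: perms_comp adj_perms)

lemma len_prodw_le: "(\<And>j. j \<in> set js \<Longrightarrow> Suc j < r) \<Longrightarrow> len r (prodw js) \<le> length js"
proof (induction js rule: rev_induct)
  case (snoc k js)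
  have "prodw js k \<noteq> prodw js (Suc k)"
    using perms_inj[OF prodw_perms, of js r k "Suc k"] snoc.prems by auto
  then have "len r (prodw js \<circ> adj k) \<le> Suc (len r (prodw js))"
    using len_asc[of k r "prodw js"] len_desc[of k r "prodw js"] snoc.prems by fastforce
  moreover have "len r (prodw js) \<le> length js" using snoc by simp
  moreover have "prodw (js @ [k]) = prodw js \<circ> adj k" by (simp only: prodw_append prodw_simps comp_id)
  ultimately show ?case by (simp only: length_append list.size)
qed simp

definition red :: "nat \<Rightarrow> (nat \<Rightarrow> nat) \<Rightarrow> nat list \<Rightarrow> bool" where
  "red r \<sigma> js \<longleftrightarrow> (\<forall>j\<in>set js. Suc j < r) \<and> length js = len r \<sigma> \<and> prodw js = \<sigma>"

lemma red_perms: "red r \<sigma> js \<Longrightarrow> \<sigma> \<in> perms r"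
  using prodw_perms unfolding red_def by blast

lemma red_snocI:
  "red r \<sigma> js \<Longrightarrow> Suc j < r \<Longrightarrow> \<sigma> j < \<sigma> (Suc j) \<Longrightarrow> red r (\<sigma> \<circ> adj j) (js @ [j])"
  by (auto simp: red_def prodw_append len_asc)

text \<open>At an ascent the permutation \<open>\<sigma> \<circ> adj k\<close> would be longer than
  \<open>\<sigma>\<close>, yet it is spelled by the shorter word \<open>js\<close>, against
  \<open>len_prodw_le\<close>.\<close>

lemma red_snocD:
  assumes "red r \<sigma> (js @ [k])"
  shows "Suc k < r" "\<sigma> (Suc k) < \<sigma> k" "red r (\<sigma> \<circ> adj k) js"
proof -
  have k: "Suc k < r" and pj: "prodw js = \<sigma> \<circ> adj k"
    and l: "length js + 1 = len r \<sigma>" "\<And>j. j \<in> set js \<Longrightarrow> Suc j < r"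
    using assms by (auto simp: red_def prodw_append)
  have le: "len r (\<sigma> \<circ> adj k) \<le> length js" using len_prodw_le[of js r] l pj by auto
  have "\<sigma> k \<noteq> \<sigma> (Suc k)" using perms_inj[OF red_perms[OF assms]] by simp
  then show d: "\<sigma> (Suc k) < \<sigma> k" using len_asc[of k r \<sigma>] le l k by fastforce
  show "Suc k < r" by fact
  show "red r (\<sigma> \<circ> adj k) js" using len_desc[OF k d] l pj by (auto simp: red_def)
qed

lemma red_exists: "\<sigma> \<in> perms r \<Longrightarrow> \<exists>js. red r \<sigma> js"
proof (induction "len r \<sigma>" arbitrary: \<sigma>)
  case 0
  then have "\<sigma> = id" using len_desc by (intro perms_ascending_id[of _ r]) fastforce+
  then have "red r \<sigma> []" by (simp only: red_def) simp
  then show ?case by blast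
next
  case (Suc n)
  have "\<sigma> \<noteq> id" using Suc(2) by auto
  then obtain j where j: "Suc j < r" "\<sigma> (Suc j) < \<sigma> j" using perms_ascending_id[OF Suc(3)] by blast
  then have "n = len r (\<sigma> \<circ> adj j)" using len_desc[OF j] Suc(2) by simp
  then obtain js where "red r (\<sigma> \<circ> adj j) js" using Suc j by blast
  from red_snocI[OF this, of j] j show ?case by (auto simp: comp_assoc)
qed

lemma red_rword: "\<sigma> \<in> perms r \<Longrightarrow> red r \<sigma> (rword r \<sigma>)"
  using someI_ex[OF red_exists] unfolding rword_def red_def prodw_def by blast

text \<open>Matsumoto's theorem: two reduced words ending in different letters are compared through
  a reduced word of the permutation with the dihedral part generated by these letters removed.\<close>
lemma matsumoto:
  "red r \<sigma> js \<Longrightarrow> red r \<sigma> ks \<Longrightarrow> fold (TT r) js x = fold (TT r) ks x"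
proof (induction "len r \<sigma>" arbitrary: \<sigma> js ks)
  case 0
  then show ?case by (simp add: red_def)
next
  case (Suc n)
  obtain js' j where js: "js = js' @ [j]" using Suc(2,3) by (cases js rule: rev_cases) (auto simp: red_def)
  obtain ks' k where ks: "ks = ks' @ [k]" using Suc(2,4) by (cases ks rule: rev_cases) (auto simp: red_def)
  note J = red_snocD[OF Suc(3)[unfolded js]] and K = red_snocD[OF Suc(4)[unfolded ks]]
  have IH: "fold (TT r) as x = fold (TT r) bs x"
    if "red r (\<sigma> \<circ> adj i) as" "red r (\<sigma> \<circ> adj i) bs" "Suc i < r" "\<sigma> (Suc i) < \<sigma> i" for i as bs
    using Suc(1)[OF _ that(1,2)] len_desc[OF that(3,4)] Suc(2) by simp
  have main: "fold (TT r) (as @ [a]) x = fold (TT r) (bs @ [b]) x"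
    if a: "Suc a < r" "\<sigma> (Suc a) < \<sigma> a" "red r (\<sigma> \<circ> adj a) as"
      and b: "Suc b < r" "\<sigma> (Suc b) < \<sigma> b" "red r (\<sigma> \<circ> adj b) bs" and ab: "a < b" for a b as bs
  proof (cases "b = Suc a")
    case False
    with ab have ab': "Suc a < b" by simp
    have c: "adj a \<circ> adj b = adj b \<circ> adj a" using ab' by (auto simp: fun_eq_iff adj_def)
    obtain ts where ts: "red r (\<sigma> \<circ> adj a \<circ> adj b) ts"
      using red_exists[of "\<sigma> \<circ> adj a \<circ> adj b" r] a b red_perms[OF Suc(3)] by (auto intro: perms_comp)
    have ts': "red r (\<sigma> \<circ> adj b \<circ> adj a) ts" using ts c by (simp add: comp_assoc)
    have "red r (\<sigma> \<circ> adj a) (ts @ [b])" using red_snocI[OF ts b(1)] b(2) ab' by simp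
    moreover have "red r (\<sigma> \<circ> adj b) (ts @ [a])" using red_snocI[OF ts' a(1)] a(2) ab' by simp
    ultimately show ?thesis using IH[OF a(3) _ a(1,2)] IH[OF b(3) _ b(1,2)] TT_commute[OF ab' b(1)] by simp
  next
    case True
    have ne: "b \<noteq> a" "Suc b \<noteq> a" "Suc b \<noteq> Suc a" using True by auto
    let ?t = "\<sigma> \<circ> adj a \<circ> adj b \<circ> adj a"
    have c: "adj a \<circ> adj b \<circ> adj a = adj b \<circ> adj a \<circ> adj b" using True by (auto simp: fun_eq_iff adj_def)
    obtain ts where ts: "red r ?t ts"
      using red_exists[of ?t r] a b red_perms[OF Suc(3)] by (auto intro!: perms_comp)
    have ts': "red r (\<sigma> \<circ> adj b \<circ> adj a \<circ> adj b) ts" using ts c by (simp add: comp_assoc)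
    have "red r (\<sigma> \<circ> adj a \<circ> adj b) (ts @ [a])" using red_snocI[OF ts a(1)] a b True by simp
    then have "red r (\<sigma> \<circ> adj a) ((ts @ [a]) @ [b])"
      using red_snocI[of r "\<sigma> \<circ> adj a \<circ> adj b" "ts @ [a]" b] a b True by simp
    moreover have "red r (\<sigma> \<circ> adj b \<circ> adj a) (ts @ [b])" using red_snocI[OF ts' b(1)] a b True by simp
    then have "red r (\<sigma> \<circ> adj b) ((ts @ [b]) @ [a])"
      using red_snocI[of r "\<sigma> \<circ> adj b \<circ> adj a" "ts @ [b]" a] a b True by simp
    ultimately show ?thesis
      using IH[OF a(3) _ a(1,2)] IH[OF b(3) _ b(1,2)] TT_braid[of a r] b(1) True by simp
  qed
  consider "j = k" | "j < k" | "k < j" by linarith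
  then show ?case
  proof cases
    case 1
    then show ?thesis using IH[OF J(3) _ J(1,2)] K(3) js ks by simp
  qed (use main[OF J K] main[OF K J] js ks in auto)
qed

definition HT :: "nat \<Rightarrow> (nat \<Rightarrow> nat) \<Rightarrow> vec \<Rightarrow> vec" where
  "HT r \<sigma> x = fold (TT r) (rword r \<sigma>) x"

lemma fold_TT_linear: "fold (TT r) js (x + y) = fold (TT r) js x + fold (TT r) js y"
  "fold (TT r) js (sm c x) = sm c (fold (TT r) js x)"
  by (induction js arbitrary: x y) (auto simp: TT_linear)

lemma HT_linear: "HT r \<sigma> (x + y) = HT r \<sigma> x + HT r \<sigma> y" "HT r \<sigma> (sm c x) = sm c (HT r \<sigma> x)"
  by (auto simp: HT_def fold_TT_linear)

lemma fold_tact: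
  "x \<in> Vsp r \<Longrightarrow> \<forall>j\<in>set js. Suc j < r \<Longrightarrow> fold tact js x = fold (TT r) js x \<and> fold (TT r) js x \<in> Vsp r"
  by (induction js arbitrary: x) (auto simp: tact_eq_TT TT_Vsp)

lemma hT_eq_HT: "x \<in> Vsp r \<Longrightarrow> \<sigma> \<in> perms r \<Longrightarrow> hT r \<sigma> x = HT r \<sigma> x"
  using fold_tact red_rword by (auto simp: hT_def HT_def red_def)

lemma HT_Vsp [intro]: "x \<in> Vsp r \<Longrightarrow> \<sigma> \<in> perms r \<Longrightarrow> HT r \<sigma> x \<in> Vsp r"
  using fold_tact red_rword by (auto simp: HT_def red_def)

lemma HT_red: "red r \<sigma> js \<Longrightarrow> HT r \<sigma> x = fold (TT r) js x"
  unfolding HT_def using matsumoto red_rword[OF red_perms] by blast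

lemma HT_id [simp]: "HT r id x = x"
  using HT_red[of r id "[]"] by (simp add: red_def)

lemma TT_HT_asc:
  assumes "\<sigma> \<in> perms r" "Suc j < r" "\<sigma> j < \<sigma> (Suc j)"
  shows "TT r j (HT r \<sigma> x) = HT r (\<sigma> \<circ> adj j) x"
  using HT_red[OF red_snocI[OF red_rword[OF assms(1)] assms(2,3)], of x] by (simp add: HT_def)

lemma TT_HT_desc:
  assumes "\<sigma> \<in> perms r" "Suc j < r" "\<sigma> (Suc j) < \<sigma> j"
  shows "TT r j (HT r \<sigma> x) = HT r (\<sigma> \<circ> adj j) x + sm hh (HT r \<sigma> x)"
  using TT_HT_asc[of "\<sigma> \<circ> adj j" r j x] TT_quad[of j r "HT r (\<sigma> \<circ> adj j) x"] assms
  by (simp add: perms_comp adj_perms)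

lemma HT_TT_asc:
  assumes "\<sigma> \<in> perms r" "Suc j < r" "inv \<sigma> j < inv \<sigma> (Suc j)"
  shows "HT r \<sigma> (TT r j x) = HT r (adj j \<circ> \<sigma>) x"
proof -
  have "red r (adj j \<circ> \<sigma>) (j # rword r \<sigma>)"
    using len_left_asc[OF assms] red_rword[OF assms(1)] assms by (auto simp: red_def)
  from HT_red[OF this, of x] show ?thesis by (simp add: HT_def)
qed

lemma HT_TT_desc:
  assumes "\<sigma> \<in> perms r" "Suc j < r" "inv \<sigma> (Suc j) < inv \<sigma> j"
  shows "HT r \<sigma> (TT r j x) = HT r (adj j \<circ> \<sigma>) x + sm hh (HT r \<sigma> x)"
proof -
  have s: "adj j \<circ> \<sigma> \<in> perms r" "inv (adj j \<circ> \<sigma>) j < inv (adj j \<circ> \<sigma>) (Suc j)"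
    using assms by (auto simp: inv_adj_comp[OF assms(1)])
  have *: "HT r \<sigma> y = HT r (adj j \<circ> \<sigma>) (TT r j y)" for y
    using HT_TT_asc[OF s(1) assms(2) s(2), of y] by simp
  show ?thesis using *[of "TT r j x"] *[of x] TT_quad[OF assms(2), of x] by (simp add: HT_linear)
qed

subsection \<open>Young subgroups and words\<close>

text \<open>The stabiliser of the word \<open>b\<close>; for constant \<open>b\<close> this is the whole symmetric group.\<close>
definition yg :: "nat \<Rightarrow> int list \<Rightarrow> (nat \<Rightarrow> nat) set" where
  "yg r b = {\<sigma>\<in>perms r. \<forall>p<r. b ! \<sigma> p = b ! p}"

lemma yg_perms: "\<sigma> \<in> yg r b \<Longrightarrow> \<sigma> \<in> perms r"
  by (simp add: yg_def)

lemma yg_nth: "\<sigma> \<in> yg r b \<Longrightarrow> p < r \<Longrightarrow> b ! \<sigma> p = b ! p"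
  by (simp add: yg_def)

lemma finite_yg [simp]: "finite (yg r b)"
  by (rule finite_subset[of _ "perms r"]) (auto simp: yg_def)

lemma yg_id [simp, intro]: "id \<in> yg r b"
  by (simp add: yg_def)

lemma yg_comp: "\<sigma> \<in> yg r b \<Longrightarrow> \<tau> \<in> yg r b \<Longrightarrow> \<sigma> \<circ> \<tau> \<in> yg r b"
  by (auto simp: yg_def perms_less_iff)

lemma yg_adj: "Suc j < r \<Longrightarrow> b ! j = b ! Suc j \<Longrightarrow> adj j \<in> yg r b"
  using adj_perms[of j r] by (auto simp: yg_def) (auto simp: adj_def)

lemma yg_const: "(\<And>p. p < r \<Longrightarrow> b ! p = c) \<Longrightarrow> yg r b = perms r"
  by (auto simp: yg_def perms_less_iff)

text \<open>Across a block boundary of the sorted word an element of the stabiliser cannot have a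
  descent, since it preserves letters. So removing descents stays inside the Young subgroup, which
  is what \<open>yg_induct\<close> exploits.\<close>

lemma yg_descent:
  assumes "sorted b" "length b = r" "\<sigma> \<in> yg r b" "\<sigma> \<noteq> id"
  obtains j where "Suc j < r" "b ! j = b ! Suc j" "\<sigma> (Suc j) < \<sigma> j"
proof -
  obtain j where j: "Suc j < r" "\<sigma> (Suc j) < \<sigma> j"
    using perms_ascending_id[OF yg_perms[OF assms(3)]] assms(4) by blast
  have "\<sigma> j < r" using j perms_less_iff[OF yg_perms[OF assms(3)]] by simp
  then have "b ! \<sigma> (Suc j) \<le> b ! \<sigma> j" using j assms(1,2) by (simp add: sorted_nth_mono)
  moreover have "b ! j \<le> b ! Suc j" using j assms(1,2) by (simp add: sorted_nth_mono)
  ultimately have "b ! j = b ! Suc j" using yg_nth[OF assms(3), of j] yg_nth[OF assms(3), of "Suc j"] j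
    by simp
  with j that show ?thesis by blast
qed

lemma yg_induct [consumes 3, case_names id adj]:
  assumes "sorted b" "length b = r" "\<sigma> \<in> yg r b" "P id"
    and "\<And>\<tau> j. \<tau> \<in> yg r b \<Longrightarrow> Suc j < r \<Longrightarrow> b ! j = b ! Suc j \<Longrightarrow> \<tau> j < \<tau> (Suc j) \<Longrightarrow> P \<tau> \<Longrightarrow> P (\<tau> \<circ> adj j)"
  shows "P \<sigma>"
  using assms(3)
proof (induction "len r \<sigma>" arbitrary: \<sigma> rule: less_induct)
  case less
  show ?case
  proof (cases "\<sigma> = id")
    case False
    obtain j where j: "Suc j < r" "b ! j = b ! Suc j" "\<sigma> (Suc j) < \<sigma> j"
      using yg_descent[OF assms(1,2) less(2) False] .
    have m: "\<sigma> \<circ> adj j \<in> yg r b" by (intro yg_comp less yg_adj j)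
    have "P (\<sigma> \<circ> adj j)" using less(1)[OF _ m] len_desc[OF j(1,3)] by simp
    from assms(5)[OF m j(1,2) _ this] j show ?thesis by simp
  qed (use assms in simp)
qed

lemma perms_induct [consumes 1, case_names id adj]:
  assumes "\<sigma> \<in> perms r" "P id"
    and "\<And>\<tau> j. \<tau> \<in> perms r \<Longrightarrow> Suc j < r \<Longrightarrow> \<tau> j < \<tau> (Suc j) \<Longrightarrow> P \<tau> \<Longrightarrow> P (\<tau> \<circ> adj j)"
  shows "P \<sigma>"
proof -
  have y: "yg r (replicate r 0) = perms r" by (rule yg_const) simp
  show ?thesis
    by (rule yg_induct[of "replicate r 0" r \<sigma> P, unfolded y]; (rule assms)?; simp)
qed

lemma sum_perms_adj:
  fixes f :: "(nat \<Rightarrow> nat) \<Rightarrow> vec"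
  assumes "Suc j < r" "b ! j = b ! Suc j"
  shows "(\<Sum>\<sigma>\<in>yg r b. f (\<sigma> \<circ> adj j)) = (\<Sum>\<sigma>\<in>yg r b. f \<sigma>)"
    "(\<Sum>\<sigma>\<in>yg r b. f (adj j \<circ> \<sigma>)) = (\<Sum>\<sigma>\<in>yg r b. f \<sigma>)"
proof -
  have "bij_betw (\<lambda>\<sigma>. \<sigma> \<circ> adj j) (yg r b) (yg r b)" "bij_betw (\<lambda>\<sigma>. adj j \<circ> \<sigma>) (yg r b) (yg r b)"
    by (rule bij_betw_byWitness[where f' = "\<lambda>\<sigma>. \<sigma> \<circ> adj j"] bij_betw_byWitness[where f' = "\<lambda>\<sigma>. adj j \<circ> \<sigma>"];
        use yg_adj[OF assms] yg_comp in \<open>auto simp del: o_apply\<close>)+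
  then show "(\<Sum>\<sigma>\<in>yg r b. f (\<sigma> \<circ> adj j)) = (\<Sum>\<sigma>\<in>yg r b. f \<sigma>)"
    "(\<Sum>\<sigma>\<in>yg r b. f (adj j \<circ> \<sigma>)) = (\<Sum>\<sigma>\<in>yg r b. f \<sigma>)"
    using sum.reindex_bij_betw[of "\<lambda>\<sigma>. \<sigma> \<circ> adj j" _ _ f] sum.reindex_bij_betw[of "\<lambda>\<sigma>. adj j \<circ> \<sigma>" _ _ f]
    by auto
qed

lemma permute_nth: "\<sigma> \<in> perms r \<Longrightarrow> length w = r \<Longrightarrow> p < r \<Longrightarrow> permute_list \<sigma> w ! p = w ! \<sigma> p"
  by (simp add: permute_list_nth perms_permutes)

lemma permute_adj:
  assumes "\<sigma> \<in> perms r" "length w = r" "Suc j < r"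
  shows "permute_list (\<sigma> \<circ> adj j) w = swp j (permute_list \<sigma> w)"
proof (rule nth_equalityI)
  fix i assume "i < length (permute_list (\<sigma> \<circ> adj j) w)"
  then have i: "i < r" using assms by simp
  have "adj j i < r" using assms i perms_less_iff[OF adj_perms] by simp
  then show "permute_list (\<sigma> \<circ> adj j) w ! i = swp j (permute_list \<sigma> w) ! i"
    using assms i permute_nth[OF perms_comp[OF assms(1) adj_perms[OF assms(3)]], of w i]
    by (simp add: swp_nth permute_nth)
qed simp

lemma yg_permute_list: "length b = r \<Longrightarrow> \<sigma> \<in> yg r b \<longleftrightarrow> \<sigma> \<in> perms r \<and> permute_list \<sigma> b = b"
  by (auto simp: yg_def list_eq_iff_nth_eq permute_nth)

lemma cnt_permute: "\<sigma> \<in> perms r \<Longrightarrow> length w = r \<Longrightarrow> cnt (permute_list \<sigma> w) = cnt w"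
  by (simp add: cnt_mset perms_permutes)

lemma cnt_eq_permute:
  assumes "cnt w = cnt u" "length u = r"
  obtains \<sigma> where "\<sigma> \<in> perms r" "permute_list \<sigma> u = w"
  using mset_eq_permutation[of w u] assms by (auto simp: cnt_mset perms_permutes)

lemma TT_ebas_less: "length w = r \<Longrightarrow> Suc j < r \<Longrightarrow> w ! j < w ! Suc j \<Longrightarrow> TT r j (ebas w) = ebas (swp j w)"
  and TT_ebas_eq: "length w = r \<Longrightarrow> Suc j < r \<Longrightarrow> w ! j = w ! Suc j \<Longrightarrow> TT r j (ebas w) = sm vv (ebas w)"
  by (auto simp: TT_ebas tbas_def)

text \<open>Along a reduced word that starts at a sorted tensor, the letters to be exchanged are
  always in weakly increasing order. The two-term case of the action never occurs; the exponent
  counts the steps at equal letters.\<close>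

lemma HT_ebas_sorted:
  assumes "sorted u" "length u = r" "\<sigma> \<in> perms r"
  shows "\<exists>k. HT r \<sigma> (ebas u) = sm (vv ^ k) (ebas (permute_list \<sigma> u))"
  using assms(3)
proof (induction rule: perms_induct)
  case id
  have "HT r id (ebas u) = sm (vv ^ 0) (ebas (permute_list id u))"
    by (simp only: HT_id permute_list_id power_0 sm_simps)
  then show ?case by blast
next
  case (adj \<tau> j)
  then obtain k where k: "HT r \<tau> (ebas u) = sm (vv ^ k) (ebas (permute_list \<tau> u))" by blast
  have "HT r (\<tau> \<circ> adj j) (ebas u) = sm (vv ^ k) (TT r j (ebas (permute_list \<tau> u)))"
    using TT_HT_asc[of \<tau> r j "ebas u"] adj k by (simp add: TT_linear)
  moreover have le: "permute_list \<tau> u ! j \<le> permute_list \<tau> u ! Suc j"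
    using adj assms by (simp add: permute_nth sorted_nth_mono perms_less_iff)
  have "TT r j (ebas (permute_list \<tau> u)) = ebas (permute_list (\<tau> \<circ> adj j) u) \<or>
      TT r j (ebas (permute_list \<tau> u)) = sm vv (ebas (permute_list (\<tau> \<circ> adj j) u))"
    using adj assms le swp_eq_self[of j "permute_list \<tau> u"]
    by (cases "permute_list \<tau> u ! j = permute_list \<tau> u ! Suc j")
      (auto simp: permute_adj TT_ebas_less TT_ebas_eq)
  ultimately show ?case
    by (metis power_Suc2 sm_simps(4))
qed

lemma HT_ebas_block:
  assumes "sorted b" "length b = r" "\<sigma> \<in> yg r b" "length t = r"
    and t: "\<And>p q. p < q \<Longrightarrow> q < r \<Longrightarrow> b ! p = b ! q \<Longrightarrow> t ! p < t ! q"
  shows "HT r \<sigma> (ebas t) = ebas (permute_list \<sigma> t)"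
  using assms(1-3)
proof (induction rule: yg_induct)
  case (adj \<tau> j)
  have p: "\<tau> \<in> perms r" using adj yg_perms by blast
  have "\<tau> (Suc j) < r" using adj perms_less_iff[OF p] by simp
  then have "t ! \<tau> j < t ! \<tau> (Suc j)"
    using adj yg_nth[OF adj(1)] by (intro t) auto
  then have "HT r (\<tau> \<circ> adj j) (ebas t) = ebas (permute_list (\<tau> \<circ> adj j) t)"
    using TT_HT_asc[OF p adj(2,4), of "ebas t"] adj p assms(4)
    by (simp add: TT_ebas_less permute_nth permute_adj)
  then show ?case .
qed (simp only: HT_id permute_list_id)

lemma HT_young:
  assumes "sorted b" "length b = r" "\<sigma> \<in> yg r b"
    and "\<And>j. Suc j < r \<Longrightarrow> b ! j = b ! Suc j \<Longrightarrow> TT r j x = sm q x"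
  shows "HT r \<sigma> x = sm (q ^ len r \<sigma>) x"
  using assms(1-3)
proof (induction rule: yg_induct)
  case (adj \<tau> j)
  then have "HT r (\<tau> \<circ> adj j) x = sm (q ^ len r (\<tau> \<circ> adj j)) x"
    using TT_HT_asc[of \<tau> r j x] assms(4)[of j] len_asc[of j r \<tau>] yg_perms[of \<tau> r b]
    by (simp add: TT_linear mult.commute)
  then show ?case .
qed (simp only: HT_id len_id power_0 sm_simps)

text \<open>For \<open>q = v\<close> this is the symmetriser $x_\lambda$ and for $q = -v^{-1}$ the antisymmetriser
  $y_\lambda$ of the Young subgroup fixing \<open>b\<close>; these two \<open>q\<close> are the roots of the quadratic relation.\<close>
definition Sym :: "nat \<Rightarrow> qv \<Rightarrow> int list \<Rightarrow> vec \<Rightarrow> vec" where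
  "Sym r q b x = (\<Sum>\<sigma>\<in>yg r b. sm (q ^ len r \<sigma>) (HT r \<sigma> x))"

lemma Sym_linear: "Sym r q b (x + y) = Sym r q b x + Sym r q b y" "Sym r q b (sm c x) = sm c (Sym r q b x)"
  by (auto simp: Sym_def HT_linear sm_distribs sum.distrib sm_sum mult.commute)

lemma Sym_sum: "Sym r q b (\<Sum>i\<in>A. f i) = (\<Sum>i\<in>A. Sym r q b (f i))" for f :: "'i \<Rightarrow> vec"
  using Modules.additive.sum[of "Sym r q b" f A] by (simp add: Modules.additive_def Sym_linear)

lemma Sym_Vsp [intro]: "x \<in> Vsp r \<Longrightarrow> Sym r q b x \<in> Vsp r"
  unfolding Sym_def using yg_perms by (intro Vsp_sum Vsp_sm HT_Vsp) auto

text \<open>The left side is the coefficient of \<open>HT r \<sigma> x\<close> in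
  \<open>TT r j (Sym r q b x)\<close> after reindexing by \<open>\<sigma> \<circ> adj j\<close>. At
  a descent the quadratic relation for \<open>q\<close> merges the two terms.\<close>

lemma sym_weight:
  assumes "q * q = 1 + hh * q" "Suc j < r" "\<sigma> j \<noteq> \<sigma> (Suc j)"
  shows "q ^ len r (\<sigma> \<circ> adj j) + (if \<sigma> (Suc j) < \<sigma> j then hh * q ^ len r \<sigma> else 0) = q * q ^ len r \<sigma>"
proof (cases "\<sigma> (Suc j) < \<sigma> j")
  case True
  have "q ^ n + hh * (q * q ^ n) = q * (q * q ^ n)" for n
    using assms(1) by (metis (no_types, lifting) distrib_right mult.assoc mult_1)
  then show ?thesis using len_desc[OF assms(2) True] True by simp
next
  case False
  then show ?thesis using len_asc[OF assms(2), of \<sigma>] assms(3) by simp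
qed

lemma TT_Sym:
  assumes "q * q = 1 + hh * q" "Suc j < r" "b ! j = b ! Suc j"
  shows "TT r j (Sym r q b x) = sm q (Sym r q b x)"
proof -
  have "TT r j (Sym r q b x) = (\<Sum>\<sigma>\<in>yg r b. sm (q ^ len r \<sigma>) (HT r (\<sigma> \<circ> adj j) x)
      + sm (if \<sigma> (Suc j) < \<sigma> j then hh * q ^ len r \<sigma> else 0) (HT r \<sigma> x))"
    unfolding Sym_def TT_sum
  proof (rule sum.cong[OF refl])
    fix \<sigma> assume "\<sigma> \<in> yg r b"
    then have s: "\<sigma> \<in> perms r" by (rule yg_perms)
    then have "\<sigma> j \<noteq> \<sigma> (Suc j)" by (simp add: perms_inj)
    then show "TT r j (sm (q ^ len r \<sigma>) (HT r \<sigma> x)) = sm (q ^ len r \<sigma>) (HT r (\<sigma> \<circ> adj j) x)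
      + sm (if \<sigma> (Suc j) < \<sigma> j then hh * q ^ len r \<sigma> else 0) (HT r \<sigma> x)"
      using TT_HT_asc[OF s assms(2), of x] TT_HT_desc[OF s assms(2), of x]
      by (cases "\<sigma> (Suc j) < \<sigma> j") (auto simp: TT_linear sm_distribs(1) mult.commute)
  qed
  also have "\<dots> = (\<Sum>\<sigma>\<in>yg r b. sm (q ^ len r (\<sigma> \<circ> adj j)) (HT r \<sigma> x)
      + sm (if \<sigma> (Suc j) < \<sigma> j then hh * q ^ len r \<sigma> else 0) (HT r \<sigma> x))"
    using sum_perms_adj(1)[OF assms(2,3), of "\<lambda>\<sigma>. sm (q ^ len r (\<sigma> \<circ> adj j)) (HT r \<sigma> x)"]
    by (simp add: sum.distrib)
  also have "\<dots> = (\<Sum>\<sigma>\<in>yg r b. sm (q * q ^ len r \<sigma>) (HT r \<sigma> x))"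
  proof (rule sum.cong[OF refl])
    fix \<sigma> assume "\<sigma> \<in> yg r b"
    then have "\<sigma> j \<noteq> \<sigma> (Suc j)" using perms_inj[OF yg_perms] by simp
    from sym_weight[OF assms(1,2) this]
    show "sm (q ^ len r (\<sigma> \<circ> adj j)) (HT r \<sigma> x)
      + sm (if \<sigma> (Suc j) < \<sigma> j then hh * q ^ len r \<sigma> else 0) (HT r \<sigma> x) = sm (q * q ^ len r \<sigma>) (HT r \<sigma> x)"
      unfolding sm_distribs(3)[symmetric] by (rule arg_cong)
  qed
  finally show ?thesis by (simp add: Sym_def sm_sum)
qed

lemma Sym_TT:
  assumes "q * q = 1 + hh * q" "Suc j < r" "b ! j = b ! Suc j"
  shows "Sym r q b (TT r j x) = sm q (Sym r q b x)"
proof -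
  have "Sym r q b (TT r j x) = (\<Sum>\<sigma>\<in>yg r b. sm (q ^ len r \<sigma>) (HT r (adj j \<circ> \<sigma>) x)
      + sm (if inv \<sigma> (Suc j) < inv \<sigma> j then hh * q ^ len r \<sigma> else 0) (HT r \<sigma> x))"
    unfolding Sym_def
  proof (rule sum.cong[OF refl])
    fix \<sigma> assume "\<sigma> \<in> yg r b"
    then have s: "\<sigma> \<in> perms r" by (rule yg_perms)
    then have "inv \<sigma> j \<noteq> inv \<sigma> (Suc j)" by (simp add: perms_inj[OF perms_inv])
    then show "sm (q ^ len r \<sigma>) (HT r \<sigma> (TT r j x)) = sm (q ^ len r \<sigma>) (HT r (adj j \<circ> \<sigma>) x)
      + sm (if inv \<sigma> (Suc j) < inv \<sigma> j then hh * q ^ len r \<sigma> else 0) (HT r \<sigma> x)"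
      using HT_TT_asc[OF s assms(2), of x] HT_TT_desc[OF s assms(2), of x]
      by (cases "inv \<sigma> (Suc j) < inv \<sigma> j") (auto simp: sm_distribs(1) mult.commute)
  qed
  also have "\<dots> = (\<Sum>\<sigma>\<in>yg r b. sm (q ^ len r (adj j \<circ> \<sigma>)) (HT r \<sigma> x)
      + sm (if inv \<sigma> (Suc j) < inv \<sigma> j then hh * q ^ len r \<sigma> else 0) (HT r \<sigma> x))"
    using sum_perms_adj(2)[OF assms(2,3), of "\<lambda>\<sigma>. sm (q ^ len r (adj j \<circ> \<sigma>)) (HT r \<sigma> x)"]
    by (simp add: sum.distrib)
  also have "\<dots> = (\<Sum>\<sigma>\<in>yg r b. sm (q * q ^ len r \<sigma>) (HT r \<sigma> x))"
  proof (rule sum.cong[OF refl])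
    fix \<sigma> assume "\<sigma> \<in> yg r b"
    then have s: "\<sigma> \<in> perms r" by (rule yg_perms)
    have "inv \<sigma> j \<noteq> inv \<sigma> (Suc j)" using s by (simp add: perms_inj[OF perms_inv])
    moreover have "len r (inv \<sigma> \<circ> adj j) = len r (adj j \<circ> \<sigma>)"
      using len_inv[of "adj j \<circ> \<sigma>" r] s assms(2) by (simp add: inv_adj_comp[OF s] perms_comp adj_perms)
    ultimately show "sm (q ^ len r (adj j \<circ> \<sigma>)) (HT r \<sigma> x)
      + sm (if inv \<sigma> (Suc j) < inv \<sigma> j then hh * q ^ len r \<sigma> else 0) (HT r \<sigma> x) = sm (q * q ^ len r \<sigma>) (HT r \<sigma> x)"
      unfolding sm_distribs(3)[symmetric]
      using sym_weight[OF assms(1,2), of "inv \<sigma>"] len_inv[OF s] by (simp only: simp_thms)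
  qed
  finally show ?thesis by (simp add: Sym_def sm_sum)
qed

lemma Sym_eigen:
  assumes "sorted b" "length b = r"
    and "\<And>j. Suc j < r \<Longrightarrow> b ! j = b ! Suc j \<Longrightarrow> TT r j x = sm q x"
  shows "Sym r q b x = sm (\<Sum>\<sigma>\<in>yg r b. q ^ len r \<sigma> * q ^ len r \<sigma>) x"
  unfolding Sym_def sm_sum_left
  by (rule sum.cong) (use HT_young[OF assms(1,2) _ assms(3)] in auto)

text \<open>The sum is the Poincare polynomial of the Young subgroup at \<open>q * q\<close>. Being
  a sum of nonzero squares it is positive, so by \<open>Sym_eigen\<close> a symmetriser never kills
  a vector on which the subgroup already acts by \<open>q\<close>.\<close>

lemma Sym_const_pos: "q \<noteq> 0 \<Longrightarrow> 0 < (\<Sum>\<sigma>\<in>yg r b. q ^ len r \<sigma> * q ^ len r \<sigma> :: qv)"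
proof (rule sum_pos)
  fix \<sigma> assume "q \<noteq> 0"
  then have "q ^ len r \<sigma> < 0 \<or> 0 < q ^ len r \<sigma>" using linorder_neq_iff power_eq_0_iff by blast
  then show "0 < q ^ len r \<sigma> * q ^ len r \<sigma>" by (auto simp only: zero_less_mult_iff)
qed (use yg_id in \<open>auto simp del: yg_id\<close>)

subsection \<open>Endomorphisms and submodules of tensor space\<close>

lemma SendI:
  assumes "\<And>x. x \<in> Vsp r \<Longrightarrow> \<phi> x \<in> Vsp r"
    "\<And>x y. x \<in> Vsp r \<Longrightarrow> y \<in> Vsp r \<Longrightarrow> \<phi> (x + y) = \<phi> x + \<phi> y"
    "\<And>c x. x \<in> Vsp r \<Longrightarrow> \<phi> (sm c x) = sm c (\<phi> x)"
    "\<And>j x. Suc j < r \<Longrightarrow> x \<in> Vsp r \<Longrightarrow> \<phi> (TT r j x) = TT r j (\<phi> x)"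
    "\<And>x. x \<notin> Vsp r \<Longrightarrow> \<phi> x = 0"
  shows "\<phi> \<in> Send r"
  using assms by (auto simp: Send_def tact_eq_TT tact_eq_TT[OF assms(1)])

lemma SendD:
  assumes "\<phi> \<in> Send r"
  shows Send_Vsp: "x \<in> Vsp r \<Longrightarrow> \<phi> x \<in> Vsp r"
    and Send_add: "x \<in> Vsp r \<Longrightarrow> y \<in> Vsp r \<Longrightarrow> \<phi> (x + y) = \<phi> x + \<phi> y"
    and Send_sm: "x \<in> Vsp r \<Longrightarrow> \<phi> (sm c x) = sm c (\<phi> x)"
    and Send_TT: "Suc j < r \<Longrightarrow> x \<in> Vsp r \<Longrightarrow> \<phi> (TT r j x) = TT r j (\<phi> x)"
    and Send_out: "x \<notin> Vsp r \<Longrightarrow> \<phi> x = 0"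
proof -
  show "x \<in> Vsp r \<Longrightarrow> \<phi> x \<in> Vsp r" "x \<in> Vsp r \<Longrightarrow> y \<in> Vsp r \<Longrightarrow> \<phi> (x + y) = \<phi> x + \<phi> y"
    "x \<in> Vsp r \<Longrightarrow> \<phi> (sm c x) = sm c (\<phi> x)" "x \<notin> Vsp r \<Longrightarrow> \<phi> x = 0"
    using assms by (auto simp: Send_def)
  show "\<phi> (TT r j x) = TT r j (\<phi> x)" if "Suc j < r" "x \<in> Vsp r"
  proof -
    have "\<phi> x \<in> Vsp r" "\<phi> (tact j x) = tact j (\<phi> x)" using assms that by (auto simp: Send_def)
    then show ?thesis using that tact_eq_TT by metis
  qed
qed

lemma Send_0 [simp]: "\<phi> \<in> Send r \<Longrightarrow> \<phi> 0 = 0"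
  using Send_sm[of \<phi> r 0 0] by simp

lemma Send_Vsp' [intro]:
  assumes "\<phi> \<in> Send r" shows "\<phi> x \<in> Vsp r"
  using Send_Vsp[OF assms] Send_out[OF assms] Vsp_0 by metis

lemma Send_diff:
  assumes "\<phi> \<in> Send r" "x \<in> Vsp r" "y \<in> Vsp r" shows "\<phi> (x - y) = \<phi> x - \<phi> y"
  using Send_add[OF assms(1) _ assms(3), of "x - y"] assms(2,3) by (simp add: algebra_simps Vsp_diff)

lemma Send_sum:
  fixes f :: "'i \<Rightarrow> vec"
  assumes "\<phi> \<in> Send r" "\<And>i. i \<in> A \<Longrightarrow> f i \<in> Vsp r"
  shows "\<phi> (\<Sum>i\<in>A. f i) = (\<Sum>i\<in>A. \<phi> (f i))"
proof (cases "finite A")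
  case True
  then show ?thesis using assms(2)
  proof (induction A)
    case empty
    then show ?case using assms(1) by (simp only: sum.empty Send_0)
  next
    case (insert a A)
    then have "\<phi> (f a + sum f A) = \<phi> (f a) + \<phi> (sum f A)"
      by (intro Send_add[OF assms(1)] Vsp_sum) auto
    also have "\<dots> = \<phi> (f a) + (\<Sum>i\<in>A. \<phi> (f i))" using insert by simp
    finally have "\<phi> (sum f (insert a A)) = (\<Sum>i\<in>insert a A. \<phi> (f i))" using insert(1,2) by simp
    then show ?case .
  qed
qed (simp add: Send_0[OF assms(1)])

lemma Send_HT:
  assumes "\<phi> \<in> Send r" "x \<in> Vsp r" "\<sigma> \<in> perms r"
  shows "\<phi> (HT r \<sigma> x) = HT r \<sigma> (\<phi> x)"
proof -
  have "\<forall>j\<in>set js. Suc j < r \<Longrightarrow> x \<in> Vsp r \<Longrightarrow> \<phi> (fold (TT r) js x) = fold (TT r) js (\<phi> x)" for js x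
    by (induction js arbitrary: x) (auto simp: Send_TT[OF assms(1)] TT_Vsp)
  then show ?thesis using red_rword[OF assms(3)] assms(2) by (auto simp: HT_def red_def)
qed

lemma Send_Sym:
  assumes "\<phi> \<in> Send r" "x \<in> Vsp r"
  shows "\<phi> (Sym r q b x) = Sym r q b (\<phi> x)"
  unfolding Sym_def using assms yg_perms[of _ r b]
  by (subst Send_sum[OF assms(1)]) (auto simp: Send_sm Send_HT HT_Vsp)

lemma Send_plus [intro]:
  assumes "\<phi> \<in> Send r" "\<psi> \<in> Send r" shows "\<phi> + \<psi> \<in> Send r"
  by (rule SendI) (auto simp: SendD[OF assms(1)] SendD[OF assms(2)] TT_linear sm_distribs)

lemma Send_scale [intro]:
  assumes "\<phi> \<in> Send r" shows "(\<lambda>x. sm c (\<phi> x)) \<in> Send r"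
  by (rule SendI) (auto simp: SendD[OF assms] TT_linear sm_distribs mult.commute)

lemma Send_comp [intro]:
  assumes "\<phi> \<in> Send r" "\<psi> \<in> Send r" shows "\<phi> \<circ> \<psi> \<in> Send r"
  by (rule SendI) (auto simp: SendD[OF assms(1)] SendD[OF assms(2)] Send_0[OF assms(1)])

lemma Send_zero [intro, simp]: "0 \<in> Send r"
  by (rule SendI) (auto simp: TT_linear)

lemma Send_one [intro, simp]: "oneS r \<in> Send r"
  by (rule SendI) (auto simp: oneS_def TT_Vsp)

lemma sum_fun_apply2: "(\<Sum>i\<in>A. f i) x = (\<Sum>i\<in>A. f i x)" for f :: "'i \<Rightarrow> vec \<Rightarrow> vec"
  by (induction A rule: infinite_finite_induct) auto

lemma kproj_apply: "x \<in> Vsp r \<Longrightarrow> kproj r \<kappa> x = (\<lambda>w. if cnt w = \<kappa> then x w else 0)"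
  by (simp add: kproj_def)

lemma Send_kproj [intro, simp]: "kproj r \<kappa> \<in> Send r"
proof (rule SendI)
  show "kproj r \<kappa> x \<in> Vsp r" if "x \<in> Vsp r" for x
  proof -
    have "{w. kproj r \<kappa> x w \<noteq> 0} \<subseteq> {w. x w \<noteq> 0}" using that by (auto simp: kproj_apply)
    then show ?thesis using that finite_subset[OF _ Vsp_finite[OF that]] by (auto simp: Vsp_def kproj_apply)
  qed
  show "kproj r \<kappa> (TT r j x) = TT r j (kproj r \<kappa> x)" if "Suc j < r" "x \<in> Vsp r" for j x
    using that TT_Vsp[OF that(2,1)] by (auto simp: kproj_apply TT_def fun_eq_iff cnt_swp)
qed (auto simp: kproj_def fun_eq_iff sm_apply)

definition hsub :: "nat \<Rightarrow> vec set \<Rightarrow> bool" where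
  "hsub r N \<longleftrightarrow> N \<subseteq> Vsp r \<and> qvs.subspace N \<and> (\<forall>j x. Suc j < r \<longrightarrow> x \<in> N \<longrightarrow> TT r j x \<in> N)"

definition hsimple :: "nat \<Rightarrow> vec set \<Rightarrow> bool" where
  "hsimple r N \<longleftrightarrow> hsub r N \<and> N \<noteq> {0} \<and> (\<forall>N'. N' \<subseteq> N \<and> hsub r N' \<longrightarrow> N' = {0} \<or> N' = N)"

definition fd :: "vec set \<Rightarrow> bool" where
  "fd N \<longleftrightarrow> (\<exists>G. finite G \<and> N \<subseteq> qvs.span G)"

lemma hsub_Vsp: "hsub r N \<Longrightarrow> x \<in> N \<Longrightarrow> x \<in> Vsp r"
  and hsub_subspace: "hsub r N \<Longrightarrow> qvs.subspace N"
  and hsub_TT: "hsub r N \<Longrightarrow> Suc j < r \<Longrightarrow> x \<in> N \<Longrightarrow> TT r j x \<in> N"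
  by (auto simp: hsub_def)

lemma hsub_HT:
  assumes "hsub r N" "x \<in> N" "\<sigma> \<in> perms r" shows "HT r \<sigma> x \<in> N"
  using assms(3)
proof (induction rule: perms_induct)
  case (adj \<tau> j)
  then have "HT r (\<tau> \<circ> adj j) x \<in> N" using TT_HT_asc[of \<tau> r j x] hsub_TT[OF assms(1)] by metis
  then show ?case .
qed (use assms in \<open>simp only: HT_id\<close>)

lemma hsub_Sym: "hsub r N \<Longrightarrow> x \<in> N \<Longrightarrow> Sym r q b x \<in> N"
  unfolding Sym_def
  by (intro qvs.subspace_sum qvs.subspace_scale hsub_subspace hsub_HT) (auto dest: yg_perms)

lemma hsimple_hsub: "hsimple r N \<Longrightarrow> hsub r N"
  and hsimple_nontrivial: "hsimple r N \<Longrightarrow> N \<noteq> {0}"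
  and hsimple_sub: "hsimple r N \<Longrightarrow> N' \<subseteq> N \<Longrightarrow> hsub r N' \<Longrightarrow> N' = {0} \<or> N' = N"
  by (auto simp: hsimple_def)

lemma hsub_Send_image:
  assumes "\<phi> \<in> Send r" "hsub r N" shows "hsub r (\<phi> ` N)"
  unfolding hsub_def
proof (intro conjI allI impI)
  have N: "x \<in> Vsp r" if "x \<in> N" for x using assms(2) that by (rule hsub_Vsp)
  note S = hsub_subspace[OF assms(2)]
  show "\<phi> ` N \<subseteq> Vsp r" using assms(1) by auto
  show "qvs.subspace (\<phi> ` N)"
  proof (rule qvs.subspaceI)
    show "0 \<in> \<phi> ` N" using qvs.subspace_0[OF S] Send_0[OF assms(1)] by force
    show "x + y \<in> \<phi> ` N" if "x \<in> \<phi> ` N" "y \<in> \<phi> ` N" for x y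
      using that Send_add[OF assms(1)] N qvs.subspace_add[OF S] by (auto simp: image_iff) metis
    show "sm c x \<in> \<phi> ` N" if "x \<in> \<phi> ` N" for c x
      using that Send_sm[OF assms(1)] N qvs.subspace_scale[OF S] by (auto simp: image_iff) metis
  qed
  show "TT r j x \<in> \<phi> ` N" if "Suc j < r" "x \<in> \<phi> ` N" for j x
    using that Send_TT[OF assms(1)] N hsub_TT[OF assms(2)] by (auto simp: image_iff) metis
qed

lemma hsub_kernel:
  assumes "\<phi> \<in> Send r" "hsub r N" shows "hsub r {x\<in>N. \<phi> x = 0}"
  unfolding hsub_def
proof (intro conjI allI impI)
  have N: "x \<in> Vsp r" if "x \<in> N" for x using assms(2) that by (rule hsub_Vsp)
  note S = hsub_subspace[OF assms(2)]
  show "{x\<in>N. \<phi> x = 0} \<subseteq> Vsp r" using N by auto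
  show "qvs.subspace {x\<in>N. \<phi> x = 0}"
    using S N by (auto intro!: qvs.subspaceI simp: Send_add[OF assms(1)] Send_sm[OF assms(1)]
        Send_0[OF assms(1)] qvs.subspace_0 qvs.subspace_add qvs.subspace_scale)
  show "TT r j x \<in> {x\<in>N. \<phi> x = 0}" if "Suc j < r" "x \<in> {x\<in>N. \<phi> x = 0}" for j x
    using that Send_TT[OF assms(1)] N hsub_TT[OF assms(2)] by (auto simp: TT_linear)
qed

section \<open>Finite-dimensional submodules and orthogonal projections\<close>

lemma fd_subset: "fd N \<Longrightarrow> N' \<subseteq> N \<Longrightarrow> fd N'"
  unfolding fd_def by blast

lemma fd_basis:
  assumes "fd N" obtains B where "finite B" "B \<subseteq> N" "N \<subseteq> qvs.span B" "qvs.independent B"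
  using assms qvs.basis_exists[of N] qvs.independent_span_bound unfolding fd_def by (metis subset_trans)

lemma fd_Send_image:
  assumes "\<phi> \<in> Send r" "fd N" "N \<subseteq> Vsp r" shows "fd (\<phi> ` N)"
proof -
  obtain B where B: "finite B" "B \<subseteq> N" "N \<subseteq> qvs.span B" using fd_basis[OF assms(2)] .
  have "\<phi> x \<in> qvs.span (\<phi> ` B)" if "x \<in> N" for x
  proof -
    have "x \<in> range (\<lambda>u. \<Sum>v\<in>B. sm (u v) v)" using that B(3) qvs.span_finite[OF B(1)] by blast
    then obtain u where u: "x = (\<Sum>v\<in>B. sm (u v) v)" by blast
    have "\<phi> x = (\<Sum>v\<in>B. sm (u v) (\<phi> v))" unfolding u
      using B assms by (subst Send_sum[OF assms(1)]) (auto intro!: sum.cong simp: Send_sm[OF assms(1)] subset_eq)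
    also have "\<dots> \<in> qvs.span (\<phi> ` B)"
      by (intro qvs.span_sum qvs.span_scale qvs.span_base imageI)
    finally show ?thesis .
  qed
  then show ?thesis unfolding fd_def using B by (intro exI[of _ "\<phi> ` B"]) auto
qed

text \<open>Gram-Schmidt without normalisation, hence without square roots: the new spanning vector
  is replaced by its component \<open>s1\<close> orthogonal to the earlier ones.\<close>

lemma projection_exists:
  assumes "finite S" "S \<subseteq> Vsp r" "x \<in> Vsp r"
  shows "\<exists>a\<in>qvs.span S. \<forall>y\<in>qvs.span S. ip (x - a) y = 0"
  using assms
proof (induction S arbitrary: x)
  case (insert s S)
  have spV: "y \<in> Vsp r" if "y \<in> qvs.span S" for y
    using that insert.prems qvs.span_minimal[OF _ Vsp_subspace, of S r] by auto
  have IH: "\<exists>a\<in>qvs.span S. \<forall>y\<in>qvs.span S. ip (z - a) y = 0" if "z \<in> Vsp r" for z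
    using insert.IH[of z] insert.prems that by blast
  obtain s0 where s0: "s0 \<in> qvs.span S" "\<forall>y\<in>qvs.span S. ip (s - s0) y = 0"
    using IH[of s] insert.prems by blast
  obtain x0 where x0: "x0 \<in> qvs.span S" "\<forall>y\<in>qvs.span S. ip (x - x0) y = 0"
    using IH[of x] insert.prems by blast
  define s1 where "s1 = s - s0"
  \<comment> \<open>If \<open>s\<close> already lies in the old span, \<open>s1\<close> may be zero;
    division by zero then gives \<open>c = 0\<close>, which is the right value.\<close>
  define c where "c = ip (x - x0) s1 / ip s1 s1"
  have V: "s \<in> Vsp r" "s0 \<in> Vsp r" "x0 \<in> Vsp r" "s1 \<in> Vsp r" "x \<in> Vsp r"
    using insert.prems s0 x0 spV by (auto simp: s1_def)
  have c: "ip (x - x0) s1 - c * ip s1 s1 = 0"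
  proof (cases "s1 = 0")
    case False
    then have "ip s1 s1 \<noteq> 0" using ip_definite V by blast
    then show ?thesis by (simp add: c_def)
  qed simp
  have "x0 + sm c s1 \<in> qvs.span (insert s S)"
    using x0 s0 unfolding s1_def
    by (intro qvs.span_add qvs.span_scale qvs.span_diff) (auto intro: qvs.span_base qvs.span_mono[THEN subsetD])
  moreover have "ip (x - (x0 + sm c s1)) y = 0" if y: "y \<in> qvs.span (insert s S)" for y
  proof -
    obtain k where k: "y - sm k s \<in> qvs.span S" using y qvs.span_breakdown_eq[of y s S] by blast
    define y0 where "y0 = (y - sm k s) + sm k s0"
    have y0: "y0 \<in> qvs.span S" "y = y0 + sm k s1"
      using k s0 by (auto simp: y0_def s1_def sm_distribs intro: qvs.span_add qvs.span_scale)
    have e: "ip (x - (x0 + sm c s1)) z = ip (x - x0) z - c * ip s1 z" if "z \<in> Vsp r" for z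
      using V that ip_diff_left[of "x - x0" r "sm c s1" z] ip_sm_left[of s1 r z c]
      by (simp add: diff_diff_eq)
    have "ip (x - (x0 + sm c s1)) y0 = 0"
      using x0(2) s0(2) y0(1) e[OF spV[OF y0(1)]] by (simp add: s1_def)
    moreover have "ip (x - (x0 + sm c s1)) s1 = 0" using e[OF V(4)] c by simp
    ultimately show ?thesis by (simp add: y0(2) ip_add_right ip_sm_right)
  qed
  ultimately show ?case by blast
qed (auto intro: bexI[of _ 0])

definition pr :: "nat \<Rightarrow> vec set \<Rightarrow> vec \<Rightarrow> vec" where
  "pr r N x = (if x \<in> Vsp r then (THE a. a \<in> N \<and> (\<forall>y\<in>N. ip (x - a) y = 0)) else 0)"

lemma pr_unique:
  assumes "hsub r N" "x \<in> Vsp r" "a \<in> N" "\<forall>y\<in>N. ip (x - a) y = 0"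
  shows "pr r N x = a"
proof -
  have "a' = a" if a': "a' \<in> N" "\<forall>y\<in>N. ip (x - a') y = 0" for a'
  proof -
    have d: "a - a' \<in> N" using assms(1,3) a'(1) hsub_subspace qvs.subspace_diff by blast
    note V = hsub_Vsp[OF assms(1,3)] hsub_Vsp[OF assms(1) a'(1)] hsub_Vsp[OF assms(1) d]
    have "ip (a - a') (a - a') = ip (x - a') (a - a') - ip (x - a) (a - a')"
      using ip_diff_left[of "x - a'" r "x - a" "a - a'"] V assms(2) by (simp add: algebra_simps)
    also have "\<dots> = 0" using assms(4) a'(2) d by simp
    finally have "a - a' = 0" using ip_definite V(3) by blast
    then show ?thesis by simp
  qed
  then have "(THE a. a \<in> N \<and> (\<forall>y\<in>N. ip (x - a) y = 0)) = a"
    using assms(3,4) by (intro the_equality) blast+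
  then show ?thesis using assms(2) by (simp add: pr_def)
qed

lemma pr_props:
  assumes "hsub r N" "fd N" "x \<in> Vsp r"
  shows pr_mem: "pr r N x \<in> N" and pr_orth: "y \<in> N \<Longrightarrow> ip (x - pr r N x) y = 0"
proof -
  obtain B where B: "finite B" "B \<subseteq> N" "N \<subseteq> qvs.span B" using fd_basis[OF assms(2)] .
  have N: "N = qvs.span B" using qvs.span_minimal[OF B(2) hsub_subspace[OF assms(1)]] B(3) by blast
  have "B \<subseteq> Vsp r" using B(2) hsub_Vsp[OF assms(1)] by blast
  obtain a where a: "a \<in> N" "\<forall>y\<in>N. ip (x - a) y = 0"
    using projection_exists[OF B(1) \<open>B \<subseteq> Vsp r\<close> assms(3)] unfolding N[symmetric] by blast
  with pr_unique[OF assms(1,3)] show "pr r N x \<in> N" "y \<in> N \<Longrightarrow> ip (x - pr r N x) y = 0" by auto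
qed

lemma pr_id: "hsub r N \<Longrightarrow> x \<in> N \<Longrightarrow> pr r N x = x"
  by (rule pr_unique) (auto simp: hsub_Vsp)

text \<open>By \<open>pr_unique\<close>, each law only requires that the expected value lies in
  \<open>N\<close> and leaves a remainder orthogonal to \<open>N\<close>. For the generators this
  combines self-adjointness with the stability of \<open>N\<close>.\<close>

lemma pr_Send:
  assumes "hsub r N" "fd N" shows "pr r N \<in> Send r"
proof (rule SendI)
  note S = hsub_subspace[OF assms(1)] and mem = pr_mem[OF assms] and orth = pr_orth[OF assms]
  have V: "pr r N x \<in> Vsp r" if "x \<in> Vsp r" for x using hsub_Vsp[OF assms(1)] mem that by blast
  then show "x \<in> Vsp r \<Longrightarrow> pr r N x \<in> Vsp r" for x .
  show "pr r N (x + y) = pr r N x + pr r N y" if xy: "x \<in> Vsp r" "y \<in> Vsp r" for x y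
  proof (rule pr_unique[OF assms(1)])
    show "\<forall>z\<in>N. ip (x + y - (pr r N x + pr r N y)) z = 0"
    proof
      fix z assume z: "z \<in> N"
      have "x + y - (pr r N x + pr r N y) = (x - pr r N x) + (y - pr r N y)" by simp
      then show "ip (x + y - (pr r N x + pr r N y)) z = 0"
        using ip_add_left[of "x - pr r N x" r "y - pr r N y" z] orth z V xy hsub_Vsp[OF assms(1) z]
        by (simp only: Vsp_diff)
    qed
  qed (use xy mem S in \<open>auto intro: qvs.subspace_add\<close>)
  show "pr r N (sm c x) = sm c (pr r N x)" if x: "x \<in> Vsp r" for c x
  proof (rule pr_unique[OF assms(1)])
    show "\<forall>z\<in>N. ip (sm c x - sm c (pr r N x)) z = 0"
      using ip_sm_left[of "x - pr r N x" r _ c] orth x V hsub_Vsp[OF assms(1)]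
      by (simp flip: sm_distribs(2))
  qed (use x mem S in \<open>auto intro: qvs.subspace_scale\<close>)
  show "pr r N (TT r j x) = TT r j (pr r N x)" if j: "Suc j < r" and x: "x \<in> Vsp r" for j x
  proof (rule pr_unique[OF assms(1)])
    show "\<forall>z\<in>N. ip (TT r j x - TT r j (pr r N x)) z = 0"
      using TT_selfadjoint[of "x - pr r N x" r _ j] orth x V j hsub_Vsp[OF assms(1)] hsub_TT[OF assms(1) j]
      by (simp flip: TT_linear(3))
  qed (use x j mem hsub_TT[OF assms(1)] in auto)
qed (simp add: pr_def)

lemma hsub_orth:
  assumes "hsub r N" "hsub r N'" shows "hsub r {x\<in>N. \<forall>y\<in>N'. ip x y = 0}"
  unfolding hsub_def
proof (intro conjI allI impI)
  have N: "x \<in> Vsp r" if "x \<in> N" for x using assms(1) that by (rule hsub_Vsp)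
  have N': "x \<in> Vsp r" if "x \<in> N'" for x using assms(2) that by (rule hsub_Vsp)
  note S = hsub_subspace[OF assms(1)]
  show "{x\<in>N. \<forall>y\<in>N'. ip x y = 0} \<subseteq> Vsp r" using N by auto
  show "qvs.subspace {x\<in>N. \<forall>y\<in>N'. ip x y = 0}"
    using N N' by (auto intro!: qvs.subspaceI simp: ip_add_left[of _ r] ip_sm_left[of _ r]
        qvs.subspace_0[OF S] qvs.subspace_add[OF S] qvs.subspace_scale[OF S])
  show "TT r j x \<in> {x\<in>N. \<forall>y\<in>N'. ip x y = 0}"
    if "Suc j < r" "x \<in> {x\<in>N. \<forall>y\<in>N'. ip x y = 0}" for j x
    using that N N' hsub_TT[OF assms(1)] hsub_TT[OF assms(2)] by (auto simp: TT_selfadjoint[of _ r])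
qed

section \<open>Homomorphisms on simple submodules: Schur's lemma\<close>

lemma hsimple_Send_image:
  assumes "\<phi> \<in> Send r" "hsimple r P" "x \<in> P" "\<phi> x \<noteq> 0"
  shows "inj_on \<phi> P" "hsimple r (\<phi> ` P)"
proof -
  note H = hsimple_hsub[OF assms(2)]
  have V: "y \<in> Vsp r" if "y \<in> P" for y using hsub_Vsp[OF H that] .
  have "{y\<in>P. \<phi> y = 0} = {0}"
    using hsimple_sub[OF assms(2) _ hsub_kernel[OF assms(1) H]] assms(3,4) by blast
  then have k: "y = 0" if "y \<in> P" "\<phi> y = 0" for y using that by blast
  show inj: "inj_on \<phi> P"
  proof (rule inj_onI)
    fix y z assume yz: "y \<in> P" "z \<in> P" "\<phi> y = \<phi> z"
    have "y - z \<in> P" using qvs.subspace_diff[OF hsub_subspace[OF H] yz(1,2)] .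
    moreover have "\<phi> (y - z) = 0" using Send_diff[OF assms(1) V[OF yz(1)] V[OF yz(2)]] yz(3) by simp
    ultimately have "y - z = 0" by (rule k)
    then show "y = z" by simp
  qed
  show "hsimple r (\<phi> ` P)"
    unfolding hsimple_def
  proof (intro conjI allI impI)
    show "hsub r (\<phi> ` P)" using hsub_Send_image assms(1) H .
    show "\<phi> ` P \<noteq> {0}" using assms(3,4) by auto
    fix N' assume N': "N' \<subseteq> \<phi> ` P \<and> hsub r N'"
    define K where "K = {y\<in>P. \<phi> y \<in> N'}"
    note SN = hsub_subspace[OF conjunct2[OF N']] and SP = hsub_subspace[OF H]
    have "hsub r K" unfolding hsub_def K_def
    proof (intro conjI allI impI)
      show "{y\<in>P. \<phi> y \<in> N'} \<subseteq> Vsp r" using V by auto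
      show "qvs.subspace {y\<in>P. \<phi> y \<in> N'}"
        using V by (auto intro!: qvs.subspaceI simp: Send_add[OF assms(1)] Send_sm[OF assms(1)] Send_0[OF assms(1)]
          qvs.subspace_0[OF SP] qvs.subspace_add[OF SP] qvs.subspace_scale[OF SP]
          qvs.subspace_0[OF SN] qvs.subspace_add[OF SN] qvs.subspace_scale[OF SN])
      show "TT r j y \<in> {y\<in>P. \<phi> y \<in> N'}" if "Suc j < r" "y \<in> {y\<in>P. \<phi> y \<in> N'}" for j y
        using that V hsub_TT[OF H] hsub_TT[OF conjunct2[OF N']] by (auto simp: Send_TT[OF assms(1)])
    qed
    then have "K = {0} \<or> K = P" using hsimple_sub[OF assms(2), of K] by (auto simp: K_def)
    moreover have "N' = \<phi> ` K" using N' by (auto simp: K_def)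
    ultimately show "N' = {0} \<or> N' = \<phi> ` P" using Send_0[OF assms(1)] by auto
  qed
qed

text \<open>The inverse of \<open>\<phi>\<close> on the image of \<open>P\<close> is extended to all
  of tensor space by applying the orthogonal projection onto that image first. This keeps the
  inverse inside the Schur algebra.\<close>

lemma hsimple_left_inverse:
  assumes "\<phi> \<in> Send r" "hsimple r P" "fd P" "x \<in> P" "\<phi> x \<noteq> 0"
  shows "\<exists>\<psi>\<in>Send r. \<forall>y\<in>P. \<psi> (\<phi> y) = y"
proof -
  note H = hsimple_hsub[OF assms(2)]
  have V: "y \<in> Vsp r" if "y \<in> P" for y using hsub_Vsp[OF H that] .
  note inj = hsimple_Send_image(1)[OF assms(1,2,4,5)]
  let ?Q = "\<phi> ` P"
  have Q: "hsub r ?Q" "fd ?Q" using hsub_Send_image[OF assms(1) H] fd_Send_image[OF assms(1,3)] V by auto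
  note S = pr_Send[OF Q] and SP = hsub_subspace[OF H]
  define g where "g = inv_into P \<phi>"
  have g: "g (\<phi> y) = y" if "y \<in> P" for y using inj that by (simp add: g_def)
  have gP: "g y \<in> P" "\<phi> (g y) = y" if "y \<in> ?Q" for y using that g by auto
  define \<psi> where "\<psi> y = (if y \<in> Vsp r then g (pr r ?Q y) else 0)" for y
  have ga: "g (y + z) = g y + g z" if yz: "y \<in> ?Q" "z \<in> ?Q" for y z
    using yz g qvs.subspace_add[OF SP] by (auto simp: Send_add[OF assms(1), symmetric] V)
  have gs: "g (sm c y) = sm c (g y)" if "y \<in> ?Q" for c y
    using that g qvs.subspace_scale[OF SP] by (auto simp: Send_sm[OF assms(1), symmetric] V)
  have gT: "g (TT r j y) = TT r j (g y)" if "y \<in> ?Q" "Suc j < r" for j y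
    using that g hsub_TT[OF H] by (auto simp: Send_TT[OF assms(1), symmetric] V)
  have m: "pr r ?Q y \<in> ?Q" if "y \<in> Vsp r" for y using pr_mem[OF Q that] .
  have "\<psi> \<in> Send r"
    by (rule SendI)
      (use m gP V in \<open>auto simp: \<psi>_def Send_add[OF S] Send_sm[OF S] Send_TT[OF S] ga gs gT TT_Vsp\<close>)
  moreover have "\<psi> (\<phi> y) = y" if "y \<in> P" for y
    using that pr_id[OF Q(1)] g by (auto simp: \<psi>_def Send_Vsp[OF assms(1)] V)
  ultimately show ?thesis by blast
qed

subsection \<open>Homomorphisms out of the regular summand\<close>

lemma length_omega [simp]: "length (omega_varpi r) = r"
  and nth_omega: "p < r \<Longrightarrow> omega_varpi r ! p = int p + 1"
  by (auto simp: omega_varpi_def)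

lemma cnt_omega: "cnt (omega_varpi r) = varpi r"
  by (auto simp: cnt_def omega_varpi_def varpi_def fun_eq_iff count_notin
      count_mset[symmetric] distinct_count_atmost_1[THEN iffD1, rule_format])

abbreviation wd :: "nat \<Rightarrow> (nat \<Rightarrow> nat) \<Rightarrow> int list" where
  "wd r \<sigma> \<equiv> permute_list \<sigma> (omega_varpi r)"

lemma wd_nth: "\<sigma> \<in> perms r \<Longrightarrow> p < r \<Longrightarrow> wd r \<sigma> ! p = int (\<sigma> p) + 1"
  by (simp add: permute_nth nth_omega perms_less_iff)

lemma wd_inj: assumes "\<sigma> \<in> perms r" "\<tau> \<in> perms r" "wd r \<sigma> = wd r \<tau>" shows "\<sigma> = \<tau>"
proof
  fix p show "\<sigma> p = \<tau> p"
  proof (cases "p < r")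
    case True
    then show ?thesis using wd_nth[OF assms(1)] wd_nth[OF assms(2)] assms(3) by fastforce
  next
    case False
    then show ?thesis using assms by (auto simp: perms_permutes permutes_def)
  qed
qed

lemma HT_omega: "\<sigma> \<in> perms r \<Longrightarrow> HT r \<sigma> (ebas (omega_varpi r)) = ebas (wd r \<sigma>)"
  by (rule HT_ebas_block[of "replicate r 0"]) (auto simp: yg_const nth_omega)

text \<open>The homomorphism that sends the free generator \<open>ebas (omega_varpi r)\<close> of
  the regular summand to \<open>u\<close> and kills all other weight spaces.\<close>

definition Phi :: "nat \<Rightarrow> vec \<Rightarrow> vec \<Rightarrow> vec" where
  "Phi r u x = (if x \<in> Vsp r then \<Sum>\<sigma>\<in>perms r. sm (x (wd r \<sigma>)) (HT r \<sigma> u) else 0)"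

lemma TT_wd:
  assumes "Suc j < r" "\<sigma> \<in> perms r"
  shows "TT r j x (wd r \<sigma>) = x (wd r (\<sigma> \<circ> adj j)) + (if \<sigma> (Suc j) < \<sigma> j then hh * x (wd r \<sigma>) else 0)"
proof -
  have "\<sigma> j \<noteq> \<sigma> (Suc j)" using perms_inj[OF assms(2)] by simp
  then show ?thesis using assms by (simp add: TT_def wd_nth permute_adj)
qed

lemma Phi_Send:
  assumes "u \<in> Vsp r" shows "Phi r u \<in> Send r"
proof (rule SendI)
  show "Phi r u x \<in> Vsp r" if "x \<in> Vsp r" for x
    using assms by (auto simp: Phi_def intro!: Vsp_sum)
  show "Phi r u (x + y) = Phi r u x + Phi r u y" if "x \<in> Vsp r" "y \<in> Vsp r" for x y
    using that by (auto simp: Phi_def sm_distribs sum.distrib)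
  show "Phi r u (sm c x) = sm c (Phi r u x)" if "x \<in> Vsp r" for c x
    using that by (auto simp: Phi_def sm_sum sm_apply)
  show "Phi r u (TT r j x) = TT r j (Phi r u x)" if j: "Suc j < r" and x: "x \<in> Vsp r" for j x
  proof -
    have y: "yg r (replicate r 0) = perms r" by (rule yg_const) simp
    let ?d = "\<lambda>\<sigma>. sm (if \<sigma> (Suc j) < \<sigma> j then hh * x (wd r \<sigma>) else 0) (HT r \<sigma> u)"
    have "Phi r u (TT r j x) = (\<Sum>\<sigma>\<in>perms r. sm (x (wd r (\<sigma> \<circ> adj j))) (HT r \<sigma> u)) + (\<Sum>\<sigma>\<in>perms r. ?d \<sigma>)"
      unfolding sum.distrib[symmetric] Phi_def using x j TT_Vsp
      by (auto simp: TT_wd sm_distribs(3) intro!: sum.cong)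
    also have "(\<Sum>\<sigma>\<in>perms r. sm (x (wd r (\<sigma> \<circ> adj j))) (HT r \<sigma> u)) = (\<Sum>\<sigma>\<in>perms r. sm (x (wd r \<sigma>)) (HT r (\<sigma> \<circ> adj j) u))"
      using sum_perms_adj(1)[of j r "replicate r 0" "\<lambda>\<sigma>. sm (x (wd r (\<sigma> \<circ> adj j))) (HT r \<sigma> u)"] j
      by (simp add: y)
    also have "\<dots> + (\<Sum>\<sigma>\<in>perms r. ?d \<sigma>) = TT r j (Phi r u x)"
      unfolding sum.distrib[symmetric] Phi_def using x j
    proof (simp add: TT_sum, intro sum.cong refl)
      fix \<sigma> assume s: "\<sigma> \<in> perms r"
      have "\<sigma> j \<noteq> \<sigma> (Suc j)" using perms_inj[OF s] by simp
      then show "sm (x (wd r \<sigma>)) (HT r (\<sigma> \<circ> adj j) u) + ?d \<sigma> = TT r j (sm (x (wd r \<sigma>)) (HT r \<sigma> u))"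
        using TT_HT_asc[OF s j, of u] TT_HT_desc[OF s j, of u]
        by (cases "\<sigma> (Suc j) < \<sigma> j") (auto simp: TT_linear sm_distribs(1) mult.commute)
    qed
    finally show ?thesis .
  qed
qed (simp add: Phi_def)

lemma Phi_omega:
  assumes "u \<in> Vsp r" shows "Phi r u (ebas (omega_varpi r)) = u"
proof -
  have "sm (ebas (omega_varpi r) (wd r \<sigma>)) (HT r \<sigma> u) = (if \<sigma> = id then u else 0)" if "\<sigma> \<in> perms r" for \<sigma>
    using wd_inj[OF that perms_id] by (auto simp: ebas_apply)
  then have "Phi r u (ebas (omega_varpi r)) = (\<Sum>\<sigma>\<in>perms r. if \<sigma> = id then u else 0)"
    by (simp add: Phi_def ebas_Vsp)
  then show ?thesis by simp
qed

lemma kproj_varpi: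
  assumes "x \<in> Vsp r"
  shows "kproj r (varpi r) x = (\<Sum>\<sigma>\<in>perms r. sm (x (wd r \<sigma>)) (ebas (wd r \<sigma>)))"
proof -
  have inj: "inj_on (wd r) (perms r)" by (auto intro!: inj_onI wd_inj)
  have "kproj r (varpi r) x = (\<Sum>w\<in>wd r ` perms r. sm (kproj r (varpi r) x w) (ebas w))"
  proof (rule Vsp_expand)
    fix w assume "kproj r (varpi r) x w \<noteq> 0"
    then have "cnt w = cnt (omega_varpi r)" using assms by (auto simp: kproj_apply cnt_omega split: if_splits)
    then obtain \<sigma> where "\<sigma> \<in> perms r" "wd r \<sigma> = w" by (rule cnt_eq_permute) simp_all
    then show "w \<in> wd r ` perms r" by blast
  qed simp
  also have "\<dots> = (\<Sum>\<sigma>\<in>perms r. sm (x (wd r \<sigma>)) (ebas (wd r \<sigma>)))"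
    using assms by (subst sum.reindex[OF inj]) (auto simp: kproj_apply cnt_permute cnt_omega intro!: sum.cong)
  finally show ?thesis .
qed

text \<open>The coefficients chosen in \<open>zmu\<close> are forced, because different permutations
  give different words \<open>wd r \<sigma>\<close>.\<close>

lemma zmu_eq_Phi:
  assumes "umu r \<mu> \<in> Vsp r" shows "zmu r \<mu> = Phi r (umu r \<mu>)"
proof
  fix x
  show "zmu r \<mu> x = Phi r (umu r \<mu>) x"
  proof (cases "x \<in> Vsp r")
    case True
    let ?P = "\<lambda>c. kproj r (varpi r) x = (\<Sum>\<sigma>\<in>perms r. sm (c \<sigma>) (hT r \<sigma> (ebas (omega_varpi r))))"
    have h: "hT r \<sigma> (ebas (omega_varpi r)) = ebas (wd r \<sigma>)" if "\<sigma> \<in> perms r" for \<sigma>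
      using that by (simp add: hT_eq_HT ebas_Vsp HT_omega)
    define c where "c = (SOME c. ?P c)"
    have "?P (\<lambda>\<sigma>. x (wd r \<sigma>))" using kproj_varpi[OF True] h by simp
    then have "?P c" unfolding c_def by (rule someI[of ?P])
    then have c: "kproj r (varpi r) x = (\<Sum>\<sigma>\<in>perms r. sm (c \<sigma>) (ebas (wd r \<sigma>)))" using h by simp
    have "c \<sigma> = x (wd r \<sigma>)" if s: "\<sigma> \<in> perms r" for \<sigma>
    proof -
      have "kproj r (varpi r) x (wd r \<sigma>) = (\<Sum>\<tau>\<in>perms r. if \<tau> = \<sigma> then c \<tau> else 0)"
        unfolding c sum_fun_apply
        by (rule sum.cong) (use wd_inj[OF s] in \<open>auto simp: sm_apply ebas_apply\<close>)
      then show ?thesis using s True by (simp add: kproj_apply cnt_permute cnt_omega)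
    qed
    then show ?thesis using True assms
      by (auto simp: zmu_def Phi_def Let_def c_def[symmetric] hT_eq_HT intro!: sum.cong)
  qed (simp add: zmu_def Phi_def)
qed

subsection \<open>Partitions and column words\<close>

lemma omega_lam_unique:
  assumes "sorted w" "length w = r" "cnt w = \<kappa>" shows "omega_lam r \<kappa> = w"
  unfolding omega_lam_def
proof (rule the_equality)
  fix w' assume "sorted w' \<and> length w' = r \<and> cnt w' = \<kappa>"
  then have "mset w' = mset w" "sorted w'" using assms(3) cnt_mset by auto
  then show "w' = w" using properties_for_sort[of w' w] sorted_sort_id[OF assms(1)] by simp
qed (use assms in simp)

lemma omega_lam_props:
  assumes "\<kappa> \<in> Lam r"
  shows sorted_omega_lam: "sorted (omega_lam r \<kappa>)" and length_omega_lam: "length (omega_lam r \<kappa>) = r"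
    and cnt_omega_lam: "cnt (omega_lam r \<kappa>) = \<kappa>"
proof -
  define M where "M = Abs_multiset \<kappa>"
  have fin: "finite {i. 0 < \<kappa> i}" using assms by (simp add: Lam_def)
  have M: "count M = \<kappa>" unfolding M_def by (rule Abs_multiset_inverse) (use fin in simp)
  define w where "w = sorted_list_of_multiset M"
  have mw: "mset w = M" by (simp add: w_def)
  have "cnt w = \<kappa>" using M mw by (auto simp: cnt_def count_mset[symmetric] fun_eq_iff)
  moreover have "size M = sum \<kappa> {i. \<kappa> i \<noteq> 0}"
    unfolding size_multiset_overloaded_eq M set_mset_def by (simp add: M)
  then have "length w = r" using assms mw by (metis (mono_tags, lifting) Lam_def mem_Collect_eq size_mset)
  moreover have "sorted w" by (simp add: w_def)
  ultimately have "omega_lam r \<kappa> = w" by (intro omega_lam_unique)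
  then show "sorted (omega_lam r \<kappa>)" "length (omega_lam r \<kappa>) = r" "cnt (omega_lam r \<kappa>) = \<kappa>"
    using \<open>cnt w = \<kappa>\<close> \<open>length w = r\<close> \<open>sorted w\<close> by auto
qed

lemma young_eq_yg: "young r \<kappa> = yg r (omega_lam r \<kappa>)"
  by (simp add: young_def yg_def)

lemma cnt_card: "cnt w x = card {p. p < length w \<and> w ! p = x}"
proof -
  have "cnt w x = length (filter (\<lambda>y. y = x) w)"
    unfolding cnt_def by (induction w) auto
  then show ?thesis by (simp add: length_filter_conv_card)
qed

lemma partitions_Lam: "\<mu> \<in> partitions r \<Longrightarrow> \<mu> \<in> Lam r"
  by (simp add: partitions_def)

lemma partition_nonpos: "\<mu> \<in> partitions r \<Longrightarrow> x \<le> 0 \<Longrightarrow> \<mu> x = 0"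
  by (simp add: partitions_def)

text \<open>For a partition, the rows of length at least \<open>i\<close> form an initial segment of
  the positive integers, so membership of \<open>x\<close> can be read off from its size
  \<open>transp \<mu> i\<close>.\<close>

lemma transp_ge_iff:
  assumes "\<mu> \<in> partitions r" "1 \<le> i" "1 \<le> x"
  shows "x \<le> int (transp \<mu> i) \<longleftrightarrow> i \<le> int (\<mu> x)"
proof -
  let ?D = "{j. i \<le> int (\<mu> j)}"
  have D: "?D \<subseteq> {j. \<mu> j \<noteq> 0}" using assms by auto
  have fin: "finite ?D" by (rule finite_subset[OF D]) (use assms partitions_Lam Lam_def in auto)
  have pos: "j \<in> ?D \<Longrightarrow> 1 \<le> j" for j using partition_nonpos[OF assms(1), of j] assms(2) by fastforce
  have t: "transp \<mu> i = card ?D" using assms by (simp add: transp_def)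
  show ?thesis
  proof
    assume "i \<le> int (\<mu> x)"
    then have "{1..x} \<subseteq> ?D" using assms unfolding partitions_def by force
    then have "card {1..x} \<le> card ?D" using fin by (rule card_mono[rotated])
    then show "x \<le> int (transp \<mu> i)" using t assms by simp
  next
    assume le: "x \<le> int (transp \<mu> i)"
    show "i \<le> int (\<mu> x)"
    proof (rule ccontr)
      assume n: "\<not> i \<le> int (\<mu> x)"
      have "?D \<subseteq> {1..x - 1}"
      proof
        fix j assume j: "j \<in> ?D"
        have "\<not> x \<le> j" using n j assms unfolding partitions_def by force
        then show "j \<in> {1..x - 1}" using pos[OF j] by simp
      qed
      then have "card ?D \<le> card {1..x - 1}" by (rule card_mono[rotated]) simp
      then show False using t le assms by simp
    qed
  qed
qed

text \<open>The boxes are counted by columns and by rows.\<close>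

lemma transp_Lam:
  assumes "\<mu> \<in> partitions r" shows "transp \<mu> \<in> Lam r"
proof -
  have L: "finite {j. \<mu> j \<noteq> 0}" "sum \<mu> {j. \<mu> j \<noteq> 0} = r" using partitions_Lam[OF assms] by (auto simp: Lam_def)
  let ?S = "{j. \<mu> j \<noteq> 0}" and ?M = "int (\<mu> 1)"
  have le: "int (\<mu> j) \<le> ?M" for j
  proof (cases "1 \<le> j")
    case False
    then show ?thesis using partition_nonpos[OF assms, of j] by simp
  qed (use assms in \<open>auto simp: partitions_def\<close>)
  have pos: "i \<in> {1..?M}" if "transp \<mu> i \<noteq> 0" for i
  proof -
    have "1 \<le> i" using that by (auto simp: transp_def split: if_splits)
    then show ?thesis using transp_ge_iff[OF assms, of i 1] that by auto
  qed
  have t: "transp \<mu> i = (\<Sum>j\<in>?S. if i \<le> int (\<mu> j) then 1 else 0)" if "i \<in> {1..?M}" for i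
  proof -
    have "{j. i \<le> int (\<mu> j)} = {j\<in>?S. i \<le> int (\<mu> j)}" using that by auto
    then show ?thesis using that L by (simp add: transp_def sum.If_cases Int_def)
  qed
  have "(\<Sum>i\<in>{i. transp \<mu> i \<noteq> 0}. transp \<mu> i) = (\<Sum>i\<in>{1..?M}. transp \<mu> i)"
    by (rule sum.mono_neutral_left) (use pos in auto)
  also have "\<dots> = (\<Sum>i\<in>{1..?M}. \<Sum>j\<in>?S. if i \<le> int (\<mu> j) then 1 else 0)" using t by simp
  also have "\<dots> = (\<Sum>j\<in>?S. \<Sum>i\<in>{1..?M}. if i \<le> int (\<mu> j) then 1 else 0)" by (rule sum.swap)
  also have "\<dots> = (\<Sum>j\<in>?S. \<mu> j)"
  proof (rule sum.cong[OF refl])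
    fix j
    have "{i\<in>{1..?M}. i \<le> int (\<mu> j)} = {1..int (\<mu> j)}" using le[of j] by auto
    then have "card {i\<in>{1..?M}. i \<le> int (\<mu> j)} = \<mu> j" by simp
    then show "(\<Sum>i\<in>{1..?M}. if i \<le> int (\<mu> j) then 1 else 0) = \<mu> j" by (simp add: sum.If_cases Int_def)
  qed
  finally have "(\<Sum>i\<in>{i. transp \<mu> i \<noteq> 0}. transp \<mu> i) = r" using L by simp
  moreover have "finite {i. transp \<mu> i \<noteq> 0}" by (rule finite_subset[of _ "{1..?M}"]) (use pos in auto)
  ultimately show ?thesis by (simp add: Lam_def)
qed

section \<open>Block-increasing words and the antisymmetriser\<close>

lemma block_increasing:
  fixes f :: "nat \<Rightarrow> 'a::order"
  assumes "sorted b" "length b = r" "\<And>j. Suc j < r \<Longrightarrow> b ! j = b ! Suc j \<Longrightarrow> f j < f (Suc j)"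
    and "p < q" "q < r" "b ! p = b ! q"
  shows "f p < f q"
  using assms(4-6)
proof (induction q)
  case (Suc q)
  have le: "b ! p \<le> b ! q" "b ! q \<le> b ! Suc q"
    by (rule sorted_nth_mono[OF assms(1)]; use Suc.prems assms(2) in simp)+
  then have e: "b ! q = b ! Suc q" "b ! p = b ! q" using Suc.prems(3) by (force intro: antisym)+
  then have "f q < f (Suc q)" using assms(3) Suc.prems(2) by blast
  moreover have "f p < f q" if "p \<noteq> q" using Suc.IH Suc.prems e that by simp
  ultimately show ?case by (cases "p = q") (auto intro: less_trans)
qed simp

text \<open>When the blocks of \<open>b\<close> are the columns of a diagram, these are the
  column-strict fillings, listed column by column.\<close>

definition binc :: "nat \<Rightarrow> int list \<Rightarrow> int list \<Rightarrow> bool" where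
  "binc r b t \<longleftrightarrow> length t = r \<and> (\<forall>p q. p < q \<longrightarrow> q < r \<longrightarrow> b ! p = b ! q \<longrightarrow> t ! p < t ! q)"

definition bdist :: "nat \<Rightarrow> int list \<Rightarrow> int list \<Rightarrow> bool" where
  "bdist r b t \<longleftrightarrow> (\<forall>p<r. \<forall>q<r. p \<noteq> q \<longrightarrow> b ! p = b ! q \<longrightarrow> t ! p \<noteq> t ! q)"

abbreviation qm :: qv where "qm \<equiv> - inverse vv"

lemma qm_quad: "qm * qm = 1 + hh * qm" and qm_neq: "vv \<noteq> qm" "qm \<noteq> 0"
proof -
  show "qm * qm = 1 + hh * qm" by (simp add: algebra_simps)
  have "0 < inverse vv" using vv_pos by simp
  then show "vv \<noteq> qm" using vv_pos by (metis neg_0_less_iff_less order_less_asym)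
qed simp

lemma invs_cong: "(\<And>p. p < r \<Longrightarrow> f p = g p) \<Longrightarrow> invs r f = invs r g"
  unfolding invs_def by (rule arg_cong[where f = card]) auto

text \<open>Straightening, by induction on inversions. Two equal neighbouring letters in a block
  make the antisymmetrised tensor an image for both roots \<open>vv\<close> and \<open>qm\<close>,
  so it vanishes; a descent in a block is swapped away at the price of a factor
  \<open>qm\<close>.\<close>

lemma Sym_ebas_reduce:
  assumes "sorted b" "length b = r" "length t = r"
  shows "Sym r qm b (ebas t) = 0 \<or>
    (\<exists>t' c. c \<noteq> 0 \<and> binc r b t' \<and> cnt t' = cnt t \<and> Sym r qm b (ebas t) = sm c (Sym r qm b (ebas t')))"
  using assms(3)
proof (induction "invs r (nth t)" arbitrary: t rule: less_induct)
  case less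
  let ?S = "Sym r qm b"
  consider j where "Suc j < r" "b ! j = b ! Suc j" "t ! j = t ! Suc j"
    | j where "Suc j < r" "b ! j = b ! Suc j" "t ! Suc j < t ! j"
    | "\<And>j. Suc j < r \<Longrightarrow> b ! j = b ! Suc j \<Longrightarrow> t ! j < t ! Suc j"
    by (meson linorder_neqE)
  then show ?case
  proof cases
    case 1
    have "sm vv (?S (ebas t)) = sm qm (?S (ebas t))"
      using Sym_TT[OF qm_quad 1(1,2), of "ebas t"] TT_ebas_eq[OF less(2) 1(1,3)] by (simp add: Sym_linear)
    then have "sm (vv - qm) (?S (ebas t)) = 0" by (simp only: sm_distribs) simp
    then show ?thesis using qm_neq(1) by (simp only: sm_eq_0_iff) simp
  next
    case (2 j)
    have l: "length (swp j t) = r" using less by simp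
    have "TT r j (ebas (swp j t)) = ebas t"
      using TT_ebas_less[OF l 2(1)] 2 less(2) by (simp add: swp_nth)
    then have S: "?S (ebas t) = sm qm (?S (ebas (swp j t)))"
      using Sym_TT[OF qm_quad 2(1,2), of "ebas (swp j t)"] by simp
    have "invs r (nth (swp j t)) = invs r (nth t \<circ> adj j)"
      using 2 less(2) by (intro invs_cong) (simp add: swp_nth)
    then have "invs r (nth (swp j t)) < invs r (nth t)" using invs_adj[of j r "nth t"] 2 by simp
    from less(1)[OF this l] show ?thesis
    proof
      assume "?S (ebas (swp j t)) = 0"
      then show ?thesis using S by simp
    next
      assume "\<exists>t' c. c \<noteq> 0 \<and> binc r b t' \<and> cnt t' = cnt (swp j t) \<and> ?S (ebas (swp j t)) = sm c (?S (ebas t'))"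
      then obtain t' c where c: "c \<noteq> 0" "binc r b t'" "cnt t' = cnt (swp j t)" "?S (ebas (swp j t)) = sm c (?S (ebas t'))"
        by blast
      have "?S (ebas t) = sm (qm * c) (?S (ebas t'))" unfolding S c(4) by (simp only: sm_simps)
      moreover have "qm * c \<noteq> 0" using c(1) qm_neq(2) by simp
      moreover have "cnt t' = cnt t" using c(3) cnt_swp[of j t] 2(1) less(2) by simp
      ultimately show ?thesis using c(2) by blast
    qed
  next
    case 3
    have "binc r b t" unfolding binc_def using less(2) block_increasing[where f = "nth t", OF assms(1,2) 3] by blast
    then show ?thesis by (intro disjI2 exI[of _ t] exI[of _ 1]) simp
  qed
qed

definition rk :: "int list \<Rightarrow> nat \<Rightarrow> nat" where
  "rk b p = card {p'. p' \<le> p \<and> b ! p' = b ! p}"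

text \<open>The word listing the rows of the boxes of a diagram column by column, when the blocks of
  \<open>b\<close> are its columns. Among block-increasing words with positive letters it is the pointwise minimum.\<close>
definition tc :: "nat \<Rightarrow> int list \<Rightarrow> int list" where
  "tc r b = map (\<lambda>p. int (rk b p)) [0..<r]"

lemma tc_nth: "p < r \<Longrightarrow> tc r b ! p = int (rk b p)" and length_tc [simp]: "length (tc r b) = r"
  by (auto simp: tc_def)

lemma rk_less: "p < q \<Longrightarrow> b ! p = b ! q \<Longrightarrow> rk b p < rk b q"
proof -
  assume pq: "p < q" "b ! p = b ! q"
  have "q \<in> {p'. p' \<le> q \<and> b ! p' = b ! q}" "q \<notin> {p'. p' \<le> p \<and> b ! p' = b ! p}" using pq by auto
  moreover have "{p'. p' \<le> p \<and> b ! p' = b ! p} \<subseteq> {p'. p' \<le> q \<and> b ! p' = b ! q}" using pq by auto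
  ultimately have "{p'. p' \<le> p \<and> b ! p' = b ! p} \<subset> {p'. p' \<le> q \<and> b ! p' = b ! q}" by blast
  then show "rk b p < rk b q" unfolding rk_def by (rule psubset_card_mono[rotated]) simp
qed

lemma rk_pos: "0 < rk b p"
  unfolding rk_def by (auto simp: card_gt_0_iff)

lemma tc_binc: "binc r b (tc r b)"
  by (auto simp: binc_def tc_nth rk_less)

text \<open>The letters of \<open>t\<close> in the block of \<open>p\<close> up to position
  \<open>p\<close> are distinct and lie in \<open>{1..t ! p}\<close>, so there are at most
  \<open>t ! p\<close> of them.\<close>

lemma tc_least:
  assumes "binc r b t" "\<And>p. p < r \<Longrightarrow> 1 \<le> t ! p" "p < r"
  shows "tc r b ! p \<le> t ! p"
proof -
  let ?S = "{p'. p' \<le> p \<and> b ! p' = b ! p}"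
  have "inj_on (nth t) ?S"
  proof (rule linorder_inj_onI)
    fix x y assume "x < y" "x \<in> ?S" "y \<in> ?S"
    then have "t ! x < t ! y" using assms(1,3) by (auto simp: binc_def)
    then show "t ! x \<noteq> t ! y" by simp
  qed auto
  moreover have "nth t ` ?S \<subseteq> {1..t ! p}"
  proof
    fix y assume "y \<in> nth t ` ?S"
    then obtain q where q: "q \<le> p" "b ! q = b ! p" "y = t ! q" by auto
    then have "t ! q \<le> t ! p" using assms(1,3) by (cases "q = p") (auto simp: binc_def less_imp_le)
    then show "y \<in> {1..t ! p}" using q assms(2)[of q] assms(3) by simp
  qed
  then have "card (nth t ` ?S) \<le> card {1..t ! p}" by (rule card_mono[rotated]) simp
  ultimately have "card ?S \<le> nat (t ! p)" by (simp add: card_image)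
  moreover have "1 \<le> t ! p" using assms by blast
  ultimately show ?thesis using assms(3) by (simp add: tc_nth rk_def)
qed

lemma cnt_positive:
  assumes "\<nu> \<in> partitions r" "cnt t = \<nu>" "p < length t" shows "1 \<le> t ! p"
proof (rule ccontr)
  assume "\<not> 1 \<le> t ! p"
  then have "cnt t (t ! p) = 0" using assms partition_nonpos by auto
  then show False using assms(3) unfolding cnt_card by (auto simp: card_eq_0_iff)
qed

abbreviation bw :: "nat \<Rightarrow> (int \<Rightarrow> nat) \<Rightarrow> int list" where
  "bw r \<mu> \<equiv> omega_lam r (transp \<mu>)"

lemmas bw_props = sorted_omega_lam[OF transp_Lam] length_omega_lam[OF transp_Lam] cnt_omega_lam[OF transp_Lam]

text \<open>An occurrence of \<open>x\<close> is a box in row \<open>x\<close>, and \<open>b\<close>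
  gives its column. So the occurrences correspond to the columns that reach row \<open>x\<close>,
  which by \<open>transp_ge_iff\<close> are \<open>{1..int (\<mu> x)}\<close>.\<close>

lemma cnt_tc:
  assumes \<mu>: "\<mu> \<in> partitions r"
  shows "cnt (tc r (bw r \<mu>)) = \<mu>"
proof
  fix x
  define b where "b = bw r \<mu>"
  note b = bw_props[OF \<mu>, folded b_def]
  have c: "cnt (tc r b) x = card {p. p < r \<and> int (rk b p) = x}"
    unfolding cnt_card by (rule arg_cong[where f = card]) (auto simp: tc_nth)
  have blk: "card {p. p < r \<and> b ! p = i} = transp \<mu> i" for i
    using b(2,3) cnt_card[of b i] by simp
  show "cnt (tc r (bw r \<mu>)) x = \<mu> x"
  proof (cases "1 \<le> x")
    case False
    then have "int (rk b p) \<noteq> x" for p using rk_pos[of b p] by linarith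
    then have "{p. p < r \<and> int (rk b p) = x} = {}" by blast
    then show ?thesis using c partition_nonpos[OF \<mu>, of x] False by (simp add: b_def)
  next
    case True
    have "bij_betw (nth b) {p. p < r \<and> int (rk b p) = x} {1..int (\<mu> x)}"
      unfolding bij_betw_def
    proof
      show "inj_on (nth b) {p. p < r \<and> int (rk b p) = x}"
      proof (rule linorder_inj_onI)
        fix p q assume "p < q" "p \<in> {p. p < r \<and> int (rk b p) = x}" "q \<in> {p. p < r \<and> int (rk b p) = x}"
        then show "b ! p \<noteq> b ! q" using rk_less[of p q b] by auto
      qed auto
      show "nth b ` {p. p < r \<and> int (rk b p) = x} = {1..int (\<mu> x)}"
      proof (intro set_eqI iffI)
        fix i assume "i \<in> nth b ` {p. p < r \<and> int (rk b p) = x}"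
        then obtain p where p: "p < r" "int (rk b p) = x" "i = b ! p" by auto
        have "rk b p \<le> transp \<mu> i" unfolding blk[symmetric] rk_def
          by (rule card_mono) (use p in auto)
        then have "x \<le> int (transp \<mu> i)" using p by simp
        moreover from this have "1 \<le> i" using True by (auto simp: transp_def split: if_splits)
        ultimately show "i \<in> {1..int (\<mu> x)}" using transp_ge_iff[OF \<mu> _ True] by simp
      next
        fix i assume i: "i \<in> {1..int (\<mu> x)}"
        let ?B = "{p. p < r \<and> b ! p = i}"
        have "rk b ` ?B \<subseteq> {1..transp \<mu> i}"
        proof
          fix k assume "k \<in> rk b ` ?B"
          then obtain p where p: "p \<in> ?B" "k = rk b p" by auto
          have "rk b p \<le> card ?B" unfolding rk_def by (rule card_mono) (use p in auto)
          then show "k \<in> {1..transp \<mu> i}" using p rk_pos[of b p] blk by simp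
        qed
        moreover have "inj_on (rk b) ?B"
        proof (rule linorder_inj_onI)
          fix p q assume "p < q" "p \<in> ?B" "q \<in> ?B"
          then show "rk b p \<noteq> rk b q" using rk_less[of p q b] by auto
        qed auto
        then have "card (rk b ` ?B) = card {1..transp \<mu> i}" using blk by (simp add: card_image)
        ultimately have "rk b ` ?B = {1..transp \<mu> i}" by (intro card_subset_eq) auto
        moreover have "nat x \<in> {1..transp \<mu> i}" using transp_ge_iff[OF \<mu>, of i x] i True by auto
        ultimately have "nat x \<in> rk b ` ?B" by simp
        then obtain p where "p \<in> ?B" "rk b p = nat x" by auto
        then show "i \<in> nth b ` {p. p < r \<and> int (rk b p) = x}" using True by force
      qed
    qed
    then have "card {p. p < r \<and> int (rk b p) = x} = \<mu> x" by (simp add: bij_betw_same_card)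
    then show ?thesis using c by (simp add: b_def)
  qed
qed

text \<open>The word lies pointwise above \<open>tc\<close> by \<open>tc_least\<close>, but has the
  same letters and hence the same sum.\<close>

lemma binc_unique:
  assumes \<mu>: "\<mu> \<in> partitions r" and t: "binc r (bw r \<mu>) t" "cnt t = \<mu>"
  shows "t = tc r (bw r \<mu>)"
proof -
  have l: "length t = r" using t by (simp add: binc_def)
  have le: "tc r (bw r \<mu>) ! p \<le> t ! p" if "p < r" for p
    using tc_least[OF t(1) _ that] cnt_positive[OF \<mu> t(2)] l by simp
  have "mset t = mset (tc r (bw r \<mu>))" using cnt_tc[OF \<mu>] t(2) cnt_mset by metis
  then have "sum_list t = sum_list (tc r (bw r \<mu>))" by (metis sum_mset_sum_list)
  then have s: "(\<Sum>p<r. t ! p) = (\<Sum>p<r. tc r (bw r \<mu>) ! p)"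
    using l by (simp add: sum_list_sum_nth lessThan_atLeast0)
  show ?thesis
  proof (rule nth_equalityI)
    fix p assume "p < length t"
    then show "t ! p = tc r (bw r \<mu>) ! p"
      using sum_mono_inv[OF s[symmetric] le, of p] l by simp
  qed (simp add: l)
qed

text \<open>The partial sums defining the dominance order, computed from any word of the given content.\<close>
definition low :: "int list \<Rightarrow> int \<Rightarrow> nat" where
  "low w k = length (filter (\<lambda>x. x \<le> k) w)"

lemma low_cnt: "cnt w = cnt u \<Longrightarrow> low w k = low u k"
  unfolding low_def cnt_mset by (metis mset_filter size_mset)

lemma low_determines:
  assumes "\<mu> \<in> Lam r" "\<nu> \<in> Lam r" "\<And>k. low (omega_lam r \<mu>) k = low (omega_lam r \<nu>) k"
  shows "\<mu> = \<nu>"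
proof
  fix k
  have "low w k = low w (k - 1) + cnt w k" for w
    unfolding low_def cnt_def by (induction w) auto
  from this[of "omega_lam r \<mu>"] this[of "omega_lam r \<nu>"] show "\<mu> k = \<nu> k"
    using assms(3)[of k] assms(3)[of "k - 1"] cnt_omega_lam[OF assms(1)] cnt_omega_lam[OF assms(2)] by simp
qed

text \<open>Since \<open>tc\<close> is pointwise smallest, it has at least as many letters up to
  \<open>k\<close> as \<open>t\<close> has.\<close>

lemma dominance:
  assumes \<mu>: "\<mu> \<in> partitions r" and \<nu>: "\<nu> \<in> partitions r" and t: "binc r (bw r \<mu>) t" "cnt t = \<nu>"
  shows "low (omega_lam r \<nu>) k \<le> low (omega_lam r \<mu>) k"
proof -
  have l: "length t = r" using t by (simp add: binc_def)
  have le: "tc r (bw r \<mu>) ! p \<le> t ! p" if "p < r" for p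
    using tc_least[OF t(1) _ that] cnt_positive[OF \<nu> t(2)] l by simp
  have "low t k = card {p. p < r \<and> t ! p \<le> k}" unfolding low_def length_filter_conv_card l ..
  also have "\<dots> \<le> card {p. p < r \<and> tc r (bw r \<mu>) ! p \<le> k}"
    by (rule card_mono) (use le in force)+
  also have "\<dots> = low (tc r (bw r \<mu>)) k" unfolding low_def length_filter_conv_card by simp
  finally show ?thesis
    using low_cnt[of t "omega_lam r \<nu>" k] low_cnt[of "tc r (bw r \<mu>)" "omega_lam r \<mu>" k] t(2) cnt_tc[OF \<mu>]
      cnt_omega_lam[OF partitions_Lam[OF \<mu>]] cnt_omega_lam[OF partitions_Lam[OF \<nu>]] by simp
qed

subsection \<open>Generators of the simple submodules\<close>

lemma Sym_weight_space:
  assumes "sorted b" "length b = r" "x \<in> Vsp r" "kproj r \<nu> x = x"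
  obtains "Sym r qm b x = 0" | t where "binc r b t" "cnt t = \<nu>"
proof (cases "\<exists>t. binc r b t \<and> cnt t = \<nu>")
  case False
  have "Sym r qm b x = (\<Sum>w\<in>{w. x w \<noteq> 0}. sm (x w) (Sym r qm b (ebas w)))"
    unfolding Sym_linear(2)[symmetric] Sym_sum[symmetric]
    by (rule arg_cong[OF Vsp_expand]) (use Vsp_finite[OF assms(3)] in auto)
  also have "\<dots> = 0"
  proof (intro sum.neutral ballI)
    fix w assume w: "w \<in> {w. x w \<noteq> 0}"
    then have "kproj r \<nu> x w \<noteq> 0" unfolding assms(4) by simp
    then have "cnt w = \<nu>" unfolding kproj_apply[OF assms(3)] by (simp split: if_splits)
    then have "Sym r qm b (ebas w) = 0"
      using Sym_ebas_reduce[OF assms(1,2) Vsp_length[OF assms(3)], of w] w False by blast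
    then show "sm (x w) (Sym r qm b (ebas w)) = 0" by simp
  qed
  finally show ?thesis using that by blast
qed (use that in blast)

lemma Sym_weight_space_line:
  assumes \<mu>: "\<mu> \<in> partitions r" and x: "x \<in> Vsp r" "kproj r \<mu> x = x"
  obtains c where "Sym r qm (bw r \<mu>) x = sm c (Sym r qm (bw r \<mu>) (ebas (tc r (bw r \<mu>))))"
proof -
  let ?S = "Sym r qm (bw r \<mu>)" and ?e = "ebas (tc r (bw r \<mu>))"
  have "\<exists>c. ?S (ebas w) = sm c (?S ?e)" if w: "w \<in> {w. x w \<noteq> 0}" for w
  proof -
    have "kproj r \<mu> x w \<noteq> 0" using w unfolding x(2) by simp
    then have cw: "cnt w = \<mu>" unfolding kproj_apply[OF x(1)] by (simp split: if_splits)
    have "length w = r" using Vsp_length[OF x(1)] w by simp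
    from Sym_ebas_reduce[OF bw_props(1,2)[OF \<mu>] this] show ?thesis
    proof
      assume "?S (ebas w) = 0"
      then show ?thesis by (intro exI[of _ 0]) simp
    next
      assume "\<exists>t' c. c \<noteq> 0 \<and> binc r (bw r \<mu>) t' \<and> cnt t' = cnt w \<and> ?S (ebas w) = sm c (?S (ebas t'))"
      then obtain t' c where t': "binc r (bw r \<mu>) t'" "cnt t' = \<mu>" "?S (ebas w) = sm c (?S (ebas t'))"
        using cw by blast
      show ?thesis using t'(3) unfolding binc_unique[OF \<mu> t'(1,2)] by blast
    qed
  qed
  then obtain c where c: "\<And>w. w \<in> {w. x w \<noteq> 0} \<Longrightarrow> ?S (ebas w) = sm (c w) (?S ?e)" by metis
  have "?S x = (\<Sum>w\<in>{w. x w \<noteq> 0}. sm (x w) (?S (ebas w)))"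
    unfolding Sym_linear(2)[symmetric] Sym_sum[symmetric]
    by (rule arg_cong[OF Vsp_expand]) (use Vsp_finite[OF x(1)] in auto)
  also have "\<dots> = (\<Sum>w\<in>{w. x w \<noteq> 0}. sm (x w * c w) (?S ?e))" using c by simp
  finally have "?S x = sm (\<Sum>w\<in>{w. x w \<noteq> 0}. x w * c w) (?S ?e)" by (simp add: sm_sum_left)
  then show ?thesis by (rule that)
qed

text \<open>The Young subgroup merely permutes the entries of \<open>tc\<close> within blocks, where
  they are distinct. Thus only the identity contributes to the coefficient at \<open>tc\<close>
  itself, which is 1.\<close>

lemma Sym_tc_neq_0:
  assumes b: "sorted b" "length b = r" shows "Sym r qm b (ebas (tc r b)) \<noteq> 0"
proof -
  have "HT r \<sigma> (ebas (tc r b)) (tc r b) = (if \<sigma> = id then 1 else 0)" if s: "\<sigma> \<in> yg r b" for \<sigma>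
  proof -
    have p: "\<sigma> \<in> perms r" using yg_perms[OF s] .
    have "HT r \<sigma> (ebas (tc r b)) = ebas (permute_list \<sigma> (tc r b))"
      by (rule HT_ebas_block[OF b s]) (use tc_binc[of r b] in \<open>auto simp: binc_def\<close>)
    moreover have "\<sigma> = id" if e: "permute_list \<sigma> (tc r b) = tc r b"
    proof
      fix q show "\<sigma> q = id q"
      proof (cases "q < r")
        case True
        then have "tc r b ! \<sigma> q = tc r b ! q" using permute_nth[OF p length_tc True, of b] e by simp
        moreover have "b ! \<sigma> q = b ! q" "\<sigma> q < r" using yg_nth[OF s True] perms_less_iff[OF p] True by auto
        ultimately have "\<not> \<sigma> q < q" "\<not> q < \<sigma> q" using rk_less[of _ _ b] True by (auto simp: tc_nth) fastforce+
        then show ?thesis by simp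
      next
        case False
        then show ?thesis using p by (auto simp: perms_permutes permutes_def)
      qed
    qed
    ultimately show ?thesis by (auto simp: ebas_apply)
  qed
  then have "Sym r qm b (ebas (tc r b)) (tc r b) = (\<Sum>\<sigma>\<in>yg r b. if \<sigma> = id then 1 else 0)"
    unfolding Sym_def sum_fun_apply by (intro sum.cong) (auto simp: sm_apply)
  then have "Sym r qm b (ebas (tc r b)) (tc r b) = 1" by simp
  then show ?thesis by (metis zero_fun_apply zero_neq_one)
qed

section \<open>The distinguished double coset representative\<close>

lemma conjugate_young:
  assumes "w \<in> perms r" "length u = r"
  shows "{inv w \<circ> a \<circ> w | a. a \<in> yg r u} = yg r (permute_list w u)"
proof (intro set_eqI iffI)
  note i = perms_inv_apply[OF assms(1)] and l = perms_less_iff[OF assms(1)]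
  fix \<sigma>
  {
    assume "\<sigma> \<in> {inv w \<circ> a \<circ> w | a. a \<in> yg r u}"
    then obtain a where a: "\<sigma> = inv w \<circ> a \<circ> w" "a \<in> yg r u" by blast
    then have s: "\<sigma> \<in> perms r" using assms perms_comp perms_inv yg_perms[OF a(2)] by metis
    have "permute_list w u ! \<sigma> p = permute_list w u ! p" if p: "p < r" for p
    proof -
      have "\<sigma> p < r" using p perms_less_iff[OF s] by simp
      then show ?thesis using a p yg_nth[OF a(2), of "w p"] l assms by (simp add: permute_nth i)
    qed
    then show "\<sigma> \<in> yg r (permute_list w u)" using s by (simp add: yg_def)
  next
    assume s: "\<sigma> \<in> yg r (permute_list w u)"
    then have sp: "\<sigma> \<in> perms r" by (rule yg_perms)
    define a where "a = w \<circ> \<sigma> \<circ> inv w"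
    have "a \<in> perms r" using assms sp unfolding a_def by (intro perms_comp perms_inv)
    moreover have "u ! a p = u ! p" if p: "p < r" for p
    proof -
      have q: "inv w p < r" "\<sigma> (inv w p) < r"
        using p perms_less_iff[OF perms_inv[OF assms(1)]] perms_less_iff[OF sp] by auto
      then show ?thesis using yg_nth[OF s q(1)] assms by (simp add: a_def permute_nth i)
    qed
    ultimately have "a \<in> yg r u" by (simp add: yg_def)
    moreover have "\<sigma> = inv w \<circ> a \<circ> w" by (auto simp: a_def fun_eq_iff i)
    ultimately show "\<sigma> \<in> {inv w \<circ> a \<circ> w | a. a \<in> yg r u}" by blast
  }
qed

text \<open>A letter repeated within a block gives a transposition in both stabilisers. Together
  with \<open>conjugate_young\<close> this turns the trivial-intersection condition on
  \<open>wlam\<close> into a condition on the permuted word.\<close>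

lemma bdist_iff_trivial:
  "length b = r \<Longrightarrow> length t = r \<Longrightarrow> bdist r b t \<longleftrightarrow> yg r t \<inter> yg r b = {id}"
proof
  assume B: "bdist r b t"
  have "\<sigma> = id" if s: "\<sigma> \<in> yg r t" "\<sigma> \<in> yg r b" for \<sigma>
  proof
    fix p show "\<sigma> p = id p"
    proof (cases "p < r")
      case True
      have "\<sigma> p < r" "b ! \<sigma> p = b ! p" "t ! \<sigma> p = t ! p"
        using True yg_nth[OF s(1)] yg_nth[OF s(2)] perms_less_iff[OF yg_perms[OF s(1)]] by auto
      then show ?thesis using B True unfolding bdist_def by (metis id_apply)
    next
      case False
      then show ?thesis using yg_perms[OF s(1)] by (auto simp: perms_permutes permutes_def)
    qed
  qed
  then show "yg r t \<inter> yg r b = {id}" by blast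
next
  assume T: "yg r t \<inter> yg r b = {id}"
  show "bdist r b t" unfolding bdist_def
  proof (intro allI impI notI)
    fix p q assume pq: "p < r" "q < r" "p \<noteq> q" "b ! p = b ! q" "t ! p = t ! q"
    have "transpose p q \<in> perms r" unfolding perms_permutes by (rule permutes_swap_id) (use pq in auto)
    then have "transpose p q \<in> yg r t \<inter> yg r b" using pq by (auto simp: yg_def transpose_def)
    then have "transpose p q p = p" using T by auto
    then show False using pq by simp
  qed
qed

text \<open>The description in \<open>wlam\<close> must be shown to have exactly one solution.
  Minimality against right factors makes the permuted word increase in the blocks of
  \<open>b\<close>, so it is \<open>tc\<close> by \<open>binc_unique\<close>; minimality against
  left factors makes \<open>inv w\<close> increase on the blocks of \<open>u\<close>. The first
  fixes the coset of \<open>w\<close>, the second its element.\<close>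

lemma
  assumes \<mu>: "\<mu> \<in> partitions r"
  shows wlam_perms: "wlam r \<mu> \<in> perms r"
    and wlam_binc: "binc r (bw r \<mu>) (permute_list (wlam r \<mu>) (omega_lam r \<mu>))"
proof -
  define u where "u = omega_lam r \<mu>"
  define b where "b = bw r \<mu>"
  note u = omega_lam_props[OF partitions_Lam[OF \<mu>], folded u_def] and b = bw_props[OF \<mu>, folded b_def]
  let ?t = "\<lambda>w. permute_list w u"
  let ?W = "\<lambda>w. distinguished r \<mu> (transp \<mu>) w \<and> {inv w \<circ> a \<circ> w | a. a \<in> young r \<mu>} \<inter> young r (transp \<mu>) = {id}"
  let ?D = "{w\<in>perms r. bdist r b (?t w)}"
  have W: "?W w \<longleftrightarrow> (\<forall>a\<in>yg r u. \<forall>c\<in>yg r b. len r w \<le> len r (a \<circ> w \<circ> c)) \<and> w \<in> ?D" for w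
  proof (cases "w \<in> perms r")
    case True
    have "{inv w \<circ> a \<circ> w | a. a \<in> young r \<mu>} \<inter> young r (transp \<mu>) = {id} \<longleftrightarrow> bdist r b (?t w)"
      using bdist_iff_trivial[of b r "?t w"] conjugate_young[OF True u(2)] u b True
      by (simp add: young_eq_yg u_def[symmetric] b_def[symmetric])
    then show ?thesis using True
      by (auto simp: distinguished_def dcoset_def young_eq_yg u_def[symmetric] b_def[symmetric])
  qed (simp add: distinguished_def)
  have binc: "binc r b (?t w)" if w: "?W w" for w
  proof -
    have wp: "w \<in> perms r" and bd: "bdist r b (?t w)" and min: "\<And>a c. a \<in> yg r u \<Longrightarrow> c \<in> yg r b \<Longrightarrow> len r w \<le> len r (a \<circ> w \<circ> c)"
      using w unfolding W by blast+
    have "?t w ! j < ?t w ! Suc j" if j: "Suc j < r" "b ! j = b ! Suc j" for j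
    proof -
      have "len r w \<le> len r (w \<circ> adj j)" using min[OF yg_id yg_adj[OF j]] by simp
      then have "\<not> w (Suc j) < w j" using len_desc[OF j(1), of w] by linarith
      then have "u ! w j \<le> u ! w (Suc j)" using u j perms_less_iff[OF wp] by (intro sorted_nth_mono) auto
      then have "?t w ! j \<le> ?t w ! Suc j" using j u wp by (simp add: permute_nth)
      moreover have "?t w ! j \<noteq> ?t w ! Suc j" using bd j unfolding bdist_def by auto
      ultimately show ?thesis by simp
    qed
    then show ?thesis unfolding binc_def using block_increasing[OF b(1,2), of "nth (?t w)"] u by auto
  qed
  have left: "inv w p < inv w q" if w: "?W w" and pq: "p < q" "q < r" "u ! p = u ! q" for w p q
  proof -
    have wp: "w \<in> perms r" and min: "\<And>a c. a \<in> yg r u \<Longrightarrow> c \<in> yg r b \<Longrightarrow> len r w \<le> len r (a \<circ> w \<circ> c)"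
      using w unfolding W by blast+
    have "inv w j < inv w (Suc j)" if j: "Suc j < r" "u ! j = u ! Suc j" for j
    proof -
      have "len r w \<le> len r (adj j \<circ> w)" using min[OF yg_adj[OF j] yg_id] by simp
      moreover have "len r (inv w \<circ> adj j) = len r (adj j \<circ> w)"
        using len_inv[of "adj j \<circ> w" r] wp j by (simp add: inv_adj_comp[OF wp] perms_comp adj_perms)
      ultimately have "\<not> inv w (Suc j) < inv w j" using len_desc[OF j(1), of "inv w"] len_inv[OF wp] by linarith
      moreover have "inv w j \<noteq> inv w (Suc j)" using perms_inj[OF perms_inv[OF wp]] by simp
      ultimately show ?thesis by simp
    qed
    from block_increasing[where f = "inv w", OF u(1,2) this pq] show ?thesis by simp
  qed
  \<comment> \<open>A shortest element of all of \<open>?D\<close> works, because \<open>?D\<close>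
    is stable under both Young subgroups. It is nonempty since \<open>tc\<close> is a rearrangement
    of \<open>u\<close>.\<close>
  have ex: "\<exists>w. ?W w"
  proof -
    obtain w0 where w0: "w0 \<in> perms r" "?t w0 = tc r b"
      using cnt_eq_permute[of "tc r b" u r] cnt_tc[OF \<mu>, folded b_def] u by metis
    have "bdist r b (tc r b)" unfolding bdist_def using tc_binc[of r b] by (auto simp: binc_def) (metis linorder_neqE_nat order_less_irrefl)
    then have "w0 \<in> ?D" using w0 by simp
    then obtain w where w: "w \<in> ?D" "\<And>w'. w' \<in> ?D \<Longrightarrow> len r w \<le> len r w'"
      using ex_has_least_nat[of "\<lambda>w. w \<in> ?D" w0 "len r"] by blast
    have "a \<circ> w \<circ> c \<in> ?D" if a: "a \<in> yg r u" and c: "c \<in> yg r b" for a c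
    proof -
      have p: "a \<in> perms r" "c \<in> perms r" "w \<in> perms r" using a c w yg_perms by auto
      have "?t (a \<circ> w \<circ> c) = permute_list c (?t w)"
        using a p u by (simp add: permute_list_compose perms_permutes yg_permute_list)
      moreover have "bdist r b (permute_list c (?t w))"
        using w(1) perms_less_iff[OF p(2)] yg_nth[OF c] perms_inj[OF p(2)] u p
        by (auto simp: bdist_def permute_nth)
      ultimately show ?thesis using p by (auto intro: perms_comp)
    qed
    then have "?W w" unfolding W using w by blast
    then show ?thesis by blast
  qed
  \<comment> \<open>Both solutions give the word \<open>tc\<close>, so they differ by some
    \<open>\<tau>\<close> in the stabiliser of \<open>u\<close>. A descent of \<open>\<tau>\<close>
    inside a block would contradict \<open>left\<close> for one of them.\<close>
  have unique: "w' = w" if w: "?W w" and w': "?W w'" for w w'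
  proof -
    have wp: "w \<in> perms r" "w' \<in> perms r" using w w' unfolding W by blast+
    note i = perms_inv_apply[OF wp(1)] perms_inv_apply[OF wp(2)]
    have t: "?t w = tc r b" if "?W w" for w
    proof -
      have "w \<in> perms r" using that unfolding W by blast
      then have "cnt (?t w) = \<mu>" using u by (simp add: cnt_permute)
      from binc_unique[OF \<mu> binc[OF that, unfolded b_def] this] show ?thesis by (simp add: b_def)
    qed
    have e: "u ! w' p = u ! w p" if "p < r" for p
      using t[OF w] t[OF w'] permute_nth[OF wp(1) u(2) that] permute_nth[OF wp(2) u(2) that] by simp
    define \<tau> where "\<tau> = w' \<circ> inv w"
    have il: "inv w p < r \<longleftrightarrow> p < r" for p by (rule perms_less_iff[OF perms_inv[OF wp(1)]])
    have "\<tau> \<in> yg r u" unfolding yg_def using wp e il by (auto simp: \<tau>_def i intro!: perms_comp perms_inv)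
    have "\<tau> = id"
    proof (rule ccontr)
      assume "\<tau> \<noteq> id"
      then obtain j where j: "Suc j < r" "u ! j = u ! Suc j" "\<tau> (Suc j) < \<tau> j"
        using yg_descent[OF u(1,2) \<open>\<tau> \<in> yg r u\<close>] by blast
      let ?p = "inv w j" and ?q = "inv w (Suc j)"
      have "?p < ?q" using left[OF w _ j(1,2)] by simp
      moreover have "w' ?q < w' ?p" using j(3) by (simp add: \<tau>_def)
      moreover have "w' ?p < r" "u ! w' ?q = u ! w' ?p"
        using j e[of ?p] e[of ?q] il perms_less_iff[OF wp(2)] by (auto simp: i)
      ultimately have "inv w' (w' ?q) < inv w' (w' ?p)" using left[OF w', of "w' ?q" "w' ?p"] by simp
      then show False using \<open>?p < ?q\<close> by (simp add: i)
    qed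
    then have "\<tau> \<circ> w = w" by simp
    then show ?thesis by (simp add: \<tau>_def fun_eq_iff i)
  qed
  have "\<exists>!w. ?W w" using ex unique by blast
  then have "?W (wlam r \<mu>)" unfolding wlam_def by (rule theI'[of ?W])
  then show "wlam r \<mu> \<in> perms r" "binc r (bw r \<mu>) (?t (wlam r \<mu>))"
    using binc unfolding W by (auto simp: b_def)
qed

text \<open>In terms of \<open>HT\<close> the coefficient (-v^2)^(-l) times the factor v^l from
  \<open>Tw\<close> is \<open>qm ^ l\<close>, so the sum in \<open>umu\<close> is \<open>Sym\<close>
  at \<open>qm\<close>. The vector it is applied to is a power of \<open>vv\<close> times the tensor
  of \<open>tc\<close>.\<close>

lemma umu_eq:
  assumes \<mu>: "\<mu> \<in> partitions r"
  obtains c where "c \<noteq> 0" "umu r \<mu> = sm c (Sym r qm (bw r \<mu>) (ebas (tc r (bw r \<mu>))))"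
proof -
  let ?u = "omega_lam r \<mu>" and ?w = "wlam r \<mu>"
  note u = omega_lam_props[OF partitions_Lam[OF \<mu>]] and wp = wlam_perms[OF \<mu>]
  obtain k where k: "HT r ?w (ebas ?u) = sm (vv ^ k) (ebas (permute_list ?w ?u))"
    using HT_ebas_sorted[OF u(1,2) wp] by blast
  have t: "permute_list ?w ?u = tc r (bw r \<mu>)"
    by (rule binc_unique[OF \<mu> wlam_binc[OF \<mu>]]) (use cnt_permute[OF wp] u in simp)
  define y where "y = Tw r ?w (ebas ?u)"
  have uV: "ebas ?u \<in> Vsp r" using u by (simp add: ebas_Vsp)
  have y: "y = sm (vv ^ len r ?w * vv ^ k) (ebas (tc r (bw r \<mu>)))"
    unfolding y_def Tw_def using hT_eq_HT[OF uV wp] k t by simp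
  have yV: "y \<in> Vsp r" unfolding y by (simp add: ebas_Vsp)
  have "umu r \<mu> = Sym r qm (bw r \<mu>) y"
    unfolding umu_def Sym_def young_eq_yg y_def[symmetric]
  proof (rule sum.cong[OF refl])
    fix \<sigma> assume "\<sigma> \<in> yg r (bw r \<mu>)"
    then have s: "\<sigma> \<in> perms r" by (rule yg_perms)
    have "inverse ((- (vv\<^sup>2)) ^ n) * vv ^ n = qm ^ n" for n
    proof -
      have "inverse ((- (vv\<^sup>2)) ^ n) * vv ^ n = (inverse (- (vv\<^sup>2)) * vv) ^ n"
        by (simp only: power_inverse power_mult_distrib)
      also have "inverse (- (vv\<^sup>2)) * vv = qm" by (simp add: power2_eq_square)
      finally show ?thesis .
    qed
    then show "sm (inverse ((- (vv\<^sup>2)) ^ len r \<sigma>)) (Tw r \<sigma> y) = sm (qm ^ len r \<sigma>) (HT r \<sigma> y)"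
      unfolding Tw_def hT_eq_HT[OF yV s] by (simp only: sm_simps)
  qed
  then have "umu r \<mu> = sm (vv ^ len r ?w * vv ^ k) (Sym r qm (bw r \<mu>) (ebas (tc r (bw r \<mu>))))"
    unfolding y Sym_linear .
  then show ?thesis by (intro that[of "vv ^ len r ?w * vv ^ k"]) auto
qed

lemma umu_Vsp: "\<mu> \<in> partitions r \<Longrightarrow> umu r \<mu> \<in> Vsp r"
  by (erule umu_eq) (auto simp: ebas_Vsp intro!: Vsp_sm Sym_Vsp)

lemma umu_neq_0: "\<mu> \<in> partitions r \<Longrightarrow> umu r \<mu> \<noteq> 0"
  using umu_eq[of \<mu> r] Sym_tc_neq_0[OF bw_props(1,2), of \<mu> r] sm_eq_0_iff by metis

lemma kproj_umu:
  assumes "\<mu> \<in> partitions r" shows "kproj r \<mu> (umu r \<mu>) = umu r \<mu>"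
proof -
  have V: "ebas (tc r (bw r \<mu>)) \<in> Vsp r" by (simp add: ebas_Vsp)
  have "kproj r \<mu> (ebas (tc r (bw r \<mu>))) = ebas (tc r (bw r \<mu>))"
    using V cnt_tc[OF assms] by (auto simp: kproj_apply fun_eq_iff ebas_apply)
  then show ?thesis using umu_eq[OF assms] Send_sm[OF Send_kproj] Send_Sym[OF Send_kproj V] V Sym_Vsp by metis
qed

lemma Sym_umu:
  assumes "\<mu> \<in> partitions r"
  obtains c where "c \<noteq> 0" "Sym r qm (bw r \<mu>) (umu r \<mu>) = sm c (umu r \<mu>)"
proof -
  let ?S = "Sym r qm (bw r \<mu>)"
  let ?c = "\<Sum>\<sigma>\<in>yg r (bw r \<mu>). qm ^ len r \<sigma> * qm ^ len r \<sigma>"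
  have SS: "?S (?S x) = sm ?c (?S x)" for x
    using Sym_eigen[OF bw_props(1,2)[OF assms] TT_Sym[OF qm_quad]] by blast
  obtain k where k: "umu r \<mu> = sm k (?S (ebas (tc r (bw r \<mu>))))" using umu_eq[OF assms] by blast
  have "?S (umu r \<mu>) = sm ?c (umu r \<mu>)"
    unfolding k Sym_linear SS by (simp only: sm_simps mult.commute)
  moreover have "?c \<noteq> 0" using Sym_const_pos[OF qm_neq(2), of r "bw r \<mu>"] by simp
  ultimately show ?thesis using that by blast
qed

section \<open>The simple submodules generated by the vectors \<open>umu\<close>\<close>

definition Pm :: "nat \<Rightarrow> (int \<Rightarrow> nat) \<Rightarrow> vec set" where
  "Pm r \<mu> = Phi r (umu r \<mu>) ` Vsp r"

lemma hsub_Vsp_UNIV: "hsub r (Vsp r)"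
  by (auto simp: hsub_def Vsp_subspace TT_Vsp)

lemma Phi_range_subset:
  assumes "hsub r N" "u \<in> N" shows "Phi r u ` Vsp r \<subseteq> N"
  using assms by (auto simp: Phi_def intro!: qvs.subspace_sum qvs.subspace_scale hsub_subspace hsub_HT)

lemma fd_Phi: assumes "u \<in> Vsp r" shows "fd (Phi r u ` Vsp r)"
  unfolding fd_def
  by (rule exI[of _ "(\<lambda>\<sigma>. HT r \<sigma> u) ` perms r"])
    (auto simp: Phi_def intro!: qvs.span_sum qvs.span_scale intro: qvs.span_base)

lemma hsub_Pm: "\<mu> \<in> partitions r \<Longrightarrow> hsub r (Pm r \<mu>)"
  and fd_Pm: "\<mu> \<in> partitions r \<Longrightarrow> fd (Pm r \<mu>)"
  and umu_Pm: "\<mu> \<in> partitions r \<Longrightarrow> umu r \<mu> \<in> Pm r \<mu>"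
  unfolding Pm_def
proof -
  assume "\<mu> \<in> partitions r"
  note V = umu_Vsp[OF this]
  show "hsub r (Phi r (umu r \<mu>) ` Vsp r)" by (rule hsub_Send_image[OF Phi_Send[OF V] hsub_Vsp_UNIV])
  show "fd (Phi r (umu r \<mu>) ` Vsp r)" by (rule fd_Phi[OF V])
  have "Phi r (umu r \<mu>) (ebas (omega_varpi r)) \<in> Phi r (umu r \<mu>) ` Vsp r" by (simp add: ebas_Vsp)
  then show "umu r \<mu> \<in> Phi r (umu r \<mu>) ` Vsp r" by (simp only: Phi_omega[OF V])
qed

lemma kproj_Pm:
  assumes "\<mu> \<in> partitions r" "x \<in> Pm r \<mu>" shows "kproj r \<mu> x = x"
proof -
  note V = umu_Vsp[OF assms(1)]
  \<comment> \<open>The vectors fixed by \<open>kproj r \<mu>\<close> are the kernel of an element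
    of the Schur algebra, hence a submodule; it contains \<open>umu r \<mu>\<close>.\<close>
  have "hsub r {x\<in>Vsp r. (kproj r \<mu> + (\<lambda>x. sm (-1) (oneS r x))) x = 0}"
    by (rule hsub_kernel[OF Send_plus[OF Send_kproj Send_scale[OF Send_one]] hsub_Vsp_UNIV])
  moreover have e: "{x\<in>Vsp r. (kproj r \<mu> + (\<lambda>x. sm (-1) (oneS r x))) x = 0} = {x\<in>Vsp r. kproj r \<mu> x = x}"
    by (auto simp: oneS_def sm_distribs)
  ultimately have "Phi r (umu r \<mu>) ` Vsp r \<subseteq> {x\<in>Vsp r. kproj r \<mu> x = x}"
    using kproj_umu[OF assms(1)] V by (intro Phi_range_subset) auto
  then show ?thesis using assms(2) unfolding Pm_def by blast
qed

text \<open>The antisymmetriser maps \<open>Pm r \<mu>\<close> into the line of the generator and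
  acts on that line by a nonzero scalar. Splitting the generator along \<open>N\<close> and its
  orthogonal complement, one component has a nonzero image; the summand it lies in then contains the
  generator, and so everything.\<close>

lemma hsimple_Pm:
  assumes \<mu>: "\<mu> \<in> partitions r" shows "hsimple r (Pm r \<mu>)"
  unfolding hsimple_def
proof (intro conjI allI impI)
  let ?P = "Pm r \<mu>" and ?u = "umu r \<mu>" and ?S = "Sym r qm (bw r \<mu>)"
  note H = hsub_Pm[OF \<mu>] and uP = umu_Pm[OF \<mu>]
  show "hsub r ?P" by fact
  show "?P \<noteq> {0}" using uP umu_neq_0[OF \<mu>] by blast
  fix N assume N: "N \<subseteq> ?P \<and> hsub r N"
  note HN = conjunct2[OF N] and SN = hsub_subspace[OF conjunct2[OF N]]
  have fdN: "fd N" using fd_subset fd_Pm[OF \<mu>] N by blast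
  have uV: "?u \<in> Vsp r" using umu_Vsp[OF \<mu>] .
  define a where "a = pr r N ?u"
  have a: "a \<in> N" "\<And>y. y \<in> N \<Longrightarrow> ip (?u - a) y = 0"
    using pr_mem[OF HN fdN uV] pr_orth[OF HN fdN uV] by (auto simp: a_def)
  have aP: "a \<in> ?P" using a N by blast
  obtain c where c: "c \<noteq> 0" "?S ?u = sm c ?u" using Sym_umu[OF \<mu>] .
  obtain \<alpha> where \<alpha>: "?S a = sm \<alpha> ?u"
  proof -
    obtain k where k: "k \<noteq> 0" "?u = sm k (?S (ebas (tc r (bw r \<mu>))))" using umu_eq[OF \<mu>] .
    obtain d where "?S a = sm d (?S (ebas (tc r (bw r \<mu>))))"
      using Sym_weight_space_line[OF \<mu> hsub_Vsp[OF H aP] kproj_Pm[OF \<mu> aP]] .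
    then have "?S a = sm (d / k) ?u" using k by simp
    then show ?thesis by (rule that)
  qed
  have gen: "?P \<subseteq> K" if "hsub r K" "sm d ?u \<in> K" "d \<noteq> 0" for K d
  proof -
    have "sm (inverse d) (sm d ?u) \<in> K" using that hsub_subspace qvs.subspace_scale by blast
    then have "?u \<in> K" using that(3) by simp
    then show ?thesis unfolding Pm_def using Phi_range_subset that(1) by blast
  qed
  show "N = {0} \<or> N = ?P"
  proof (cases "\<alpha> = 0")
    case False
    have "sm \<alpha> ?u \<in> N" using \<alpha> hsub_Sym[OF HN a(1)] by metis
    then show ?thesis using gen[OF HN _ False] N by blast
  next
    case True
    let ?K = "{x\<in>?P. \<forall>y\<in>N. ip x y = 0}"
    have HK: "hsub r ?K" using hsub_orth[OF H HN] .
    have "?u - a \<in> ?K" using a aP uP qvs.subspace_diff[OF hsub_subspace[OF H]] by blast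
    then have "?S (?u - a) \<in> ?K" by (rule hsub_Sym[OF HK])
    moreover have "?S ?u = ?S (?u - a) + ?S a" using Sym_linear(1)[of r qm "bw r \<mu>" "?u - a" a] by simp
    then have "?S (?u - a) = sm c ?u" using c \<alpha> True by simp
    ultimately have "?P \<subseteq> ?K" using gen[OF HK _ c(1)] by simp
    then have "ip y y = 0" if "y \<in> N" for y using that N by blast
    then have "y = 0" if "y \<in> N" for y using that ip_definite hsub_Vsp[OF HN] by blast
    then show ?thesis using qvs.subspace_0[OF SN] by blast
  qed
qed

text \<open>The image of \<open>umu r \<nu>\<close> is a nonzero vector of weight
  \<open>\<mu>\<close> that survives the antisymmetriser of \<open>\<nu>\<close>. So a word of
  content \<open>\<mu>\<close> increasing in the columns of \<open>\<nu>\<close> exists, and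
  \<open>dominance\<close> applies.\<close>

lemma Pm_hom_dominance:
  assumes \<mu>: "\<mu> \<in> partitions r" and \<nu>: "\<nu> \<in> partitions r"
    and \<psi>: "\<psi> \<in> Send r" "\<psi> ` Pm r \<nu> \<subseteq> Pm r \<mu>" "x \<in> Pm r \<nu>" "\<psi> x \<noteq> 0"
  shows "low (omega_lam r \<mu>) k \<le> low (omega_lam r \<nu>) k"
proof -
  let ?u = "umu r \<nu>" and ?S = "Sym r qm (bw r \<nu>)"
  note uP = umu_Pm[OF \<nu>]
  have u: "\<psi> ?u \<noteq> 0"
  proof
    assume "\<psi> ?u = 0"
    then have "\<psi> ?u = \<psi> 0" using Send_0[OF \<psi>(1)] by simp
    then have "?u = 0"
      using inj_onD[OF hsimple_Send_image(1)[OF \<psi>(1) hsimple_Pm[OF \<nu>] \<psi>(3,4)]] uP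
        qvs.subspace_0[OF hsub_subspace[OF hsub_Pm[OF \<nu>]]] by blast
    then show False using umu_neq_0[OF \<nu>] by simp
  qed
  obtain c where c: "c \<noteq> 0" "?S ?u = sm c ?u" using Sym_umu[OF \<nu>] .
  have "?S (\<psi> ?u) = sm c (\<psi> ?u)"
    using Send_Sym[OF \<psi>(1) umu_Vsp[OF \<nu>], of qm "bw r \<nu>"] Send_sm[OF \<psi>(1) umu_Vsp[OF \<nu>]] c by simp
  then have "?S (\<psi> ?u) \<noteq> 0" using u c sm_eq_0_iff by metis
  moreover have "\<psi> ?u \<in> Pm r \<mu>" using \<psi>(2) uP by blast
  ultimately obtain t where "binc r (bw r \<nu>) t" "cnt t = \<mu>"
    using Sym_weight_space[OF bw_props(1,2)[OF \<nu>] hsub_Vsp[OF hsub_Pm[OF \<mu>]] kproj_Pm[OF \<mu>], of "\<psi> ?u"] by blast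
  from dominance[OF \<nu> \<mu> this] show ?thesis .
qed

subsection \<open>Jucys--Murphy operators\<close>

text \<open>The multiplicative Jucys-Murphy elements, numbered from 0 with the identity first. The
  eigenvalue attached to a box of content \<open>c\<close> is
  \<open>vv powi (2 * c)\<close>.\<close>

fun LL :: "nat \<Rightarrow> nat \<Rightarrow> vec \<Rightarrow> vec" where
  "LL r 0 x = x"
| "LL r (Suc k) x = TT r k (LL r k (TT r k x))"

lemma LL_linear: "LL r k (x + y) = LL r k x + LL r k y" "LL r k (sm c x) = sm c (LL r k x)"
  "LL r k (x - y) = LL r k x - LL r k y" "LL r k 0 = 0"
  by (induction k arbitrary: x y) (simp_all only: LL.simps TT_linear)

lemma LL_hsub: "hsub r N \<Longrightarrow> k < r \<Longrightarrow> x \<in> N \<Longrightarrow> LL r k x \<in> N"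
  by (induction k arbitrary: x) (auto intro: hsub_TT)

lemma LL_selfadjoint: "k < r \<Longrightarrow> x \<in> Vsp r \<Longrightarrow> y \<in> Vsp r \<Longrightarrow> ip (LL r k x) y = ip x (LL r k y)"
proof (induction k arbitrary: x y)
  case (Suc k)
  then show ?case
    using TT_selfadjoint[of "LL r k (TT r k x)" r y k] TT_selfadjoint[of x r "LL r k (TT r k y)" k]
      LL_hsub[OF hsub_Vsp_UNIV, of k r] by (simp add: TT_Vsp)
qed simp

lemma TT_LL_below: "k < j \<Longrightarrow> Suc j < r \<Longrightarrow> TT r j (LL r k x) = LL r k (TT r j x)"
proof (induction k arbitrary: x)
  case (Suc k)
  then show ?case by (simp add: TT_commute[of k j r, symmetric])
qed simp

text \<open>The case not inherited by the induction is the operator of index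
  \<open>Suc (Suc j)\<close>, through which the generator passes by two braid relations.\<close>

lemma TT_LL_above: "Suc j < k \<Longrightarrow> k < r \<Longrightarrow> TT r j (LL r k x) = LL r k (TT r j x)"
proof (induction k arbitrary: x)
  case (Suc k)
  show ?case
  proof (cases "k = Suc j")
    case True
    have "TT r j (LL r (Suc k) x) = TT r j (TT r (Suc j) (TT r j (LL r j (TT r j (TT r (Suc j) x)))))"
      using True by simp
    also have "\<dots> = TT r (Suc j) (TT r j (TT r (Suc j) (LL r j (TT r j (TT r (Suc j) x)))))"
      using Suc.prems True by (intro TT_braid) simp
    also have "\<dots> = TT r (Suc j) (TT r j (LL r j (TT r (Suc j) (TT r j (TT r (Suc j) x)))))"
      using Suc.prems True by (simp add: TT_LL_below)
    also have "\<dots> = TT r (Suc j) (TT r j (LL r j (TT r j (TT r (Suc j) (TT r j x)))))"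
      using Suc.prems True by (simp add: TT_braid)
    finally show ?thesis using True by simp
  next
    case False
    then show ?thesis using Suc by (simp add: TT_commute[of j k r])
  qed
qed simp

lemma LL_commute_less: "i < k \<Longrightarrow> k < r \<Longrightarrow> LL r i (LL r k x) = LL r k (LL r i x)"
  by (induction i arbitrary: x) (simp_all add: TT_LL_above)

lemma LL_commute: "i < r \<Longrightarrow> k < r \<Longrightarrow> LL r i (LL r k x) = LL r k (LL r i x)"
  using LL_commute_less[of i k r] LL_commute_less[of k i r] by (cases i k rule: linorder_cases) auto

lemma LL_Suc_TT:
  assumes "Suc k < r"
  shows "LL r (Suc k) (TT r k x) = TT r k (LL r k x) + sm hh (LL r (Suc k) x)"
  using TT_quad[OF assms, of x] by (simp add: LL_linear TT_linear)

lemma TT_LL_Suc: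
  assumes "Suc k < r"
  shows "TT r k (LL r (Suc k) x) = LL r k (TT r k x) + sm hh (LL r (Suc k) x)"
  using TT_quad[OF assms, of "LL r k (TT r k x)"] by simp

lemma vv_cancel: "vv * (inverse vv * q) = q" "inverse vv * (vv * q) = q" for q :: qv
  by (simp_all flip: mult.assoc)

text \<open>The intertwiner of the affine Hecke algebra: it exchanges two consecutive Jucys--Murphy operators.\<close>
definition twine :: "nat \<Rightarrow> nat \<Rightarrow> vec \<Rightarrow> vec" where
  "twine r k x = TT r k (LL r k x) - LL r k (TT r k x)"

lemma twine_linear: "twine r k (x - y) = twine r k x - twine r k y" "twine r k (sm c x) = sm c (twine r k x)"
  "twine r k 0 = 0"
  by (auto simp: twine_def TT_linear LL_linear sm_distribs(2))

lemma LL_twine: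
  assumes "Suc k < r"
  shows "LL r (Suc k) (twine r k x) = twine r k (LL r k x)" "LL r k (twine r k x) = twine r k (LL r (Suc k) x)"
proof -
  have c: "LL r k (LL r (Suc k) y) = LL r (Suc k) (LL r k y)" for y
    using assms by (intro LL_commute) auto
  note a = LL_Suc_TT[OF assms] and b = TT_LL_Suc[OF assms]
  show "LL r (Suc k) (twine r k x) = twine r k (LL r k x)"
    unfolding twine_def
    by (simp only: LL_linear a b c[symmetric]) (simp only: LL_linear a b c, simp)
  have "twine r k (LL r (Suc k) x) = LL r k (TT r k (LL r k x)) + sm hh (LL r (Suc k) (LL r k x))
      - LL r k (LL r k (TT r k x) + sm hh (LL r (Suc k) x))"
    unfolding twine_def by (simp only: c b)
  also have "\<dots> = LL r k (twine r k x)" unfolding twine_def by (simp only: LL_linear c) simp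
  finally show "LL r k (twine r k x) = twine r k (LL r (Suc k) x)" by simp
qed

text \<open>With L and M for the two consecutive operators, the right side is -(M - v^2 L)(M -
  v^(-2) L). So a vector killed by the squared intertwiner relates eigenvalues that differ by a
  factor v^2 or v^(-2), that is, contents that differ by one.\<close>

lemma twine_twine:
  assumes "Suc k < r"
  shows "twine r k (twine r k x) = sm (vv * vv + inverse vv * inverse vv) (LL r k (LL r (Suc k) x))
    - LL r (Suc k) (LL r (Suc k) x) - LL r k (LL r k x)"
proof -
  let ?L = "LL r k" and ?M = "LL r (Suc k)" and ?T = "TT r k"
  have c: "?M (?L y) = ?L (?M y)" for y
    using assms by (intro LL_commute) auto
  have f: "twine r k y = ?T (?L y) - ?T (?M y) + sm hh (?M y)" for y
    unfolding twine_def TT_LL_Suc[OF assms] by simp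
  have g: "?T (twine r k y) = ?L y - ?M y + sm hh (?T (?L y))" for y
    unfolding f TT_linear TT_quad[OF assms] by simp
  have id: "p - m + sm k t1 - (l - p + sm k t2) + sm k (t2 - t1 + sm k p) = sm (k * k + 2) p - m - l"
    for p m l t1 t2 :: vec and k
    by (rule ext) (simp add: sm_apply algebra_simps)
  have h: "hh * hh + 2 = vv * vv + inverse vv * inverse vv" by (simp add: algebra_simps)
  have "twine r k (twine r k x) = ?T (twine r k (?M x)) - ?T (twine r k (?L x)) + sm hh (twine r k (?L x))"
    unfolding f[of "twine r k x"] LL_twine[OF assms] ..
  also have "\<dots> = ?L (?M x) - ?M (?M x) + sm hh (?T (?L (?M x))) - (?L (?L x) - ?M (?L x) + sm hh (?T (?L (?L x))))
      + sm hh (?T (?L (?L x)) - ?T (?M (?L x)) + sm hh (?M (?L x)))"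
    unfolding g by (simp only: f[of "?L x"])
  also have "\<dots> = sm (hh * hh + 2) (?L (?M x)) - ?M (?M x) - ?L (?L x)"
    unfolding c by (rule id)
  finally show ?thesis unfolding h .
qed

text \<open>The product of the operators \<open>A - a\<close> over the list, applied to
  \<open>x\<close>. That it vanishes replaces an annihilating polynomial with known roots.\<close>

definition evp :: "(vec \<Rightarrow> vec) \<Rightarrow> qv list \<Rightarrow> vec \<Rightarrow> vec" where
  "evp A as x = fold (\<lambda>a y. A y - sm a y) as x"

lemma evp_simps: "evp A [] x = x" "evp A (a # as) x = evp A as (A x - sm a x)"
  "evp A (as @ bs) x = evp A bs (evp A as x)"
  by (auto simp: evp_def)

lemma evp_transport:
  assumes "\<And>x. f (A x) = B (f x)" "\<And>x y. f (x - y) = f x - f y" "\<And>c x. f (sm c x) = sm c (f x)"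
  shows "f (evp A as x) = evp B as (f x)"
proof (induction as arbitrary: x)
  case (Cons a as)
  then show ?case by (simp only: evp_simps assms)
qed (simp only: evp_simps)

lemma evp_zero: "A 0 = 0 \<Longrightarrow> evp A as 0 = 0"
  by (induction as) (simp_all add: evp_simps)

lemma evp_diff:
  assumes "\<And>x y. A (x - y) = A x - A y"
  shows "evp A as (x - y) = evp A as x - evp A as y"
proof (induction as arbitrary: x y)
  case (Cons a as)
  have "A (x - y) - sm a (x - y) = (A x - sm a x) - (A y - sm a y)"
    by (simp add: assms sm_distribs)
  then show ?case by (simp only: evp_simps Cons)
qed (simp only: evp_simps)

lemma evp_sm:
  assumes "\<And>x y. A (x - y) = A x - A y" "\<And>c x. A (sm c x) = sm c (A x)"
  shows "evp A as (sm c x) = sm c (evp A as x)"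
  by (rule evp_transport[of "sm c" A A, symmetric]) (simp_all only: assms sm_distribs sm_simps mult.commute)

text \<open>Peeling off one factor \<open>d\<close> at a time reduces to the vector
  \<open>z\<close>, on which the lower operator acts by \<open>d\<close>. The factors
  \<open>as\<close> kill the intertwined vector, because the intertwiner turns the upper operator
  into the lower one. Hence the squared intertwiner kills \<open>z\<close>, and
  \<open>twine_twine\<close> gives the quadratic equation with roots v^2 d and v^(-2) d.\<close>

lemma LL_annihilated_step:
  assumes k: "Suc k < r" and as: "\<And>x. evp (LL r k) as x = 0" and ds: "evp (LL r k) ds y = 0"
  shows "evp (LL r (Suc k)) (concat (map (\<lambda>d. [vv * vv * d, inverse vv * inverse vv * d]) ds) @ as) y = 0"
  using ds
proof (induction ds arbitrary: y)
  case Nil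
  then have "y = 0" by (simp only: evp_simps)
  then show ?case by (simp only: evp_zero LL_linear)
next
  case (Cons d ds)
  let ?L = "LL r k" and ?M = "LL r (Suc k)"
  let ?cc = "concat (map (\<lambda>d. [vv * vv * d, inverse vv * inverse vv * d]) ds)"
  let ?B = "evp ?M (?cc @ as)"
  have c: "?L (?M x) = ?M (?L x)" for x using k by (intro LL_commute) auto
  have LB: "?L (?B x) = ?B (?L x)" for x by (rule evp_transport) (simp_all only: c LL_linear)
  have MB: "?M (?B x) = ?B (?M x)" for x by (rule evp_transport) (simp_all only: LL_linear)
  have Bd: "?B (x - z) = ?B x - ?B z" and Bs: "?B (sm e x) = sm e (?B x)" for x z e
    by (rule evp_diff evp_sm; simp only: LL_linear)+
  define z where "z = ?B y"
  have "evp ?L ds (?L y - sm d y) = 0" using Cons.prems by (simp only: evp_simps)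
  from Cons.IH[OF this] have "?B (?L y - sm d y) = 0" .
  then have "?B (?L y) - sm d (?B y) = 0" by (simp only: Bd Bs)
  then have e: "?L z = sm d z" unfolding z_def LB by simp
  have "twine r k z = evp ?L (?cc @ as) (twine r k y)"
    unfolding z_def by (rule evp_transport) (simp_all only: LL_twine[OF k] twine_linear)
  also have "\<dots> = 0" unfolding evp_simps as ..
  finally have "twine r k (twine r k z) = 0" by (simp only: twine_linear)
  then have t: "sm (vv * vv + inverse vv * inverse vv) (sm d (?M z)) - ?M (?M z) - sm d (sm d z) = 0"
    unfolding twine_twine[OF k] c e LL_linear .
  have "?M (?M z - sm (vv * vv * d) z) - sm (inverse vv * inverse vv * d) (?M z - sm (vv * vv * d) z) = 0"
  proof (rule ext)
    fix w
    define m where "m = ?M z w"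
    define n where "n = ?M (?M z) w"
    have "(vv * vv + inverse vv * inverse vv) * (d * m) - n - d * (d * z w) = 0"
      using fun_cong[OF t, of w] by (simp only: m_def n_def sm_apply fun_diff_def zero_fun_apply)
    then have "n - vv * vv * d * m - inverse vv * inverse vv * d * (m - vv * vv * d * z w) = 0"
      by (simp add: algebra_simps vv_cancel)
    then show "(?M (?M z - sm (vv * vv * d) z) - sm (inverse vv * inverse vv * d) (?M z - sm (vv * vv * d) z)) w = 0 w"
      unfolding LL_linear m_def n_def by (simp only: sm_apply fun_diff_def zero_fun_apply)
  qed
  then have "?B (?M (?M y - sm (vv * vv * d) y) - sm (inverse vv * inverse vv * d) (?M y - sm (vv * vv * d) y)) = 0"
    unfolding z_def by (simp only: MB[symmetric] Bd Bs)
  then show ?case by (simp only: list.map concat.simps append_Cons append_Nil evp_simps)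
qed

lemma vv_powi_add2: "vv * vv * vv powi (2 * c) = vv powi (2 * (c + 1))"
  "inverse vv * inverse vv * vv powi (2 * c) = vv powi (2 * (c - 1))"
proof -
  have "vv powi (2 * (c + 1)) = vv powi (2 * c) * vv powi 2"
    by (simp only: distrib_left power_int_add[OF disjI1[OF vv_nz]]) simp
  then show "vv * vv * vv powi (2 * c) = vv powi (2 * (c + 1))" by (simp add: power2_eq_square)
  have "vv powi (2 * (c - 1) + 2) = vv powi (2 * (c - 1)) * vv powi 2" by (rule power_int_add) simp
  then have "vv powi (2 * c) = vv powi (2 * (c - 1)) * (vv * vv)" by (simp add: power2_eq_square)
  then show "inverse vv * inverse vv * vv powi (2 * c) = vv powi (2 * (c - 1))"
    by (simp only: mult_ac vv_cancel)
qed

text \<open>A root with exponent \<open>2 * c\<close> at one level produces \<open>c + 1\<close> and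
  \<open>c - 1\<close> at the next, besides the old ones; the start is the identity, with root
  exponent 0.\<close>

lemma LL_annihilated:
  "k < r \<Longrightarrow> \<exists>cs. \<forall>x. evp (LL r k) (map (\<lambda>c. vv powi (2 * c)) cs) x = 0"
proof (induction k)
  case 0
  have "evp (LL r 0) (map (\<lambda>c. vv powi (2 * c)) [0]) x = 0" for x by (simp add: evp_simps)
  then show ?case by blast
next
  case (Suc k)
  have "k < r" using Suc.prems by simp
  from Suc.IH[OF this] obtain cs where "\<forall>x. evp (LL r k) (map (\<lambda>c. vv powi (2 * c)) cs) x = 0" by blast
  then have cs: "evp (LL r k) (map (\<lambda>c. vv powi (2 * c)) cs) x = 0" for x by blast
  have "concat (map (\<lambda>d. [vv * vv * d, inverse vv * inverse vv * d]) (map (\<lambda>c. vv powi (2 * c)) cs))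
      = map (\<lambda>c. vv powi (2 * c)) (concat (map (\<lambda>c. [c + 1, c - 1]) cs))"
    by (induction cs) (simp_all only: list.map concat.simps append_Cons append_Nil vv_powi_add2 map_append)
  with LL_annihilated_step[OF Suc.prems cs cs]
  have "evp (LL r (Suc k)) (map (\<lambda>c. vv powi (2 * c)) (concat (map (\<lambda>c. [c + 1, c - 1]) cs) @ cs)) x = 0" for x
    by (simp only: map_append)
  then show ?case by blast
qed

text \<open>Apply the factors one after the other: the last nonzero vector is an eigenvector for the
  next factor, and it still lies in \<open>M\<close>.\<close>

lemma eigenvector_exists:
  assumes "evp A as y = 0" "y \<in> M" "y \<noteq> 0" "\<And>x a. x \<in> M \<Longrightarrow> A x - sm a x \<in> M"
  shows "\<exists>a\<in>set as. \<exists>x\<in>M. x \<noteq> 0 \<and> A x = sm a x"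
  using assms(1-3)
proof (induction as arbitrary: y)
  case (Cons a as)
  show ?case
  proof (cases "A y - sm a y = 0")
    case True
    then have "A y = sm a y" by simp
    then show ?thesis using Cons.prems(2,3) by auto
  next
    case False
    have "evp A as (A y - sm a y) = 0" using Cons.prems(1) by (simp only: evp_simps)
    from Cons.IH[OF this assms(4)[OF Cons.prems(2)] False] show ?thesis by auto
  qed
qed (simp only: evp_simps)

section \<open>Joint weights and the action of one generator on them\<close>

definition jmw :: "nat \<Rightarrow> int list \<Rightarrow> vec \<Rightarrow> bool" where
  "jmw r c x \<longleftrightarrow> length c = r \<and> x \<noteq> 0 \<and> (\<forall>i<r. LL r i x = sm (vv powi (2 * c ! i)) x)"

lemma jmw_exists:
  assumes N: "hsub r N" "y \<in> N" "y \<noteq> 0"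
  shows "\<exists>c x. x \<in> N \<and> jmw r c x"
proof -
  note S = hsub_subspace[OF N(1)]
  have "k \<le> r \<Longrightarrow> \<exists>c x. length c = k \<and> x \<in> N \<and> x \<noteq> 0 \<and> (\<forall>i<k. LL r i x = sm (vv powi (2 * c ! i)) x)" for k
  proof (induction k)
    case 0
    have "length ([] :: int list) = 0 \<and> y \<in> N \<and> y \<noteq> 0 \<and> (\<forall>i<0. LL r i y = sm (vv powi (2 * [] ! i)) y)"
      using N by simp
    then show ?case by blast
  next
    case (Suc k)
    then have "k \<le> r" by simp
    from Suc.IH[OF this] obtain c x
      where c: "length c = k" "x \<in> N" "x \<noteq> 0" "\<forall>i<k. LL r i x = sm (vv powi (2 * c ! i)) x" by blast
    \<comment> \<open>The joint eigenspace of the earlier operators in \<open>N\<close>. The next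
      operator preserves it because all of them commute.\<close>
    let ?M = "{x\<in>N. \<forall>i<k. LL r i x = sm (vv powi (2 * c ! i)) x}"
    have k: "k < r" using Suc.prems by simp
    obtain cs where cs: "\<And>x. evp (LL r k) (map (\<lambda>c. vv powi (2 * c)) cs) x = 0" using LL_annihilated[OF k] by blast
    have M: "LL r k z - sm a z \<in> ?M" if z: "z \<in> ?M" for z a
    proof -
      have "LL r i (LL r k z - sm a z) = sm (vv powi (2 * c ! i)) (LL r k z - sm a z)" if i: "i < k" for i
      proof -
        have "LL r i (LL r k z) = LL r k (LL r i z)" using i k by (intro LL_commute) auto
        then show ?thesis using z i by (simp add: LL_linear sm_distribs mult.commute)
      qed
      moreover have "LL r k z - sm a z \<in> N"
        using z k by (intro qvs.subspace_diff[OF S] qvs.subspace_scale[OF S] LL_hsub[OF N(1)]) auto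
      ultimately show ?thesis by blast
    qed
    have "x \<in> ?M" using c by blast
    from eigenvector_exists[of "LL r k", OF cs this c(3) M]
    obtain a z where z: "a \<in> set (map (\<lambda>c. vv powi (2 * c)) cs)" "z \<in> ?M" "z \<noteq> 0" "LL r k z = sm a z"
      by blast
    then obtain d where d: "a = vv powi (2 * d)" by auto
    have "\<forall>i<Suc k. LL r i z = sm (vv powi (2 * (c @ [d]) ! i)) z"
      using z(2,4) c(1) d by (auto simp: nth_append less_Suc_eq)
    then show ?case using z(2,3) c(1) by (intro exI[of _ "c @ [d]"] exI[of _ z]) auto
  qed
  from this[of r] show ?thesis unfolding jmw_def by blast
qed

definition wts :: "nat \<Rightarrow> vec set \<Rightarrow> int list set" where
  "wts r N = {c. \<exists>x\<in>N. jmw r c x}"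

lemma jmw_hd: "jmw r c x \<Longrightarrow> 0 < r \<Longrightarrow> c ! 0 = 0"
proof -
  assume "jmw r c x" "0 < r"
  then have x: "sm (vv powi (2 * c ! 0)) x = x" "x \<noteq> 0" by (auto simp: jmw_def)
  then have "sm (vv powi (2 * c ! 0) - 1) x = 0" by (simp only: sm_distribs) simp
  then have "vv powi (2 * c ! 0) = vv powi 0" using x(2) by (simp add: sm_eq_0_iff)
  then show "c ! 0 = 0" unfolding vv_powi_inj by simp
qed

text \<open>The two formulas describe the plane of \<open>x\<close> and \<open>TT r j x\<close>. If
  neighbouring entries were equal, the lower operator would have a Jordan block there, which a
  self-adjoint operator for a definite form cannot have.\<close>

lemma jmw_local:
  assumes w: "jmw r c x" and V: "x \<in> Vsp r" and j: "Suc j < r"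
  defines "a \<equiv> vv powi (2 * c ! j)" and "b \<equiv> vv powi (2 * c ! Suc j)"
  shows "LL r j (TT r j x) = sm b (TT r j x) - sm (hh * b) x"
    and "LL r (Suc j) (TT r j x) = sm a (TT r j x) + sm (hh * b) x"
    and "c ! j \<noteq> c ! Suc j"
proof -
  have e: "LL r j x = sm a x" "LL r (Suc j) x = sm b x" using w j by (auto simp: jmw_def a_def b_def simp del: LL.simps)
  show 1: "LL r j (TT r j x) = sm b (TT r j x) - sm (hh * b) x"
    using TT_LL_Suc[OF j, of x] unfolding e by (simp add: TT_linear)
  show "LL r (Suc j) (TT r j x) = sm a (TT r j x) + sm (hh * b) x"
    using LL_Suc_TT[OF j, of x] unfolding e TT_linear by simp
  show "c ! j \<noteq> c ! Suc j"
  proof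
    assume "c ! j = c ! Suc j"
    then have ab: "a = b" by (simp add: a_def b_def)
    have TV: "TT r j x \<in> Vsp r" using V j by blast
    have "ip x (LL r j (TT r j x)) = ip (LL r j x) (TT r j x)"
      using LL_selfadjoint[of j r x "TT r j x"] V TV j by simp
    also have "\<dots> = b * ip x (TT r j x)" unfolding e ab using ip_sm_left[OF V TV] .
    finally have "hh * b * ip x x = 0" unfolding 1 by (simp add: ip_diff_right ip_sm_right)
    moreover have "b \<noteq> 0" by (simp add: b_def)
    ultimately have "ip x x = 0" using hh_pos by simp
    then show False using ip_definite[OF V] w by (simp add: jmw_def)
  qed
qed

text \<open>The value \<open>s\<close> is the one for which \<open>TT r j x - sm s x\<close> is
  again an eigenvector in that plane; its two eigenvalues are exchanged.\<close>

lemma jmw_swap: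
  assumes w: "jmw r c x" and V: "x \<in> Vsp r" and j: "Suc j < r"
    and s: "s = hh * vv powi (2 * c ! Suc j) / (vv powi (2 * c ! Suc j) - vv powi (2 * c ! j))"
    and ne: "TT r j x \<noteq> sm s x"
  shows "jmw r (swp j c) (TT r j x - sm s x)"
proof -
  define a where "a = vv powi (2 * c ! j)"
  define b where "b = vv powi (2 * c ! Suc j)"
  note loc = jmw_local[OF w V j, folded a_def b_def]
  have l: "length c = r" using w by (simp add: jmw_def)
  have e: "LL r i x = sm (vv powi (2 * c ! i)) x" if "i < r" for i using w that by (auto simp: jmw_def)
  have ba: "b - a \<noteq> 0" using loc(3) by (simp add: a_def b_def vv_powi_inj)
  have s': "s = hh * b / (b - a)" using s by (simp add: a_def b_def)
  then have sb: "s * (b - a) = hh * b" using ba by simp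
  let ?y = "TT r j x - sm s x"
  have "LL r i ?y = sm (vv powi (2 * swp j c ! i)) ?y" if i: "i < r" for i
  proof -
    consider "i = j" | "i = Suc j" | "i \<noteq> j" "i \<noteq> Suc j" by blast
    then show ?thesis
    proof cases
      case 1
      have "LL r j ?y = sm b (TT r j x) - sm (hh * b) x - sm (s * a) x"
        using e[of j] j by (simp only: LL_linear loc) (simp add: a_def)
      also have "\<dots> = sm b ?y" unfolding sb[symmetric] by (simp add: fun_eq_iff sm_apply algebra_simps)
      finally show ?thesis using 1 j l by (simp add: swp_nth b_def)
    next
      case 2
      have "LL r (Suc j) ?y = sm a (TT r j x) + sm (hh * b) x - sm (s * b) x"
        using e[of "Suc j"] j by (simp only: LL_linear loc) (simp add: b_def)
      also have "\<dots> = sm a ?y" unfolding sb[symmetric] by (simp add: fun_eq_iff sm_apply algebra_simps)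
      finally show ?thesis using 2 j l by (simp add: swp_nth a_def)
    next
      case 3
      have "LL r i (TT r j x) = TT r j (LL r i x)"
        using TT_LL_below[of i j r x] TT_LL_above[of j i r x] 3 i j by (cases "i < j") auto
      then show ?thesis using e[OF i] 3 i j l by (simp add: LL_linear TT_linear swp_nth sm_distribs mult.commute)
    qed
  qed
  then show ?thesis using ne l by (simp add: jmw_def)
qed

lemma quad_roots: "s * s = 1 + hh * s \<longleftrightarrow> s = vv \<or> s = qm"
proof -
  have "s * s - (1 + hh * s) = (s - vv) * (s + inverse vv)" by (simp add: algebra_simps)
  then have "s * s = 1 + hh * s \<longleftrightarrow> (s - vv) * (s + inverse vv) = 0" by (metis eq_iff_diff_eq_0)
  then show ?thesis by (simp add: eq_neg_iff_add_eq_0)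
qed

text \<open>The fraction is the coefficient \<open>s\<close> of \<open>jmw_swap\<close>. It is a
  root of the quadratic relation exactly when the two contents differ by one.\<close>

lemma ratio_root:
  assumes "b \<noteq> 0" "a \<noteq> (b :: qv)"
  shows "hh * b / (b - a) = vv \<longleftrightarrow> b = vv * vv * a" "hh * b / (b - a) = qm \<longleftrightarrow> b = inverse vv * inverse vv * a"
proof -
  have ba: "b - a \<noteq> 0" using assms by simp
  have "hh * b / (b - a) = vv \<longleftrightarrow> hh * b = vv * (b - a)" using ba by (simp add: nonzero_divide_eq_eq)
  also have "\<dots> \<longleftrightarrow> inverse vv * b = vv * a" by (auto simp: algebra_simps)
  also have "\<dots> \<longleftrightarrow> b = vv * vv * a" by (metis vv_cancel mult.assoc)
  finally show "hh * b / (b - a) = vv \<longleftrightarrow> b = vv * vv * a" .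
  have "hh * b / (b - a) = qm \<longleftrightarrow> hh * b = qm * (b - a)" using ba by (simp add: nonzero_divide_eq_eq)
  also have "\<dots> \<longleftrightarrow> vv * b = inverse vv * a" by (auto simp: algebra_simps)
  also have "\<dots> \<longleftrightarrow> b = inverse vv * inverse vv * a" by (metis vv_cancel mult.assoc)
  finally show "hh * b / (b - a) = qm \<longleftrightarrow> b = inverse vv * inverse vv * a" .
qed

lemma powi_ratio: "vv powi (2 * d) = vv * vv * vv powi (2 * c) \<longleftrightarrow> d = c + 1"
  "vv powi (2 * d) = inverse vv * inverse vv * vv powi (2 * c) \<longleftrightarrow> d = c - 1"
  unfolding vv_powi_add2 vv_powi_inj by auto

text \<open>If the swapped vector were zero, \<open>s\<close> would be an eigenvalue of a generator,
  hence a root, and the contents would be adjacent.\<close>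

lemma jmw_swap_mem:
  assumes N: "hsub r N" "x \<in> N" "jmw r c x" and j: "Suc j < r" and far: "2 \<le> \<bar>c ! j - c ! Suc j\<bar>"
  shows "swp j c \<in> wts r N"
proof -
  have V: "x \<in> Vsp r" using hsub_Vsp N by blast
  define s where "s = hh * vv powi (2 * c ! Suc j) / (vv powi (2 * c ! Suc j) - vv powi (2 * c ! j))"
  have ne: "TT r j x \<noteq> sm s x"
  proof
    assume T: "TT r j x = sm s x"
    then have "sm (s * s) x = sm (1 + hh * s) x" using TT_quad[OF j, of x] by (simp add: TT_linear sm_distribs(3))
    then have "sm (s * s - (1 + hh * s)) x = 0" by (simp only: sm_distribs(4)) simp
    then have "s * s = 1 + hh * s" using N(3) by (simp only: sm_eq_0_iff jmw_def) simp
    then have "s = vv \<or> s = qm" by (simp only: quad_roots)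
    then have "c ! Suc j = c ! j + 1 \<or> c ! Suc j = c ! j - 1"
      unfolding s_def using ratio_root[of "vv powi (2 * c ! Suc j)" "vv powi (2 * c ! j)"] far
      by (auto simp: powi_ratio vv_powi_inj)
    then show False using far by auto
  qed
  have "TT r j x - sm s x \<in> N"
    using N j by (intro qvs.subspace_diff qvs.subspace_scale hsub_subspace[OF N(1)] hsub_TT[OF N(1)]) auto
  then show ?thesis unfolding wts_def using jmw_swap[OF N(3) V j s_def ne] by blast
qed

text \<open>Suppose the swapped vector \<open>?y\<close> is nonzero. It is an eigenvector of the
  generator for the other root \<open>hh - s\<close>, and it is orthogonal to \<open>x\<close>
  because their eigenvalues for \<open>LL r j\<close> differ. Moving the generator across the form
  then gives \<open>ip ?y ?y = 0\<close>.\<close>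

lemma jmw_adjacent:
  assumes w: "jmw r c x" and V: "x \<in> Vsp r" and j: "Suc j < r"
    and s: "s = hh * vv powi (2 * c ! Suc j) / (vv powi (2 * c ! Suc j) - vv powi (2 * c ! j))"
    and q: "s * s = 1 + hh * s"
  shows "TT r j x = sm s x"
proof (rule ccontr)
  assume ne: "TT r j x \<noteq> sm s x"
  let ?y = "TT r j x - sm s x"
  have y: "jmw r (swp j c) ?y" by (rule jmw_swap[OF w V j s ne])
  have yV: "?y \<in> Vsp r" using V j by (intro Vsp_diff Vsp_sm TT_Vsp)
  have l: "length c = r" using w by (simp add: jmw_def)
  have s0: "s \<noteq> 0" using q by auto
  have Ty: "TT r j ?y = sm (hh - s) ?y"
  proof -
    have "(hh - s) * s = -1" using q by (simp only: left_diff_distrib)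
    then have "sm (hh - s) ?y = sm (hh - s) (TT r j x) + x" by (simp only: sm_distribs(2) sm_simps) (simp add: sm_distribs)
    also have "\<dots> = TT r j ?y" by (simp add: TT_linear TT_quad[OF j] sm_distribs(4))
    finally show ?thesis by simp
  qed
  have "vv powi (2 * c ! j) * ip x ?y = ip (LL r j x) ?y"
    using w j V yV by (simp add: jmw_def ip_sm_left)
  also have "\<dots> = ip x (LL r j ?y)" using LL_selfadjoint[of j r x ?y] V yV j by simp
  also have "\<dots> = vv powi (2 * c ! Suc j) * ip x ?y"
    using y j l by (simp add: jmw_def ip_sm_right swp_nth)
  finally have xy: "ip x ?y = 0" using jmw_local(3)[OF w V j] by (auto simp: vv_powi_inj)
  have "ip ?y ?y = ip (TT r j x) ?y - s * ip x ?y"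
    using ip_diff_left[of "TT r j x" r "sm s x" ?y] ip_sm_left[OF V yV] V yV j by (simp add: TT_Vsp Vsp_sm)
  also have "ip (TT r j x) ?y = (hh - s) * ip x ?y"
    using TT_selfadjoint[OF V yV j] unfolding Ty ip_sm_right .
  finally have "ip ?y ?y = 0" unfolding xy by (simp only: mult_zero_right diff_self)
  then show False using ip_definite[OF yV] y by (simp add: jmw_def)
qed

lemma jmw_succ:
  assumes "jmw r c x" "x \<in> Vsp r" "Suc j < r"
  shows "c ! Suc j = c ! j + 1 \<Longrightarrow> TT r j x = sm vv x" "c ! Suc j = c ! j - 1 \<Longrightarrow> TT r j x = sm qm x"
proof -
  have ne: "vv powi (2 * c ! j) \<noteq> vv powi (2 * c ! Suc j)" "vv powi (2 * c ! Suc j) \<noteq> 0"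
    using jmw_local(3)[OF assms] by (auto simp: vv_powi_inj)
  note rr = ratio_root[OF ne(2,1)]
  show "TT r j x = sm vv x" if "c ! Suc j = c ! j + 1"
    by (rule jmw_adjacent[OF assms _ vv_quad]) (use rr(1) that powi_ratio(1)[of "c ! Suc j" "c ! j"] in simp)
  show "TT r j x = sm qm x" if "c ! Suc j = c ! j - 1"
    by (rule jmw_adjacent[OF assms _ qm_quad]) (use rr(2) that powi_ratio(2)[of "c ! Suc j" "c ! j"] in simp)
qed

text \<open>Both generators would act on \<open>x\<close> by scalars, one by \<open>vv\<close> and
  the other by \<open>qm\<close>, while the braid relation forces these scalars to be equal.\<close>

lemma jmw_no_braid:
  assumes "jmw r c x" "x \<in> Vsp r" "Suc (Suc j) < r" "c ! j = c ! Suc (Suc j)"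
  shows "\<bar>c ! j - c ! Suc j\<bar> \<noteq> 1"
proof
  assume "\<bar>c ! j - c ! Suc j\<bar> = 1"
  then consider "c ! Suc j = c ! j + 1" | "c ! Suc j = c ! j - 1" by linarith
  then obtain s t where st: "TT r j x = sm s x" "TT r (Suc j) x = sm t x" "s \<noteq> t" "s \<noteq> 0" "t \<noteq> 0"
  proof cases
    case 1
    then show ?thesis using that[of vv qm] jmw_succ[OF assms(1,2), of j] jmw_succ[OF assms(1,2,3)] assms(3,4) qm_neq by simp
  next
    case 2
    then show ?thesis using that[of qm vv] jmw_succ[OF assms(1,2), of j] jmw_succ[OF assms(1,2,3)] assms(3,4) qm_neq by simp
  qed
  have "sm (s * (t * s)) x = sm (t * (s * t)) x"
    using TT_braid[OF assms(3), of x] by (simp add: st TT_linear mult_ac)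
  then have "sm (s * t * (s - t)) x = 0" by (simp add: algebra_simps sm_distribs(4))
  then show False using st assms(1) by (simp add: sm_eq_0_iff jmw_def)
qed

subsection \<open>Content sequences\<close>

text \<open>These properties of the set of weights are isolated because they are invariant under
  negation. The column reading is thereby obtained from the row reading of the negated
  weights.\<close>

definition admissible :: "int list set \<Rightarrow> bool" where
  "admissible W \<longleftrightarrow> (\<forall>a zs. a # zs \<in> W \<longrightarrow> a = 0)
     \<and> (\<forall>xs a b zs. xs @ [a, b] @ zs \<in> W \<longrightarrow> a \<noteq> b)
     \<and> (\<forall>xs a b zs. xs @ [a, b] @ zs \<in> W \<longrightarrow> 2 \<le> \<bar>a - b\<bar> \<longrightarrow> xs @ [b, a] @ zs \<in> W)
     \<and> (\<forall>xs a b zs. xs @ [a, b, a] @ zs \<in> W \<longrightarrow> \<bar>a - b\<bar> \<noteq> 1)"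

lemma admissibleD:
  assumes "admissible W"
  shows "a # zs \<in> W \<Longrightarrow> a = 0" "xs @ [a, b] @ zs \<in> W \<Longrightarrow> a \<noteq> b"
    "xs @ [a, b] @ zs \<in> W \<Longrightarrow> 2 \<le> \<bar>a - b\<bar> \<Longrightarrow> xs @ [b, a] @ zs \<in> W"
    "xs @ [a, b, a] @ zs \<in> W \<Longrightarrow> \<bar>a - b\<bar> \<noteq> 1"
  using assms unfolding admissible_def by blast+

lemma move_left:
  assumes "admissible W" "xs @ ys @ [s] @ zs \<in> W" "\<And>y. y \<in> set ys \<Longrightarrow> 2 \<le> \<bar>y - s\<bar>"
  shows "xs @ [s] @ ys @ zs \<in> W"
  using assms(2,3)
proof (induction ys arbitrary: zs rule: rev_induct)
  case (snoc y ys)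
  have "(xs @ ys) @ [s, y] @ zs \<in> W"
    by (rule admissibleD(3)[OF assms(1)]) (use snoc.prems in auto)
  then have "xs @ ys @ [s] @ (y # zs) \<in> W" by simp
  from snoc.IH[OF this] snoc.prems(2) show ?case by simp
qed simp

lemma move_right:
  assumes "admissible W" "xs @ [s] @ ys @ zs \<in> W" "\<And>y. y \<in> set ys \<Longrightarrow> 2 \<le> \<bar>y - s\<bar>"
  shows "xs @ ys @ [s] @ zs \<in> W"
  using assms(2,3)
proof (induction ys arbitrary: xs)
  case (Cons y ys)
  have "2 \<le> \<bar>s - y\<bar>" using Cons.prems(2)[of y] by simp
  then have "xs @ [y, s] @ ys @ zs \<in> W"
    using admissibleD(3)[OF assms(1), of xs s y "ys @ zs"] Cons.prems(1) by simp
  then have "(xs @ [y]) @ [s] @ ys @ zs \<in> W" by simp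
  from Cons.IH[OF this] Cons.prems(2) show ?case by simp
qed simp

text \<open>Boxes are zero-based pairs (row, column), row after row. Then \<open>crow\<close> is the
  content sequence of the row-reading standard tableau, and \<open>brow\<close> numbers the rows
  from 1 to match the basis word \<open>omega_lam\<close>.\<close>

definition rowbox :: "nat list \<Rightarrow> (nat \<times> nat) list" where
  "rowbox ls = concat (map (\<lambda>i. map (Pair i) [0..<ls ! i]) [0..<length ls])"

definition crow :: "nat list \<Rightarrow> int list" where
  "crow ls = map (\<lambda>(i, j). int j - int i) (rowbox ls)"

definition brow :: "nat list \<Rightarrow> int list" where
  "brow ls = map (\<lambda>(i, j). int i + 1) (rowbox ls)"

definition valid :: "nat list \<Rightarrow> bool" where
  "valid ls \<longleftrightarrow> sorted_wrt (\<ge>) ls \<and> 0 \<notin> set ls"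

lemma rowbox_Nil [simp]: "rowbox [] = []" "crow [] = []" "brow [] = []"
  by (auto simp: rowbox_def crow_def brow_def)

lemma rowbox_snoc: "rowbox (ls @ [l]) = rowbox ls @ map (Pair (length ls)) [0..<l]"
proof -
  have "map (\<lambda>i. map (Pair i) [0..<(ls @ [l]) ! i]) [0..<length ls] = map (\<lambda>i. map (Pair i) [0..<ls ! i]) [0..<length ls]"
    by (auto simp: nth_append)
  then show ?thesis unfolding rowbox_def by (simp del: map_eq_conv)
qed

lemma upto_shift: "map (\<lambda>j. int j - m) [0..<l] = [- m..int l - m - 1]"
proof (induction l)
  case (Suc l)
  then show ?case using upto_rec2[of "- m" "int l - m"] by simp
qed simp

lemma crow_snoc: "crow (ls @ [l]) = crow ls @ [- int (length ls)..int l - int (length ls) - 1]"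
  by (simp add: crow_def rowbox_snoc comp_def upto_shift)

lemma brow_snoc: "brow (ls @ [l]) = brow ls @ replicate l (int (length ls) + 1)"
  by (simp add: brow_def rowbox_snoc comp_def map_replicate_const)

lemma crow_lower: "x \<in> set (crow ls) \<Longrightarrow> - int (length ls) < x"
  by (induction ls arbitrary: x rule: rev_induct) (auto simp: crow_snoc, fastforce)

lemma valid_snoc: "valid (ls @ [l]) \<longleftrightarrow> valid ls \<and> 0 < l \<and> (ls \<noteq> [] \<longrightarrow> l \<le> last ls)"
proof -
  have "(\<forall>x\<in>set ls. l \<le> x) \<longleftrightarrow> (ls \<noteq> [] \<longrightarrow> l \<le> last ls)" if "sorted_wrt (\<ge>) ls"
    using that by (cases ls rule: rev_cases) (auto simp: sorted_wrt_append)
  then show ?thesis by (auto simp: valid_def sorted_wrt_append)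
qed

text \<open>A sequence without ascents larger than one is lexicographically maximal among its rearrangements
  by admissible swaps. Reading it from the left, each entry either continues the current row of a
  diagram or starts the next row; every other value is moved left or right into a forbidden pattern.\<close>
lemma content_rows:
  assumes W: "admissible W" and c: "c \<in> W"
    and asc: "\<And>xs a b zs. c = xs @ [a, b] @ zs \<Longrightarrow> \<not> a + 2 \<le> b"
  shows "n \<le> length c \<Longrightarrow> \<exists>ls. valid ls \<and> take n c = crow ls \<and> (0 < n \<longrightarrow> ls \<noteq> [])"
proof (induction n)
  case 0
  then show ?case by (intro exI[of _ "[]"]) (simp add: valid_def)
next
  case (Suc n)
  define s where "s = c ! n"
  define rest where "rest = drop (Suc n) c"
  have tk: "take (Suc n) c = take n c @ [s]" using Suc.prems by (simp add: s_def take_Suc_conv_app_nth)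
  then have cs: "c = take n c @ [s] @ rest"
    by (metis append.assoc append_take_drop_id rest_def)
  obtain ls where ls: "valid ls" "take n c = crow ls" "0 < n \<longrightarrow> ls \<noteq> []" using Suc by auto
  show ?case
  proof (cases "ls = []")
    case True
    then have "c = s # rest" using cs ls by simp
    then have "s = 0" using admissibleD(1)[OF W] c by simp
    then have "take (Suc n) c = crow ([] @ [1])" using tk ls True by (simp add: crow_snoc del: append_Nil)
    moreover have "valid [1]" by (simp add: valid_def)
    ultimately show ?thesis by (intro exI[of _ "[1]"]) simp
  next
    case False
    then obtain ks l where kl: "ls = ks @ [l]" by (cases ls rule: rev_cases) auto
    define m where "m = int (length ks)"
    define e where "e = int l - m - 1"
    have vk: "valid ks" "0 < l" "ks \<noteq> [] \<longrightarrow> l \<le> last ks" using ls(1) by (auto simp: kl valid_snoc)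
    have me: "- m \<le> e" using vk by (simp add: e_def)
    have ck: "crow ls = crow ks @ [- m..e]" by (simp add: kl crow_snoc m_def e_def)
    have cm: "c = crow ks @ [- m..e] @ [s] @ rest" using cs ls(2) ck by simp
    have ce: "c = (crow ks @ [- m..e - 1]) @ [e, s] @ rest" using cm upto_rec2[OF me] by simp
    have "s \<noteq> e" using admissibleD(2)[OF W] c ce by metis
    moreover have "\<not> e + 2 \<le> s" using asc[OF ce] .
    ultimately consider "s = e + 1" | "- m \<le> s" "s \<le> e - 1" | "s = - m - 1" | "s < - m - 1" by linarith
    then show ?thesis
    proof cases
      case 1
      \<comment> \<open>The entry continues the current row, which must still be shorter than the
        row above. If both have length \<open>l\<close>, the row above ends in \<open>s\<close>;
        that entry moves right past all but the last entry of the current row and creates the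
        pattern \<open>s, e, s\<close>.\<close>
      have "ks \<noteq> [] \<longrightarrow> Suc l \<le> last ks"
      proof (rule ccontr)
        assume "\<not> ?thesis"
        then obtain hs where hs: "ks = hs @ [l]" using vk(3) by (cases ks rule: rev_cases) auto
        have "crow ks = crow hs @ [- (m - 1)..s]"
          using 1 by (simp add: hs crow_snoc m_def e_def)
        moreover have "- (m - 1) \<le> s" using 1 me by simp
        ultimately have "crow ks = (crow hs @ [- (m - 1)..s - 1]) @ [s]" using upto_rec2[of "- (m - 1)" s] by simp
        then have "c = (crow hs @ [- (m - 1)..s - 1]) @ [s] @ [- m..e - 1] @ ([e, s] @ rest)"
          using ce by simp
        then have "(crow hs @ [- (m - 1)..s - 1]) @ [- m..e - 1] @ [s] @ ([e, s] @ rest) \<in> W"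
          using c 1 by (intro move_right[OF W]) auto
        then have "((crow hs @ [- (m - 1)..s - 1]) @ [- m..e - 1]) @ [s, e, s] @ rest \<in> W" by simp
        from admissibleD(4)[OF W this] 1 show False by simp
      qed
      then have "valid (ks @ [Suc l])" using vk by (simp add: valid_snoc)
      moreover have "take (Suc n) c = crow (ks @ [Suc l])"
        using tk ls(2) ck 1 upto_rec2[of "- m" s] me by (simp add: crow_snoc m_def[symmetric] e_def)
      ultimately show ?thesis by blast
    next
      case 2
      \<comment> \<open>The value occurs in the current row before its end. The new entry moves left
        past \<open>s + 2, ..., e\<close> and creates the pattern
        \<open>s, s + 1, s\<close>.\<close>
      have "[- m..e] = [- m..s - 1] @ [s] @ [s + 1] @ [s + 2..e]"
        using 2 upto_split1[of "- m" s e] upto_split1[of "s" "s + 1" e] upto_rec1[of s e] upto_rec1[of "s + 1" e]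
          upto_split2[of "- m" "s - 1" e] by (simp add: add.commute)
      then have "c = (crow ks @ [- m..s - 1] @ [s, s + 1]) @ [s + 2..e] @ [s] @ rest" using cm by simp
      then have "(crow ks @ [- m..s - 1] @ [s, s + 1]) @ [s] @ [s + 2..e] @ rest \<in> W"
        using c by (intro move_left[OF W]) auto
      then have "(crow ks @ [- m..s - 1]) @ [s, s + 1, s] @ ([s + 2..e] @ rest) \<in> W" by simp
      from admissibleD(4)[OF W this] show ?thesis by simp
    next
      case 3
      have "valid (ls @ [1])" unfolding valid_snoc using ls(1) vk kl by simp
      moreover have "take (Suc n) c = crow (ls @ [1])"
      proof -
        have "int 1 - int (length ls) - 1 = s" "- int (length ls) = s" using 3 by (simp_all add: kl m_def)
        then show ?thesis unfolding crow_snoc using tk ls(2) by simp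
      qed
      ultimately show ?thesis by blast
    next
      case 4
      \<comment> \<open>The new entry is at distance at least two from all earlier ones, so it moves
        to the front, where only 0 is allowed.\<close>
      have "2 \<le> \<bar>y - s\<bar>" if "y \<in> set (crow ls)" for y
        using crow_lower[OF that] 4 by (simp add: kl m_def)
      then have "[] @ [s] @ crow ls @ rest \<in> W" using cs c ls(2) by (intro move_left[OF W]) auto
      then have "s = 0" using admissibleD(1)[OF W] by simp
      then show ?thesis using 4 by (simp add: m_def)
    qed
  qed
qed

text \<open>A numerical substitute for the lexicographic order: earlier entries weigh more, so
  moving the larger of two neighbours forward increases the value.\<close>

fun lexval :: "int list \<Rightarrow> int" where
  "lexval [] = 0"
| "lexval (x # xs) = x * int (Suc (length xs)) + lexval xs"

lemma lexval_swap: "lexval (xs @ [b, a] @ zs) = lexval (xs @ [a, b] @ zs) + b - a"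
  by (induction xs) (auto simp: algebra_simps)

lemma content_rows_exists:
  assumes W: "admissible W" and c0: "c0 \<in> W"
  obtains ls where "valid ls" "crow ls \<in> W" "mset (crow ls) = mset c0"
proof -
  let ?W = "{c\<in>W. mset c = mset c0}"
  have "?W \<subseteq> {c. set c \<subseteq> set c0 \<and> length c = length c0}"
    using mset_eq_setD mset_eq_length by fastforce
  then have fin: "finite ?W" by (rule finite_subset) (simp add: finite_lists_length_eq)
  have "Max (lexval ` ?W) \<in> lexval ` ?W" by (rule Max_in) (use fin c0 in auto)
  then obtain c where c: "c \<in> ?W" "lexval c = Max (lexval ` ?W)" by auto
  then have mx: "lexval d \<le> lexval c" if "d \<in> ?W" for d using that fin by simp
  have "\<exists>ls. valid ls \<and> take (length c) c = crow ls \<and> (0 < length c \<longrightarrow> ls \<noteq> [])"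
  proof (rule content_rows[OF W])
    show "c \<in> W" using c by simp
    fix xs a b zs assume e: "c = xs @ [a, b] @ zs"
    show "\<not> a + 2 \<le> b"
    proof
      assume "a + 2 \<le> b"
      then have "xs @ [b, a] @ zs \<in> W" using admissibleD(3)[OF W] c e by auto
      then have "xs @ [b, a] @ zs \<in> ?W" using c e by (simp add: add_mset_commute)
      from mx[OF this] \<open>a + 2 \<le> b\<close> show False using lexval_swap[of xs b a zs] unfolding e by linarith
    qed
  qed simp
  then obtain ls where "valid ls" "c = crow ls" by auto
  then show ?thesis using that c by auto
qed

lemma admissible_uminus:
  assumes "admissible W" shows "admissible (map uminus ` W)"
proof -
  have e: "c \<in> map uminus ` W \<longleftrightarrow> map uminus c \<in> W" for c :: "int list"
  proof
    show "map uminus c \<in> W \<Longrightarrow> c \<in> map uminus ` W"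
      by (rule image_eqI[of _ _ "map uminus c"]) (simp_all add: comp_def)
  qed (auto simp: comp_def)
  show ?thesis unfolding admissible_def e
  proof (intro conjI allI impI)
    show "a = 0" if "map uminus (a # zs) \<in> W" for a zs
      using admissibleD(1)[OF assms, of "- a" "map uminus zs"] that by simp
    show "a \<noteq> b" if "map uminus (xs @ [a, b] @ zs) \<in> W" for xs a b zs
      using admissibleD(2)[OF assms, of "map uminus xs" "- a" "- b" "map uminus zs"] that by simp
    show "map uminus (xs @ [b, a] @ zs) \<in> W" if "map uminus (xs @ [a, b] @ zs) \<in> W" "2 \<le> \<bar>a - b\<bar>" for xs a b zs
      using admissibleD(3)[OF assms, of "map uminus xs" "- a" "- b" "map uminus zs"] that by simp
    show "\<bar>a - b\<bar> \<noteq> 1" if "map uminus (xs @ [a, b, a] @ zs) \<in> W" for xs a b zs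
      using admissibleD(4)[OF assms, of "map uminus xs" "- a" "- b" "map uminus zs"] that by simp
  qed
qed

section \<open>Contents, transposed diagrams and partitions\<close>

lemma set_rowbox: "set (rowbox ls) = {(i, j). i < length ls \<and> j < ls ! i}"
  by (auto simp: rowbox_def)

lemma distinct_rowbox: "distinct (rowbox ls)"
proof (induction ls rule: rev_induct)
  case (snoc l ls)
  have "distinct (map (Pair (length ls)) [0..<l])" by (simp add: distinct_map inj_on_def)
  moreover have "set (rowbox ls) \<inter> set (map (Pair (length ls)) [0..<l]) = {}" by (auto simp: set_rowbox)
  ultimately show ?case using snoc by (simp only: rowbox_snoc distinct_append)
qed simp

lemma count_map_distinct:
  assumes "distinct xs" shows "count (mset (map f xs)) d = card {x\<in>set xs. f x = d}"
proof -
  have "count (mset (map f xs)) d = length (filter (\<lambda>x. f x = d) xs)"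
    by (induction xs) auto
  also have "\<dots> = card (set (filter (\<lambda>x. f x = d) xs))"
    using assms by (simp only: distinct_card distinct_filter)
  finally show ?thesis by simp
qed

text \<open>On each diagonal the boxes of a diagram form an initial segment, so their number determines them.\<close>
lemma diagram_subset:
  fixes D E :: "(nat \<times> nat) set"
  assumes "finite D" "\<And>i j i' j'. (i, j) \<in> D \<Longrightarrow> i' \<le> i \<Longrightarrow> j' \<le> j \<Longrightarrow> (i', j') \<in> D"
    "\<And>i j i' j'. (i, j) \<in> E \<Longrightarrow> i' \<le> i \<Longrightarrow> j' \<le> j \<Longrightarrow> (i', j') \<in> E"
    "\<And>d. card {x\<in>D. int (snd x) - int (fst x) = d} = card {x\<in>E. int (snd x) - int (fst x) = d}"
  shows "D \<subseteq> E"
proof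
  fix x assume x: "x \<in> D"
  obtain i j where ij: "x = (i, j)" by fastforce
  let ?d = "int j - int i"
  let ?D = "{x\<in>D. int (snd x) - int (fst x) = ?d}" and ?E = "{x\<in>E. int (snd x) - int (fst x) = ?d}"
  show "x \<in> E"
  proof (rule ccontr)
    assume n: "x \<notin> E"
    have "?E \<subseteq> ?D - {x}"
    proof
      fix y assume y: "y \<in> ?E"
      obtain i' j' where y': "y = (i', j')" by fastforce
      have d: "int j' - int i' = ?d" using y y' by simp
      have "\<not> i \<le> i'"
      proof
        assume "i \<le> i'"
        then have "(i, j) \<in> E" using assms(3)[of i' j' i j] y y' d by simp
        then show False using n ij by simp
      qed
      then have "(i', j') \<in> D" using assms(2)[of i j i' j'] x ij d by simp
      then show "y \<in> ?D - {x}" using y y' n by auto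
    qed
    then have "card ?E \<le> card (?D - {x})" using assms(1) by (intro card_mono) auto
    also have "\<dots> < card ?D" using x ij assms(1) by (intro card_Diff1_less) auto
    finally show False using assms(4)[of ?d] by simp
  qed
qed

definition pl :: "nat list \<Rightarrow> int \<Rightarrow> nat" where
  "pl ls = (\<lambda>i. if 1 \<le> i \<and> i \<le> int (length ls) then ls ! nat (i - 1) else 0)"

lemma cnt_brow: "cnt (brow ls) = pl ls"
proof (induction ls rule: rev_induct)
  case Nil
  have "cnt (brow []) = pl []" by (auto simp: cnt_def pl_def)
  then show ?case .
next
  case (snoc l ls)
  have "cnt (brow (ls @ [l])) i = pl (ls @ [l]) i" for i
  proof -
    have "cnt (brow (ls @ [l])) i = pl ls i + (if i = int (length ls) + 1 then l else 0)"
      using fun_cong[OF snoc, of i] by (simp add: cnt_def brow_snoc count_mset[symmetric])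
    then show ?thesis by (auto simp: pl_def nth_append)
  qed
  then have "cnt (brow (ls @ [l])) = pl (ls @ [l])" by blast
  then show ?case .
qed

lemma brow_upper: "x \<in> set (brow ls) \<Longrightarrow> x \<le> int (length ls)"
  by (auto simp: brow_def set_rowbox)

lemma sorted_brow: "sorted (brow ls)"
proof (induction ls rule: rev_induct)
  case (snoc l ls)
  then show ?case using brow_upper[of _ ls] by (fastforce simp: brow_snoc sorted_append)
qed simp

lemma cnt_Lam: "cnt w \<in> Lam (length w)"
proof -
  have "{i. cnt w i \<noteq> 0} = set w" by (auto simp: cnt_def count_list_0_iff)
  then show ?thesis unfolding Lam_def by (simp add: cnt_def sum_count_set)
qed

lemma pl_partition:
  assumes "valid ls" "length (brow ls) = r" shows "pl ls \<in> partitions r" "omega_lam r (pl ls) = brow ls"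
proof -
  have "pl ls j \<le> pl ls i" if "1 \<le> i" "i \<le> j" for i j
  proof (cases "j \<le> int (length ls) \<and> i < j")
    case True
    then have "ls ! nat (i - 1) \<ge> ls ! nat (j - 1)"
      using assms(1) that unfolding valid_def by (intro sorted_wrt_nth_less[of "(\<ge>)" ls]) auto
    then show ?thesis using True that by (simp add: pl_def)
  qed (use that in \<open>auto simp: pl_def\<close>)
  moreover have "pl ls \<in> Lam r" using cnt_Lam[of "brow ls"] assms cnt_brow by simp
  ultimately show "pl ls \<in> partitions r" by (auto simp: partitions_def) (simp add: pl_def)
  show "omega_lam r (pl ls) = brow ls" by (rule omega_lam_unique[OF sorted_brow assms(2) cnt_brow])
qed

lemma rowbox_step:
  "Suc p < length (rowbox ls) \<Longrightarrow> fst (rowbox ls ! p) = fst (rowbox ls ! Suc p) \<Longrightarrow>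
    snd (rowbox ls ! Suc p) = Suc (snd (rowbox ls ! p))"
proof (induction ls rule: rev_induct)
  case (snoc l ls)
  let ?n = "length (rowbox ls)"
  consider "Suc p < ?n" | "Suc p = ?n" | "?n \<le> p" by linarith
  then show ?case
  proof cases
    case 1
    then show ?thesis using snoc by (simp add: rowbox_snoc nth_append)
  next
    case 2
    then have "rowbox ls ! p \<in> set (rowbox ls)" by (intro nth_mem) simp
    then have "fst (rowbox ls ! p) < length ls" by (auto simp: set_rowbox)
    then show ?thesis using snoc.prems 2 by (simp add: rowbox_snoc nth_append)
  next
    case 3
    then show ?thesis using snoc.prems by (simp add: rowbox_snoc nth_append Suc_diff_le)
  qed
qed simp

text \<open>Equal neighbours in \<open>brow\<close> are neighbouring boxes of one row. With
  \<open>jmw_succ\<close> this makes a vector of weight \<open>crow ls\<close> an eigenvector of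
  every generator of the row stabiliser.\<close>

lemma crow_step:
  assumes "Suc p < length (brow ls)" "brow ls ! p = brow ls ! Suc p"
  shows "crow ls ! Suc p = crow ls ! p + 1"
proof -
  have l: "Suc p < length (rowbox ls)" using assms by (simp add: brow_def)
  have "fst (rowbox ls ! p) = fst (rowbox ls ! Suc p)"
    using assms l by (simp add: brow_def case_prod_unfold)
  from rowbox_step[OF l this] this show ?thesis using l by (simp add: crow_def case_prod_unfold)
qed

lemma transp_pl:
  assumes "valid ls" "valid ks" "\<And>i j. (i, j) \<in> set (rowbox ls) \<longleftrightarrow> (j, i) \<in> set (rowbox ks)"
  shows "transp (pl ls) = pl ks"
proof
  fix i
  show "transp (pl ls) i = pl ks i"
  proof (cases "1 \<le> i")
    case True
    define k where "k = nat (i - 1)"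
    have i: "i = int k + 1" using True by (simp add: k_def)
    have "{j. i \<le> int (pl ls j)} = (\<lambda>a. int a + 1) ` {a. (a, k) \<in> set (rowbox ls)}"
    proof (intro set_eqI iffI)
      fix j assume j: "j \<in> {j. i \<le> int (pl ls j)}"
      then have "1 \<le> j" "j \<le> int (length ls)" "k < ls ! nat (j - 1)"
        using i by (auto simp: pl_def split: if_splits)
      then show "j \<in> (\<lambda>a. int a + 1) ` {a. (a, k) \<in> set (rowbox ls)}"
        by (intro image_eqI[of _ _ "nat (j - 1)"]) (auto simp: set_rowbox)
    next
      fix j assume "j \<in> (\<lambda>a. int a + 1) ` {a. (a, k) \<in> set (rowbox ls)}"
      then show "j \<in> {j. i \<le> int (pl ls j)}" using i by (auto simp: set_rowbox pl_def)
    qed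
    also have "{a. (a, k) \<in> set (rowbox ls)} = {a. (k, a) \<in> set (rowbox ks)}" using assms(3) by auto
    also have "\<dots> = {..<if k < length ks then ks ! k else 0}" by (auto simp: set_rowbox)
    finally have "{j. i \<le> int (pl ls j)} = (\<lambda>a. int a + 1) ` {..<if k < length ks then ks ! k else 0}" .
    moreover have "card ((\<lambda>a. int a + 1) ` A) = card A" for A by (rule card_image) (auto intro: inj_onI)
    ultimately have "card {j. i \<le> int (pl ls j)} = (if k < length ks then ks ! k else 0)" by simp
    then show ?thesis using i by (auto simp: transp_def pl_def)
  qed (auto simp: transp_def pl_def)
qed

lemma rowbox_down:
  assumes "valid ls" "(i, j) \<in> set (rowbox ls)" "i' \<le> i" "j' \<le> j" shows "(i', j') \<in> set (rowbox ls)"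
proof -
  have "i < length ls" "j < ls ! i" using assms(2) by (auto simp: set_rowbox)
  moreover have "ls ! i \<le> ls ! i'"
    using assms(1,3) \<open>i < length ls\<close> sorted_wrt_nth_less[of "(\<ge>)" ls i' i] unfolding valid_def
    by (cases "i' = i") auto
  ultimately show ?thesis using assms(3,4) by (auto simp: set_rowbox)
qed

text \<open>Reflecting a diagram negates its contents, so both diagrams, one of them reflected, have
  equally many boxes on each diagonal; \<open>diagram_subset\<close> applies in both
  directions.\<close>

lemma transpose_diagrams:
  assumes "valid ls" "valid ks" "mset (crow ls) = mset (map uminus (crow ks))"
  shows "(i, j) \<in> set (rowbox ls) \<longleftrightarrow> (j, i) \<in> set (rowbox ks)"
proof -
  let ?D = "set (rowbox ls)" and ?E = "prod.swap ` set (rowbox ks)"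
  have c1: "count (mset (crow ls)) d = card {x\<in>?D. int (snd x) - int (fst x) = d}" for d
    unfolding crow_def count_map_distinct[OF distinct_rowbox] by (simp add: case_prod_unfold)
  have c2: "count (mset (map uminus (crow ks))) d = card {x\<in>?E. int (snd x) - int (fst x) = d}" for d
  proof -
    have "{x\<in>?E. int (snd x) - int (fst x) = d} = prod.swap ` {x\<in>set (rowbox ks). - (case x of (i, j) \<Rightarrow> int j - int i) = d}"
      by (auto simp: case_prod_unfold)
    then have "card {x\<in>?E. int (snd x) - int (fst x) = d} = card {x\<in>set (rowbox ks). - (case x of (i, j) \<Rightarrow> int j - int i) = d}"
      by (simp add: card_image)
    then show ?thesis unfolding crow_def map_map count_map_distinct[OF distinct_rowbox] by (simp add: comp_def)
  qed
  have dD: "(i', j') \<in> ?D" if "(i, j) \<in> ?D" "i' \<le> i" "j' \<le> j" for i j i' j'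
    using rowbox_down[OF assms(1) that] .
  have dE: "(i', j') \<in> ?E" if ij: "(i, j) \<in> ?E" "i' \<le> i" "j' \<le> j" for i j i' j'
  proof -
    have "(j, i) \<in> set (rowbox ks)" using ij(1) by auto
    from rowbox_down[OF assms(2) this ij(3,2)] show ?thesis by (intro image_eqI[of _ _ "(j', i')"]) auto
  qed
  have e: "card {x\<in>?D. int (snd x) - int (fst x) = d} = card {x\<in>?E. int (snd x) - int (fst x) = d}" for d
    using c1 c2 assms(3) by metis
  have "?D = ?E"
  proof (rule subset_antisym)
    show "?D \<subseteq> ?E" by (rule diagram_subset[OF _ dD dE e]) auto
    show "?E \<subseteq> ?D" by (rule diagram_subset[OF _ dE dD e[symmetric]]) auto
  qed
  then have "(i, j) \<in> set (rowbox ls) \<longleftrightarrow> (i, j) \<in> ?E" by simp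
  also have "\<dots> \<longleftrightarrow> (j, i) \<in> set (rowbox ks)" by force
  finally show ?thesis .
qed

lemma swp_append: "swp (length xs) (xs @ [a, b] @ zs) = xs @ [b, a] @ zs"
  by (simp add: swp_def nth_append list_update_append)

lemma admissible_wts:
  assumes N: "hsub r N" shows "admissible (wts r N)"
  unfolding admissible_def
proof (intro conjI allI impI)
  have V: "x \<in> N \<Longrightarrow> x \<in> Vsp r" for x using hsub_Vsp[OF N] .
  show "a = 0" if "a # zs \<in> wts r N" for a zs
    using that jmw_hd by (auto simp: wts_def jmw_def) (metis jmw_def jmw_hd length_Cons nth_Cons_0 zero_less_Suc)
  show "a \<noteq> b" if W: "xs @ [a, b] @ zs \<in> wts r N" for xs a b zs
  proof -
    obtain x where x: "x \<in> N" "jmw r (xs @ [a, b] @ zs) x" using W unfolding wts_def by blast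
    have "length (xs @ [a, b] @ zs) = r" using x(2) by (simp only: jmw_def)
    then show ?thesis using jmw_local(3)[OF x(2) V[OF x(1)], of "length xs"] by (simp add: nth_append)
  qed
  show "xs @ [b, a] @ zs \<in> wts r N" if W: "xs @ [a, b] @ zs \<in> wts r N" "2 \<le> \<bar>a - b\<bar>" for xs a b zs
  proof -
    obtain x where x: "x \<in> N" "jmw r (xs @ [a, b] @ zs) x" using W(1) unfolding wts_def by blast
    have "length (xs @ [a, b] @ zs) = r" using x(2) by (simp only: jmw_def)
    then show ?thesis using jmw_swap_mem[OF N x, of "length xs"] W(2)
      by (simp add: nth_append swp_append[simplified])
  qed
  show "\<bar>a - b\<bar> \<noteq> 1" if W: "xs @ [a, b, a] @ zs \<in> wts r N" for xs a b zs
  proof -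
    obtain x where x: "x \<in> N" "jmw r (xs @ [a, b, a] @ zs) x" using W(1) unfolding wts_def by blast
    have "length (xs @ [a, b, a] @ zs) = r" using x(2) by (simp only: jmw_def)
    then show ?thesis using jmw_no_braid[OF x(2) V[OF x(1)], of "length xs"] by (simp add: nth_append)
  qed
qed

text \<open>Both searches start from the same weight \<open>c0\<close>, one among the weights and
  one among their negatives. Therefore the contents of \<open>ks\<close> are the negatives of those
  of \<open>ls\<close>, so \<open>ks\<close> is the transposed shape, and one partition describes
  both vectors.\<close>

lemma row_and_column_vectors:
  assumes N: "hsub r N" "N \<noteq> {0}"
  obtains \<mu> x z where "\<mu> \<in> partitions r" "x \<in> N" "x \<noteq> 0" "z \<in> N" "z \<noteq> 0"
    "\<And>j. Suc j < r \<Longrightarrow> omega_lam r \<mu> ! j = omega_lam r \<mu> ! Suc j \<Longrightarrow> TT r j x = sm vv x"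
    "\<And>j. Suc j < r \<Longrightarrow> bw r \<mu> ! j = bw r \<mu> ! Suc j \<Longrightarrow> TT r j z = sm qm z"
proof -
  obtain y where "y \<in> N" "y \<noteq> 0" using N qvs.subspace_0[OF hsub_subspace[OF N(1)]] by blast
  then obtain c0 where c0: "c0 \<in> wts r N" using jmw_exists[OF N(1)] unfolding wts_def by blast
  obtain ls where ls: "valid ls" "crow ls \<in> wts r N" "mset (crow ls) = mset c0"
    using content_rows_exists[OF admissible_wts[OF N(1)] c0] .
  obtain ks where ks: "valid ks" "crow ks \<in> map uminus ` wts r N" "mset (crow ks) = mset (map uminus c0)"
    using content_rows_exists[OF admissible_uminus[OF admissible_wts[OF N(1)]] imageI[OF c0]] .
  obtain d where d: "d \<in> wts r N" "crow ks = map uminus d" using ks(2) by auto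
  obtain x where x: "x \<in> N" "jmw r (crow ls) x" using ls(2) by (auto simp: wts_def)
  obtain z where z: "z \<in> N" "jmw r d z" using d(1) by (auto simp: wts_def)
  have len: "length (brow ls) = r" "length (brow ks) = r"
    using x(2) z(2) arg_cong[OF d(2), of length] by (simp_all add: jmw_def crow_def brow_def)
  have "mset (crow ls) = mset (map uminus (crow ks))"
    using ls(3) ks(3) by (simp add: image_mset.compositionality comp_def)
  from transp_pl[OF ls(1) ks(1) transpose_diagrams[OF ls(1) ks(1) this]]
  have t: "transp (pl ls) = pl ks" .
  show ?thesis
  proof (rule that[of "pl ls" x z])
    show "pl ls \<in> partitions r" by (rule pl_partition(1)[OF ls(1) len(1)])
    show "x \<in> N" "x \<noteq> 0" "z \<in> N" "z \<noteq> 0" using x z by (auto simp: jmw_def)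
    have V: "x \<in> Vsp r" "z \<in> Vsp r" using hsub_Vsp[OF N(1)] x z by auto
    show "TT r j x = sm vv x" if "Suc j < r" "omega_lam r (pl ls) ! j = omega_lam r (pl ls) ! Suc j" for j
      using jmw_succ(1)[OF x(2) V(1) that(1)] crow_step[of j ls] that len pl_partition(2)[OF ls(1) len(1)] by simp
    show "TT r j z = sm qm z" if j: "Suc j < r" "bw r (pl ls) ! j = bw r (pl ls) ! Suc j" for j
    proof -
      have "crow ks ! Suc j = crow ks ! j + 1"
        using crow_step[of j ks] j len pl_partition(2)[OF ks(1) len(2)] t by simp
      moreover have "length d = r" using z(2) by (simp add: jmw_def)
      ultimately have "d ! Suc j = d ! j - 1" using d(2) j by simp
      then show ?thesis using jmw_succ(2)[OF z(2) V(2) j(1)] by simp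
    qed
  qed
qed

subsection \<open>Classification of the simple submodules of tensor space\<close>

text \<open>The adjoint of \<open>Phi r u\<close> for the form \<open>ip\<close>: a homomorphism
  into the regular summand instead of out of it. That it commutes with the generators follows from
  the same fact for \<open>Phi\<close> by definiteness.\<close>

definition Psi :: "nat \<Rightarrow> vec \<Rightarrow> vec \<Rightarrow> vec" where
  "Psi r u y = (if y \<in> Vsp r then \<Sum>\<sigma>\<in>perms r. sm (ip y (HT r \<sigma> u)) (ebas (wd r \<sigma>)) else 0)"

lemma Psi_Vsp: "Psi r u y \<in> Vsp r"
  by (auto simp: Psi_def ebas_Vsp intro!: Vsp_sum)

lemma Psi_adjoint:
  assumes "y \<in> Vsp r" "z \<in> Vsp r" shows "ip z (Psi r u y) = ip y (Phi r u z)"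
proof -
  have "ip z (ebas (wd r \<sigma>)) = z (wd r \<sigma>)" for \<sigma>
    using ip_commute[OF assms(2), of "ebas (wd r \<sigma>)"] by (simp add: ebas_Vsp)
  then show ?thesis using assms by (simp add: Psi_def Phi_def ip_sum_right ip_sm_right mult.commute)
qed

lemma Psi_Send:
  assumes u: "u \<in> Vsp r" shows "Psi r u \<in> Send r"
proof (rule SendI)
  note P = Phi_Send[OF u]
  show "Psi r u (TT r j y) = TT r j (Psi r u y)" if j: "Suc j < r" and y: "y \<in> Vsp r" for j y
  proof -
    let ?d = "Psi r u (TT r j y) - TT r j (Psi r u y)"
    have d: "?d \<in> Vsp r" using j by (intro Vsp_diff Psi_Vsp TT_Vsp)
    have "ip ?d (Psi r u (TT r j y)) = ip (TT r j y) (Phi r u ?d)"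
      using Psi_adjoint d TT_Vsp[OF y j] by blast
    also have "\<dots> = ip y (TT r j (Phi r u ?d))" using TT_selfadjoint[OF y _ j] P by blast
    also have "\<dots> = ip y (Phi r u (TT r j ?d))" using Send_TT[OF P j d] by simp
    also have "\<dots> = ip (TT r j ?d) (Psi r u y)" using Psi_adjoint[OF y TT_Vsp[OF d j]] by simp
    also have "\<dots> = ip ?d (TT r j (Psi r u y))" using TT_selfadjoint[OF d Psi_Vsp j] .
    finally have "ip ?d ?d = 0" unfolding ip_diff_right by (simp only: diff_self)
    then have "?d = 0" using ip_definite d by blast
    then show ?thesis by simp
  qed
qed (use assms in \<open>auto simp: Psi_def ebas_Vsp ip_add_left[of _ r] ip_sm_left[of _ r] sm_distribs sum.distrib sm_sum HT_Vsp
    intro!: Vsp_sum\<close>)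

section \<open>Weight spaces and the homomorphisms out of them\<close>

definition Om :: "nat \<Rightarrow> (int \<Rightarrow> nat) \<Rightarrow> vec set" where
  "Om r \<kappa> = {x\<in>Vsp r. kproj r \<kappa> x = x}"

lemma kproj_idem: "x \<in> Vsp r \<Longrightarrow> kproj r \<kappa> (kproj r \<kappa> x) = kproj r \<kappa> x"
  using Send_Vsp[OF Send_kproj, of x r \<kappa>] by (simp only: kproj_apply) (simp add: kproj_apply fun_eq_iff)

lemma Om_eq_image: "Om r \<kappa> = kproj r \<kappa> ` Vsp r"
  unfolding Om_def using kproj_idem Send_Vsp[OF Send_kproj] by (auto simp: image_iff) metis

lemma hsub_Om: "hsub r (Om r \<kappa>)"
  unfolding Om_eq_image by (rule hsub_Send_image[OF Send_kproj hsub_Vsp_UNIV])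

lemma fd_Om: "fd (Om r \<kappa>)"
proof -
  let ?B = "{w. cnt w = \<kappa>}"
  have fin: "finite ?B"
  proof (cases "?B = {}")
    case False
    then obtain w0 where w0: "cnt w0 = \<kappa>" by blast
    have "?B \<subseteq> {w. set w \<subseteq> set w0 \<and> length w = length w0}"
      unfolding w0[symmetric] cnt_mset using mset_eq_setD mset_eq_length by fastforce
    then show ?thesis by (rule finite_subset) (simp add: finite_lists_length_eq)
  qed simp
  have "Om r \<kappa> \<subseteq> qvs.span (ebas ` ?B)"
  proof
    fix x assume "x \<in> Om r \<kappa>"
    then have x: "x \<in> Vsp r" "kproj r \<kappa> x = x" by (auto simp: Om_def)
    have "x = (\<Sum>w\<in>?B. sm (x w) (ebas w))"
    proof (rule Vsp_expand[OF fin])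
      fix w assume "x w \<noteq> 0"
      then have "kproj r \<kappa> x w \<noteq> 0" unfolding x(2) .
      then show "w \<in> ?B" unfolding kproj_apply[OF x(1)] by (simp split: if_splits)
    qed
    also have "\<dots> \<in> qvs.span (ebas ` ?B)" by (intro qvs.span_sum qvs.span_scale qvs.span_base imageI)
    finally show "x \<in> qvs.span (ebas ` ?B)" .
  qed
  then show ?thesis unfolding fd_def using fin by blast
qed

lemma kproj_eq_pr: "kproj r \<kappa> = pr r (Om r \<kappa>)"
proof
  fix x show "kproj r \<kappa> x = pr r (Om r \<kappa>) x"
  proof (cases "x \<in> Vsp r")
    case True
    have "ip (x - kproj r \<kappa> x) y = 0" if "y \<in> Om r \<kappa>" for y
    proof -
      have y: "y \<in> Vsp r" "kproj r \<kappa> y = y" using that by (auto simp: Om_def)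
      have "(x - kproj r \<kappa> x) w * y w = 0" for w
        using fun_cong[OF y(2), of w] True y(1) by (auto simp: kproj_apply split: if_splits)
      then show ?thesis unfolding ip_def by (intro sum.neutral) blast
    qed
    then show ?thesis using True by (intro pr_unique[OF hsub_Om, symmetric]) (auto simp: Om_eq_image)
  qed (simp add: pr_def kproj_def)
qed

text \<open>A form of Frobenius reciprocity that needs no presentation of the weight space: the map
  goes through the regular summand, as \<open>Psi\<close> followed by \<open>Phi\<close>. The
  coefficient of \<open>HT r \<sigma> (ebas u)\<close> at \<open>u\<close> is
  \<open>vv ^ len r \<sigma>\<close> on the Young subgroup and zero outside, so
  \<open>ebas u\<close> goes to a positive multiple of \<open>x\<close>.\<close>

lemma symmetric_vector_hom:
  assumes u: "sorted u" "length u = r" and N: "hsub r N" and x: "x \<in> N" "x \<noteq> 0"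
    and sym: "\<And>j. Suc j < r \<Longrightarrow> u ! j = u ! Suc j \<Longrightarrow> TT r j x = sm vv x"
  obtains F where "F \<in> Send r" "\<And>y. F y \<in> N" "F (ebas u) \<noteq> 0"
proof -
  have V: "x \<in> Vsp r" "ebas u \<in> Vsp r" using hsub_Vsp[OF N x(1)] u by (auto simp: ebas_Vsp)
  note P = Phi_Send[OF V(1)] and Q = Psi_Send[OF V(2)]
  let ?F = "Phi r x \<circ> Psi r (ebas u)"
  have "?F y \<in> N" for y using Phi_range_subset[OF N x(1)] Psi_Vsp by auto
  moreover have "?F (ebas u) \<noteq> 0"
  proof -
    have c: "HT r \<sigma> (ebas u) u = (if \<sigma> \<in> yg r u then vv ^ len r \<sigma> else 0)" if s: "\<sigma> \<in> perms r" for \<sigma>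
    proof (cases "\<sigma> \<in> yg r u")
      case True
      have "HT r \<sigma> (ebas u) = sm (vv ^ len r \<sigma>) (ebas u)"
        by (rule HT_young[OF u True]) (use u TT_ebas_eq in auto)
      then show ?thesis using True by (simp add: sm_apply ebas_apply)
    next
      case False
      then have "permute_list \<sigma> u \<noteq> u" using s yg_permute_list[OF u(2)] by blast
      moreover obtain k where "HT r \<sigma> (ebas u) = sm (vv ^ k) (ebas (permute_list \<sigma> u))"
        using HT_ebas_sorted[OF u s] by blast
      ultimately show ?thesis using False by (simp add: sm_apply ebas_apply)
    qed
    have Pe: "Phi r x (ebas (wd r \<sigma>)) = HT r \<sigma> x" if s: "\<sigma> \<in> perms r" for \<sigma>
      using Send_HT[OF P, of "ebas (omega_varpi r)" \<sigma>] Phi_omega[OF V(1)] HT_omega[OF s] s by (simp add: ebas_Vsp)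
    have "?F (ebas u) = (\<Sum>\<sigma>\<in>perms r. sm (HT r \<sigma> (ebas u) u) (HT r \<sigma> x))"
      using V by (simp add: Psi_def Send_sum[OF P] Send_sm[OF P] ebas_Vsp Pe)
    also have "\<dots> = (\<Sum>\<sigma>\<in>yg r u. sm (vv ^ len r \<sigma>) (HT r \<sigma> x))"
      by (rule sum.mono_neutral_cong_right) (auto simp: c c[OF yg_perms] dest: yg_perms)
    also have "\<dots> = sm (\<Sum>\<sigma>\<in>yg r u. vv ^ len r \<sigma> * vv ^ len r \<sigma>) x"
      using Sym_eigen[OF u sym] unfolding Sym_def by blast
    finally show ?thesis using Sym_const_pos[OF vv_nz, of r u] x(2) by (simp only: sm_eq_0_iff) simp
  qed
  ultimately show ?thesis using that[of ?F] Send_comp[OF P Q] by blast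
qed

text \<open>The column vector \<open>z\<close> has a preimage \<open>y\<close> in the weight space
  of \<open>\<mu>\<close>. The antisymmetriser turns \<open>y\<close> into a multiple of
  \<open>umu r \<mu>\<close> and \<open>z\<close> into a nonzero multiple of itself, so
  \<open>F\<close> cannot kill \<open>umu r \<mu>\<close>; between simple modules it is then
  bijective.\<close>

lemma hsimple_classification:
  assumes N: "hsimple r N"
  obtains \<mu> F where "\<mu> \<in> partitions r" "F \<in> Send r" "F ` Pm r \<mu> = N" "inj_on F (Pm r \<mu>)"
proof -
  note H = hsimple_hsub[OF N]
  obtain \<mu> x z where \<mu>: "\<mu> \<in> partitions r" and xz: "x \<in> N" "x \<noteq> 0" "z \<in> N" "z \<noteq> 0"
    and row: "\<And>j. Suc j < r \<Longrightarrow> omega_lam r \<mu> ! j = omega_lam r \<mu> ! Suc j \<Longrightarrow> TT r j x = sm vv x"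
    and col: "\<And>j. Suc j < r \<Longrightarrow> bw r \<mu> ! j = bw r \<mu> ! Suc j \<Longrightarrow> TT r j z = sm qm z"
    using row_and_column_vectors[OF H hsimple_nontrivial[OF N]] by blast
  note u = omega_lam_props[OF partitions_Lam[OF \<mu>]]
  obtain F where F: "F \<in> Send r" "\<And>y. F y \<in> N" "F (ebas (omega_lam r \<mu>)) \<noteq> 0"
    using symmetric_vector_hom[OF u(1,2) H xz(1,2) row] by blast
  have e: "ebas (omega_lam r \<mu>) \<in> Om r \<mu>"
    using u by (auto simp: Om_def ebas_Vsp kproj_apply fun_eq_iff ebas_apply)
  have "F ` Om r \<mu> = N"
    using hsimple_sub[OF N _ hsub_Send_image[OF F(1) hsub_Om]] F(2,3) e by blast
  then obtain y where y: "y \<in> Om r \<mu>" "z = F y" using xz(3) by blast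
  have yV: "y \<in> Vsp r" "kproj r \<mu> y = y" using y by (auto simp: Om_def)
  let ?S = "Sym r qm (bw r \<mu>)"
  obtain d where d: "?S y = sm d (?S (ebas (tc r (bw r \<mu>))))" using Sym_weight_space_line[OF \<mu> yV] .
  obtain k where k: "k \<noteq> 0" "umu r \<mu> = sm k (?S (ebas (tc r (bw r \<mu>))))" using umu_eq[OF \<mu>] .
  have "?S y = sm (d / k) (umu r \<mu>)" using d k by simp
  then have "?S z = sm (d / k) (F (umu r \<mu>))"
    using Send_Sym[OF F(1) yV(1)] Send_sm[OF F(1) umu_Vsp[OF \<mu>]] y(2) by metis
  moreover have "?S z = sm (\<Sum>\<sigma>\<in>yg r (bw r \<mu>). qm ^ len r \<sigma> * qm ^ len r \<sigma>) z"
    by (rule Sym_eigen[OF bw_props(1,2)[OF \<mu>] col])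
  then have "?S z \<noteq> 0"
    using Sym_const_pos[OF qm_neq(2), of r "bw r \<mu>"] xz(4) by (simp only: sm_eq_0_iff) simp
  ultimately have Fu: "F (umu r \<mu>) \<noteq> 0" using sm_simps(3) by metis
  note I = hsimple_Send_image[OF F(1) hsimple_Pm[OF \<mu>] umu_Pm[OF \<mu>] Fu]
  have "F ` Pm r \<mu> \<subseteq> N" using F(2) by blast
  then have "F ` Pm r \<mu> = N"
    using hsimple_sub[OF N _ hsimple_hsub[OF I(2)]] hsimple_nontrivial[OF I(2)] by blast
  then show ?thesis using that \<mu> F(1) I(1) by blast
qed

section \<open>Splitting projections into projections onto simple submodules\<close>

lemma dim_psubset:
  assumes "fd N" "N' \<subseteq> N" "qvs.subspace N'" "N' \<noteq> N"
  shows "qvs.dim N' < qvs.dim N"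
proof -
  obtain B' where B': "B' \<subseteq> N'" "qvs.independent B'" "N' \<subseteq> qvs.span B'" "card B' = qvs.dim N'"
    using qvs.basis_exists .
  obtain B where B: "B' \<subseteq> B" "B \<subseteq> N" "qvs.independent B" "N \<subseteq> qvs.span B"
    using qvs.maximal_independent_subset_extend[of B' N] B' assms(2) by (metis subset_trans)
  obtain G where G: "finite G" "N \<subseteq> qvs.span G" using assms(1) by (auto simp: fd_def)
  have fin: "finite B" using qvs.independent_span_bound[OF G(1) B(3)] B(2) G(2) by blast
  have "B \<noteq> B'"
  proof
    assume "B = B'"
    then have "N \<subseteq> N'" using B(4) qvs.span_minimal[OF B'(1) assms(3)] by blast
    then show False using assms(2,4) by blast
  qed
  then have "card B' < card B" using B(1) fin by (intro psubset_card_mono) auto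
  then show ?thesis using B'(4) qvs.basis_card_eq_dim[OF B(2,4,3)] by simp
qed

lemma pr_decompose:
  assumes N: "hsub r N" "fd N" and N': "hsub r N'" "N' \<subseteq> N"
  defines "C \<equiv> {x\<in>N. \<forall>y\<in>N'. ip x y = 0}"
  shows "pr r N = pr r N' + pr r C"
proof
  fix x
  note fd' = fd_subset[OF N(2) N'(2)]
  have C: "hsub r C" unfolding C_def by (rule hsub_orth[OF N(1) N'(1)])
  show "pr r N x = (pr r N' + pr r C) x"
  proof (cases "x \<in> Vsp r")
    case True
    define p where "p = pr r N x"
    define p' where "p' = pr r N' p"
    have p: "p \<in> N" "\<And>y. y \<in> N \<Longrightarrow> ip (x - p) y = 0" using pr_mem[OF N True] pr_orth[OF N True] by (auto simp: p_def)
    have pV: "p \<in> Vsp r" using hsub_Vsp[OF N(1) p(1)] .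
    have p': "p' \<in> N'" "\<And>y. y \<in> N' \<Longrightarrow> ip (p - p') y = 0"
      using pr_mem[OF N'(1) fd' pV] pr_orth[OF N'(1) fd' pV] by (auto simp: p'_def)
    have p'V: "p' \<in> Vsp r" using hsub_Vsp[OF N'(1) p'(1)] .
    have "pr r N' x = p'"
    proof (rule pr_unique[OF N'(1) True p'(1)], rule ballI)
      fix y assume y: "y \<in> N'"
      have "ip (x - p') y = ip (x - p) y + ip (p - p') y"
        using ip_add_left[of "x - p" r "p - p'" y] True pV p'V hsub_Vsp[OF N'(1) y] by simp
      then show "ip (x - p') y = 0" using p(2)[of y] p'(2)[OF y] y N'(2) by auto
    qed
    moreover have "pr r C x = p - p'"
    proof (rule pr_unique[OF C True])
      show "p - p' \<in> C" unfolding C_def using p' p N'(2) qvs.subspace_diff[OF hsub_subspace[OF N(1)]] by blast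
      show "\<forall>y\<in>C. ip (x - (p - p')) y = 0"
      proof
        fix y assume y: "y \<in> C"
        have yV: "y \<in> Vsp r" and yN: "y \<in> N" using hsub_Vsp[OF C y] y by (auto simp: C_def)
        have "ip (x - (p - p')) y = ip (x - p) y + ip p' y"
          using ip_add_left[of "x - p" r p' y] True pV p'V yV by (simp add: algebra_simps)
        moreover have "ip p' y = 0" using y p'(1) ip_commute[OF p'V yV] by (simp add: C_def)
        ultimately show "ip (x - (p - p')) y = 0" using p(2)[OF yN] by simp
      qed
    qed
    ultimately show ?thesis by (simp add: p_def)
  qed (simp add: pr_def)
qed

text \<open>The decomposition is recorded as an identity of projections rather than as a direct sum
  of subspaces, because an abstract module sees only elements of the Schur algebra.\<close>

lemma pr_sum_of_simples:
  assumes "hsub r N" "fd N"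
  shows "\<exists>Ps. (\<forall>P\<in>set Ps. hsimple r P \<and> fd P) \<and> pr r N = sum_list (map (pr r) Ps)"
  using assms
proof (induction "qvs.dim N" arbitrary: N rule: less_induct)
  case less
  show ?case
  proof (cases "N = {0}")
    case True
    have "pr r N x = 0" for x
      using pr_mem[OF less.prems, of x] True by (cases "x \<in> Vsp r") (auto simp: pr_def)
    then have "pr r N = sum_list (map (pr r) [])" by auto
    then show ?thesis by (intro exI[of _ "[]"]) simp
  next
    case False
    show ?thesis
    proof (cases "hsimple r N")
      case True
      then show ?thesis using less.prems by (intro exI[of _ "[N]"]) simp
    next
      case nonsimple: False
      then obtain N' where N': "N' \<subseteq> N" "hsub r N'" "N' \<noteq> {0}" "N' \<noteq> N"
        using less.prems(1) False unfolding hsimple_def by blast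
      let ?C = "{x\<in>N. \<forall>y\<in>N'. ip x y = 0}"
      have C: "hsub r ?C" by (rule hsub_orth[OF less.prems(1) N'(2)])
      have "?C \<noteq> N"
      proof
        assume "?C = N"
        then have "ip y y = 0" if "y \<in> N'" for y using that N'(1) by blast
        then have "y = 0" if "y \<in> N'" for y using that ip_definite hsub_Vsp[OF N'(2)] by blast
        then show False using N'(3) qvs.subspace_0[OF hsub_subspace[OF N'(2)]] by blast
      qed
      then have "qvs.dim ?C < qvs.dim N" "qvs.dim N' < qvs.dim N"
        using dim_psubset[OF less.prems(2) _ hsub_subspace[OF C]] dim_psubset[OF less.prems(2) N'(1) hsub_subspace[OF N'(2)] N'(4)]
        by auto
      moreover have "fd ?C" "fd N'" using fd_subset[OF less.prems(2)] N'(1) by auto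
      ultimately obtain Ps Qs where
        "\<forall>P\<in>set Ps. hsimple r P \<and> fd P" "pr r N' = sum_list (map (pr r) Ps)"
        "\<forall>P\<in>set Qs. hsimple r P \<and> fd P" "pr r ?C = sum_list (map (pr r) Qs)"
        using less.hyps[OF _ C] less.hyps[OF _ N'(2)] by blast
      then show ?thesis using pr_decompose[OF less.prems N'(2,1)] by (intro exI[of _ "Ps @ Qs"]) auto
    qed
  qed
qed

subsection \<open>Modules over the Schur algebra\<close>

lemma smodD:
  assumes "smod r M a"
  shows smod_0: "0 \<in> M" and smod_plus: "x \<in> M \<Longrightarrow> y \<in> M \<Longrightarrow> x + y \<in> M"
    and smod_uminus: "x \<in> M \<Longrightarrow> - x \<in> M" and smod_act: "\<phi> \<in> Send r \<Longrightarrow> x \<in> M \<Longrightarrow> a \<phi> x \<in> M"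
    and act_add: "\<phi> \<in> Send r \<Longrightarrow> x \<in> M \<Longrightarrow> y \<in> M \<Longrightarrow> a \<phi> (x + y) = a \<phi> x + a \<phi> y"
    and add_act: "\<phi> \<in> Send r \<Longrightarrow> \<psi> \<in> Send r \<Longrightarrow> x \<in> M \<Longrightarrow> a (\<phi> + \<psi>) x = a \<phi> x + a \<psi> x"
    and comp_act: "\<phi> \<in> Send r \<Longrightarrow> \<psi> \<in> Send r \<Longrightarrow> x \<in> M \<Longrightarrow> a (\<phi> \<circ> \<psi>) x = a \<phi> (a \<psi> x)"
    and one_act: "x \<in> M \<Longrightarrow> a (oneS r) x = x"
  using assms by (auto simp: smod_def)

lemma smod_submodule:
  assumes M: "smod r M a" and "N \<subseteq> M" "0 \<in> N" "\<And>x y. x \<in> N \<Longrightarrow> y \<in> N \<Longrightarrow> x + y \<in> N"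
    "\<And>x. x \<in> N \<Longrightarrow> - x \<in> N" "\<And>\<phi> x. \<phi> \<in> Send r \<Longrightarrow> x \<in> N \<Longrightarrow> a \<phi> x \<in> N"
  shows "smod r N a"
  using assms(2-) smodD[OF M] unfolding smod_def subset_eq by simp

lemma act_0: "smod r M a \<Longrightarrow> \<phi> \<in> Send r \<Longrightarrow> a \<phi> 0 = 0"
  using act_add[of r M a \<phi> 0 0] smod_0[of r M a] by simp

lemma zero_act: "smod r M a \<Longrightarrow> x \<in> M \<Longrightarrow> a 0 x = 0"
  using add_act[of r M a 0 0 x] by simp

text \<open>A module carries no scalar multiplication of its own, so negation is expressed through
  elements of the Schur algebra.\<close>

abbreviation negS :: "(vec \<Rightarrow> vec) \<Rightarrow> vec \<Rightarrow> vec" where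
  "negS \<phi> \<equiv> (\<lambda>x. sm (-1) (\<phi> x))"

lemma plus_negS: "\<phi> + negS \<phi> = 0" "(\<phi> + negS \<psi>) y = \<phi> y - \<psi> y"
  by (auto simp: fun_eq_iff sm_apply)

lemma negS_act:
  assumes "smod r M a" "\<phi> \<in> Send r" "x \<in> M" shows "a (negS \<phi>) x = - a \<phi> x"
proof -
  have "a \<phi> x + a (negS \<phi>) x = 0"
    unfolding add_act[OF assms(1,2) Send_scale[OF assms(2)] assms(3), symmetric] plus_negS
    by (rule zero_act[OF assms(1,3)])
  then show ?thesis by (metis minus_unique)
qed

lemma smod_sum:
  assumes "smod r M a" "\<And>i. i \<in> A \<Longrightarrow> g i \<in> M" shows "(\<Sum>i\<in>A. g i) \<in> M"
  using assms(2) by (induction A rule: infinite_finite_induct) (auto intro: smod_0[OF assms(1)] smod_plus[OF assms(1)])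

lemma act_sum:
  assumes "smod r M a" "\<phi> \<in> Send r" "\<And>i. i \<in> A \<Longrightarrow> g i \<in> M"
  shows "a \<phi> (\<Sum>i\<in>A. g i) = (\<Sum>i\<in>A. a \<phi> (g i))"
  using assms(3)
proof (induction A rule: infinite_finite_induct)
  case (insert i A)
  then show ?case using act_add[OF assms(1,2), of "g i" "sum g A"] smod_sum[OF assms(1), of A g] by simp
qed (auto simp: act_0[OF assms(1,2)])

lemma sum_list_act:
  assumes "smod r M a" "x \<in> M" "\<And>f. f \<in> set fs \<Longrightarrow> f \<in> Send r"
  shows "sum_list fs \<in> Send r \<and> a (sum_list fs) x = sum_list (map (\<lambda>f. a f x) fs)"
  using assms(3)
proof (induction fs)
  case Nil
  have "0 \<in> Send r \<and> a 0 x = 0" using zero_act[OF assms(1,2)] by blast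
  then show ?case unfolding list.map sum_list.Nil .
next
  case (Cons f fs)
  have f: "f \<in> Send r" using Cons.prems by simp
  have fs: "sum_list fs \<in> Send r \<and> a (sum_list fs) x = sum_list (map (\<lambda>f. a f x) fs)"
    using Cons.IH Cons.prems by simp
  have "f + sum_list fs \<in> Send r" "a (f + sum_list fs) x = a f x + sum_list (map (\<lambda>f. a f x) fs)"
    using Send_plus[OF f] add_act[OF assms(1) f _ assms(2)] fs by auto
  then show ?case unfolding list.map sum_list.Cons by (rule conjI)
qed

definition cyc :: "nat \<Rightarrow> ((vec \<Rightarrow> vec) \<Rightarrow> 'm \<Rightarrow> 'm) \<Rightarrow> 'm \<Rightarrow> 'm set" where
  "cyc r a y = (\<lambda>\<phi>. a \<phi> y) ` Send r"

lemma cyc_subset: "smod r M a \<Longrightarrow> y \<in> M \<Longrightarrow> cyc r a y \<subseteq> M"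
  by (auto simp: cyc_def smod_act)

lemma cyc_self: "smod r M a \<Longrightarrow> y \<in> M \<Longrightarrow> y \<in> cyc r a y"
  unfolding cyc_def by (rule image_eqI[of _ _ "oneS r"]) (auto simp: one_act)

lemma smod_cyc:
  assumes M: "smod r M a" and y: "y \<in> M" shows "smod r (cyc r a y) a"
proof (rule smod_submodule[OF M cyc_subset[OF M y]])
  show "0 \<in> cyc r a y" unfolding cyc_def by (rule image_eqI[of _ "\<lambda>\<phi>. a \<phi> y" 0]) (simp_all add: zero_act[OF M y])
  show "x + x' \<in> cyc r a y" if "x \<in> cyc r a y" "x' \<in> cyc r a y" for x x'
    using that add_act[OF M _ _ y, symmetric] Send_plus by (auto simp: cyc_def)
  show "- x \<in> cyc r a y" if x: "x \<in> cyc r a y" for x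
  proof -
    obtain \<phi> where "\<phi> \<in> Send r" "x = a \<phi> y" using x by (auto simp: cyc_def)
    then have "negS \<phi> \<in> Send r" "- x = a (negS \<phi>) y" using negS_act[OF M _ y] Send_scale by (metis, metis)
    then show ?thesis unfolding cyc_def by blast
  qed
  show "a \<phi> x \<in> cyc r a y" if "\<phi> \<in> Send r" "x \<in> cyc r a y" for \<phi> x
    using that comp_act[OF M _ _ y, symmetric] Send_comp by (auto simp: cyc_def)
qed

lemma irreducible_cyc:
  assumes M: "irreducible_mod r M a" and y: "y \<in> M" "y \<noteq> 0" shows "cyc r a y = M"
proof -
  have S: "smod r M a" using M by (simp add: irreducible_mod_def)
  have "cyc r a y \<noteq> {0}" using cyc_self[OF S y(1)] y(2) by blast
  then show ?thesis using M smod_cyc[OF S y(1)] cyc_subset[OF S y(1)] by (auto simp: irreducible_mod_def)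
qed

text \<open>A nonzero vector of the form \<open>pr r P x\<close> with \<open>P\<close> simple can be recovered from each
  of its nonzero images, because a homomorphism that is nonzero on \<open>P\<close> has a left inverse there.\<close>
lemma act_pr_zero_iff:
  assumes M: "smod r M a" and P: "hsimple r P" "fd P" and x: "x \<in> M" "a (pr r P) x \<noteq> 0" and \<phi>: "\<phi> \<in> Send r"
  shows "a \<phi> (a (pr r P) x) = 0 \<longleftrightarrow> (\<forall>p\<in>P. \<phi> p = 0)"
    and "a \<phi> (a (pr r P) x) \<noteq> 0 \<Longrightarrow> \<exists>\<psi>\<in>Send r. a \<psi> (a \<phi> (a (pr r P) x)) = a (pr r P) x"
proof -
  note H = hsimple_hsub[OF P(1)]
  note pS = pr_Send[OF H P(2)]
  have z: "a \<phi> (a (pr r P) x) = 0" if "\<forall>p\<in>P. \<phi> p = 0"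
  proof -
    have "(\<phi> \<circ> pr r P) t = 0" for t
      using that pr_mem[OF H P(2), of t] Send_0[OF \<phi>] by (cases "t \<in> Vsp r") (auto simp: pr_def)
    then have "\<phi> \<circ> pr r P = 0" by (intro ext) simp
    then show ?thesis using comp_act[OF M \<phi> pS x(1)] zero_act[OF M x(1)] by simp
  qed
  have inv: "\<exists>\<psi>\<in>Send r. a \<psi> (a \<phi> (a (pr r P) x)) = a (pr r P) x" if p: "p \<in> P" "\<phi> p \<noteq> 0" for p
  proof -
    obtain \<psi> where \<psi>: "\<psi> \<in> Send r" "\<forall>y\<in>P. \<psi> (\<phi> y) = y"
      using hsimple_left_inverse[OF \<phi> P p] by blast
    have "\<psi> \<circ> (\<phi> \<circ> pr r P) = pr r P"
    proof
      fix t show "(\<psi> \<circ> (\<phi> \<circ> pr r P)) t = pr r P t"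
        using \<psi>(2) pr_mem[OF H P(2), of t] Send_0[OF \<phi>] Send_0[OF \<psi>(1)] by (cases "t \<in> Vsp r") (auto simp: pr_def)
    qed
    then have "a \<psi> (a \<phi> (a (pr r P) x)) = a (pr r P) x"
      using comp_act[OF M \<psi>(1) Send_comp[OF \<phi> pS] x(1)] comp_act[OF M \<phi> pS x(1)] by simp
    then show ?thesis using \<psi>(1) by blast
  qed
  show "a \<phi> (a (pr r P) x) = 0 \<longleftrightarrow> (\<forall>p\<in>P. \<phi> p = 0)"
    using z inv x(2) act_0[OF M] by metis
  show "a \<phi> (a (pr r P) x) \<noteq> 0 \<Longrightarrow> \<exists>\<psi>\<in>Send r. a \<psi> (a \<phi> (a (pr r P) x)) = a (pr r P) x"
    using z inv by blast
qed

lemma irreducible_pr: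
  assumes M: "smod r M a" and P: "hsimple r P" "fd P" and x: "x \<in> M" "a (pr r P) x \<noteq> 0"
  shows "irreducible_mod r (cyc r a (a (pr r P) x)) a"
  unfolding irreducible_mod_def
proof (intro conjI allI impI)
  let ?y = "a (pr r P) x"
  have y: "?y \<in> M" using smod_act[OF M pr_Send[OF hsimple_hsub[OF P(1)] P(2)] x(1)] .
  show "smod r (cyc r a ?y) a" by (rule smod_cyc[OF M y])
  show "cyc r a ?y \<noteq> {0}" using cyc_self[OF M y] x(2) by blast
  fix N assume N: "N \<subseteq> cyc r a ?y \<and> smod r N a"
  show "N = {0} \<or> N = cyc r a ?y"
  proof (cases "N = {0}")
    case False
    then obtain n where n: "n \<in> N" "n \<noteq> 0" using smod_0[OF conjunct2[OF N]] by blast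
    then obtain \<phi> where \<phi>: "\<phi> \<in> Send r" "n = a \<phi> ?y" using N by (auto simp: cyc_def)
    then obtain \<psi> where "\<psi> \<in> Send r" "a \<psi> n = ?y" using act_pr_zero_iff(2)[OF M P x \<phi>(1)] n by blast
    then have "?y \<in> N" using smod_act[OF conjunct2[OF N]] n by metis
    then have "cyc r a ?y \<subseteq> N" using cyc_subset[OF conjunct2[OF N]] by blast
    then show ?thesis using N by blast
  qed simp
qed

text \<open>Each cyclic module is the quotient of the Schur algebra by the annihilator of its
  generator, and the annihilators agree. By \<open>eq\<close> the choice of a representative in
  \<open>f\<close> does not matter.\<close>

lemma iso_cyc:
  fixes a :: "(vec \<Rightarrow> vec) \<Rightarrow> 'm::ab_group_add \<Rightarrow> 'm" and b :: "(vec \<Rightarrow> vec) \<Rightarrow> 'n::ab_group_add \<Rightarrow> 'n"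
  assumes M: "smod r M a" "y \<in> M" and N: "smod r N b" "z \<in> N"
    and iff: "\<And>\<phi>. \<phi> \<in> Send r \<Longrightarrow> a \<phi> y = 0 \<longleftrightarrow> b \<phi> z = 0"
  shows "iso_mod r (cyc r a y) a (cyc r b z) b"
proof -
  have eq: "a \<phi> y = a \<psi> y \<longleftrightarrow> b \<phi> z = b \<psi> z" if s: "\<phi> \<in> Send r" "\<psi> \<in> Send r" for \<phi> \<psi>
  proof -
    have d: "\<phi> + negS \<psi> \<in> Send r" using s Send_scale by blast
    have "a (\<phi> + negS \<psi>) y = a \<phi> y - a \<psi> y" "b (\<phi> + negS \<psi>) z = b \<phi> z - b \<psi> z"
      by (simp_all only: add_act[OF M(1) s(1) Send_scale[OF s(2)] M(2)] negS_act[OF M(1) s(2) M(2)]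
        add_act[OF N(1) s(1) Send_scale[OF s(2)] N(2)] negS_act[OF N(1) s(2) N(2)] add_uminus_conv_diff)
    then show ?thesis using iff[OF d] by simp
  qed
  define f where "f m = b (SOME \<phi>. \<phi> \<in> Send r \<and> m = a \<phi> y) z" for m
  have f: "f (a \<phi> y) = b \<phi> z" if "\<phi> \<in> Send r" for \<phi>
  proof -
    define \<psi> where "\<psi> = (SOME \<psi>. \<psi> \<in> Send r \<and> a \<phi> y = a \<psi> y)"
    have "\<phi> \<in> Send r \<and> a \<phi> y = a \<phi> y" using that by simp
    then have "\<psi> \<in> Send r \<and> a \<phi> y = a \<psi> y"
      unfolding \<psi>_def by (rule someI[where P = "\<lambda>\<psi>. \<psi> \<in> Send r \<and> a \<phi> y = a \<psi> y"])
    then have "b \<phi> z = b \<psi> z" using eq[OF that] by blast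
    then show ?thesis by (simp only: f_def \<psi>_def)
  qed
  show ?thesis unfolding iso_mod_def
  proof (intro exI[of _ f] conjI ballI)
    show "bij_betw f (cyc r a y) (cyc r b z)"
      unfolding bij_betw_def
    proof
      show "inj_on f (cyc r a y)"
      proof (rule inj_onI)
        fix m m' assume "m \<in> cyc r a y" "m' \<in> cyc r a y" "f m = f m'"
        then obtain \<phi> \<psi> where "\<phi> \<in> Send r" "\<psi> \<in> Send r" "m = a \<phi> y" "m' = a \<psi> y" by (auto simp: cyc_def)
        then show "m = m'" using \<open>f m = f m'\<close> f eq by simp
      qed
      show "f ` cyc r a y = cyc r b z" unfolding cyc_def image_image by (rule image_cong) (auto simp: f)
    qed
    show "f (m + m') = f m + f m'" if mm: "m \<in> cyc r a y" "m' \<in> cyc r a y" for m m'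
    proof -
      obtain \<phi> \<psi> where s: "\<phi> \<in> Send r" "\<psi> \<in> Send r" "m = a \<phi> y" "m' = a \<psi> y" using mm by (auto simp: cyc_def)
      have "m + m' = a (\<phi> + \<psi>) y" using add_act[OF M(1) s(1,2) M(2)] s by simp
      then show ?thesis using f[OF Send_plus[OF s(1,2)]] add_act[OF N(1) s(1,2) N(2)] f s by simp
    qed
    show "f (a \<phi> m) = b \<phi> (f m)" if \<phi>m: "\<phi> \<in> Send r" "m \<in> cyc r a y" for \<phi> m
    proof -
      obtain \<psi> where s: "\<psi> \<in> Send r" "m = a \<psi> y" using \<phi>m by (auto simp: cyc_def)
      have "a \<phi> m = a (\<phi> \<circ> \<psi>) y" using comp_act[OF M(1) \<phi>m(1) s(1) M(2)] s by simp
      then show ?thesis using f[OF Send_comp[OF \<phi>m(1) s(1)]] comp_act[OF N(1) \<phi>m(1) s(1) N(2)] f s by simp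
    qed
  qed
qed

lemma iso_mod_sym:
  assumes M: "smod r M a" and "iso_mod r M a N b" shows "iso_mod r N b M a"
proof -
  obtain f where f: "bij_betw f M N" "\<And>x y. x \<in> M \<Longrightarrow> y \<in> M \<Longrightarrow> f (x + y) = f x + f y"
    "\<And>\<phi> x. \<phi> \<in> Send r \<Longrightarrow> x \<in> M \<Longrightarrow> f (a \<phi> x) = b \<phi> (f x)"
    using assms(2) unfolding iso_mod_def by blast
  let ?g = "inv_into M f"
  have inj: "inj_on f M" and im: "f ` M = N" using f(1) by (auto simp: bij_betw_def)
  have g: "?g x \<in> M" "f (?g x) = x" if "x \<in> N" for x
    using that im by (auto intro: inv_into_into f_inv_into_f)
  have gf: "?g (f x) = x" if "x \<in> M" for x using inv_into_f_f[OF inj that] .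
  show ?thesis unfolding iso_mod_def
  proof (intro exI[of _ ?g] conjI ballI)
    show "bij_betw ?g N M" by (rule bij_betw_inv_into[OF f(1)])
    show "?g (x + y) = ?g x + ?g y" if "x \<in> N" "y \<in> N" for x y
      using gf[OF smod_plus[OF M g(1) g(1)]] f(2)[OF g(1) g(1)] g(2) that by metis
    show "?g (b \<phi> x) = a \<phi> (?g x)" if "\<phi> \<in> Send r" "x \<in> N" for \<phi> x
      using gf[OF smod_act[OF M that(1) g(1)]] f(3)[OF that(1) g(1)] g(2) that by metis
  qed
qed

subsection \<open>Complete reducibility\<close>

text \<open>\<open>Sp\<close> and \<open>indep\<close> are the spanning and the independence clause
  of \<open>compl_red\<close>, separated so that Zorn's lemma can be applied to independent
  families.\<close>

definition Sp :: "'m::ab_group_add set set \<Rightarrow> 'm set" where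
  "Sp \<N> = {x. \<exists>F g. finite F \<and> F \<subseteq> \<N> \<and> (\<forall>N\<in>F. g N \<in> N) \<and> x = (\<Sum>N\<in>F. g N)}"

definition indep :: "'m::ab_group_add set set \<Rightarrow> bool" where
  "indep \<N> \<longleftrightarrow> (\<forall>F g. finite F \<and> F \<subseteq> \<N> \<and> (\<forall>N\<in>F. g N \<in> N) \<and> (\<Sum>N\<in>F. g N) = 0 \<longrightarrow> (\<forall>N\<in>F. g N = 0))"

lemma SpI: "finite F \<Longrightarrow> F \<subseteq> \<N> \<Longrightarrow> \<forall>N\<in>F. g N \<in> N \<Longrightarrow> (\<Sum>N\<in>F. g N) \<in> Sp \<N>"
  unfolding Sp_def by (rule CollectI, intro exI conjI) (assumption | rule refl)+

lemma SpE:
  assumes "x \<in> Sp \<N>"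
  obtains F g where "finite F" "F \<subseteq> \<N>" "\<forall>N\<in>F. g N \<in> N" "x = (\<Sum>N\<in>F. g N)"
  using assms unfolding Sp_def by (elim CollectE exE conjE)

lemma smod_Sp:
  assumes M: "smod r M a" and \<N>: "\<And>N. N \<in> \<N> \<Longrightarrow> N \<subseteq> M \<and> smod r N a"
  shows "smod r (Sp \<N>) a" "Sp \<N> \<subseteq> M"
proof -
  show sub: "Sp \<N> \<subseteq> M"
  proof
    fix x assume "x \<in> Sp \<N>"
    then obtain F g where F: "finite F" "F \<subseteq> \<N>" "\<forall>N\<in>F. g N \<in> N" "x = (\<Sum>N\<in>F. g N)" by (rule SpE)
    then show "x \<in> M" using \<N> by (auto intro!: smod_sum[OF M])
  qed
  show "smod r (Sp \<N>) a"
  proof (rule smod_submodule[OF M sub])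
    show "0 \<in> Sp \<N>" using SpI[of "{}" \<N>] by simp
    show "x + y \<in> Sp \<N>" if xy: "x \<in> Sp \<N>" "y \<in> Sp \<N>" for x y
    proof -
      obtain F g where F: "finite F" "F \<subseteq> \<N>" "\<forall>N\<in>F. g N \<in> N" "x = (\<Sum>N\<in>F. g N)" using SpE[OF xy(1)] .
      obtain E h where E: "finite E" "E \<subseteq> \<N>" "\<forall>N\<in>E. h N \<in> N" "y = (\<Sum>N\<in>E. h N)" using SpE[OF xy(2)] .
      let ?k = "\<lambda>N. (if N \<in> F then g N else 0) + (if N \<in> E then h N else 0)"
      have "x = (\<Sum>N\<in>F \<union> E. if N \<in> F then g N else 0)" "y = (\<Sum>N\<in>F \<union> E. if N \<in> E then h N else 0)"
        unfolding F(4) E(4) by (rule sum.mono_neutral_cong_left; use F E in auto)+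
      then have "x + y = (\<Sum>N\<in>F \<union> E. ?k N)" by (simp add: sum.distrib)
      moreover have "\<forall>N\<in>F \<union> E. ?k N \<in> N"
      proof
        fix N assume "N \<in> F \<union> E"
        then have S: "smod r N a" using F(2) E(2) \<N> by blast
        have "(if N \<in> F then g N else 0) \<in> N" "(if N \<in> E then h N else 0) \<in> N"
          using F(3) E(3) smod_0[OF S] by auto
        then show "?k N \<in> N" by (rule smod_plus[OF S])
      qed
      ultimately show ?thesis using SpI[of "F \<union> E" \<N> ?k] F(1,2) E(1,2) by simp
    qed
    show "- x \<in> Sp \<N>" if x: "x \<in> Sp \<N>" for x
    proof -
      obtain F g where F: "finite F" "F \<subseteq> \<N>" "\<forall>N\<in>F. g N \<in> N" "x = (\<Sum>N\<in>F. g N)" using SpE[OF x] .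
      have "- x = (\<Sum>N\<in>F. - g N)" using F by (simp add: sum_negf)
      moreover have "\<forall>N\<in>F. - g N \<in> N"
      proof
        fix N assume N: "N \<in> F"
        then have S: "smod r N a" using F(2) \<N> by blast
        show "- g N \<in> N" using smod_uminus[OF S] F(3) N by blast
      qed
      ultimately show ?thesis using SpI[OF F(1,2), of "\<lambda>N. - g N"] by simp
    qed
    show "a \<phi> x \<in> Sp \<N>" if \<phi>x: "\<phi> \<in> Send r" "x \<in> Sp \<N>" for \<phi> x
    proof -
      obtain F g where F: "finite F" "F \<subseteq> \<N>" "\<forall>N\<in>F. g N \<in> N" "x = (\<Sum>N\<in>F. g N)" using SpE[OF \<phi>x(2)] .
      have "a \<phi> x = (\<Sum>N\<in>F. a \<phi> (g N))" unfolding F(4) by (rule act_sum[OF M \<phi>x(1)]) (use F \<N> in auto)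
      moreover have "\<forall>N\<in>F. a \<phi> (g N) \<in> N"
      proof
        fix N assume N: "N \<in> F"
        then have S: "smod r N a" using F(2) \<N> by blast
        show "a \<phi> (g N) \<in> N" using smod_act[OF S \<phi>x(1)] F(3) N by blast
      qed
      ultimately show ?thesis using SpI[OF F(1,2), of "\<lambda>N. a \<phi> (g N)"] by simp
    qed
  qed
qed

lemma Sp_member: "N \<in> \<N> \<Longrightarrow> N \<subseteq> Sp \<N>"
proof
  fix x assume "N \<in> \<N>" "x \<in> N"
  then show "x \<in> Sp \<N>" using SpI[of "{N}" \<N> "\<lambda>_. x"] by simp
qed

lemma indep_insert:
  assumes ind: "indep \<N>" and M: "smod r (Sp \<N>) a" and N0: "N0 \<inter> Sp \<N> = {0}"
  shows "indep (insert N0 \<N>)"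
  unfolding indep_def
proof (intro allI impI)
  fix F g assume A: "finite F \<and> F \<subseteq> insert N0 \<N> \<and> (\<forall>N\<in>F. g N \<in> N) \<and> (\<Sum>N\<in>F. g N) = 0"
  let ?F = "F - {N0}"
  have F': "finite ?F" "?F \<subseteq> \<N>" "\<forall>N\<in>?F. g N \<in> N" using A by auto
  have s: "(\<Sum>N\<in>?F. g N) \<in> Sp \<N>" by (rule SpI[OF F'])
  have z: "(\<Sum>N\<in>?F. g N) = 0 \<and> (N0 \<in> F \<longrightarrow> g N0 = 0)"
  proof (cases "N0 \<in> F")
    case True
    have e: "g N0 + (\<Sum>N\<in>?F. g N) = 0" using A True sum.remove[of F N0 g] by simp
    then have "g N0 = - (\<Sum>N\<in>?F. g N)" by (simp add: eq_neg_iff_add_eq_0)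
    then have "g N0 \<in> Sp \<N>" using smod_uminus[OF M s] by simp
    moreover have "g N0 \<in> N0" using A True by blast
    ultimately have "g N0 \<in> N0 \<inter> Sp \<N>" by blast
    then show ?thesis using e N0 by simp
  qed (use A in simp)
  then have "finite ?F \<and> ?F \<subseteq> \<N> \<and> (\<forall>N\<in>?F. g N \<in> N) \<and> (\<Sum>N\<in>?F. g N) = 0" using F' by simp
  from ind[unfolded indep_def, THEN spec, THEN spec, THEN mp, OF this] have "\<forall>N\<in>?F. g N = 0" .
  then show "\<forall>N\<in>F. g N = 0" using z by blast
qed

text \<open>Unions of chains stay independent because a relation involves finitely many members. For
  a maximal independent family, an irreducible submodule meets the span in 0 or lies in it, and in
  the first case the family could be enlarged.\<close>

lemma completely_reducible:
  assumes M: "smod r M a" and gen: "\<And>x. x \<in> M \<Longrightarrow> x \<in> Sp {N. N \<subseteq> M \<and> irreducible_mod r N a}"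
  shows "compl_red r M a"
proof -
  define I where "I = {N. N \<subseteq> M \<and> irreducible_mod r N a}"
  define A where "A = {\<N>. \<N> \<subseteq> I \<and> indep \<N>}"
  have A_iff: "\<N> \<in> A \<longleftrightarrow> \<N> \<subseteq> I \<and> indep \<N>" for \<N> by (simp add: A_def)
  have irrI: "irreducible_mod r N a" if "N \<in> I" for N using that by (simp add: I_def)
  have chain: "\<Union>\<C> \<in> A" if C: "subset.chain A \<C>" for \<C>
  proof -
    have "indep (\<Union>\<C>)" unfolding indep_def
    proof (intro allI impI)
      fix F g assume as: "finite F \<and> F \<subseteq> \<Union>\<C> \<and> (\<forall>N\<in>F. g N \<in> N) \<and> (\<Sum>N\<in>F. g N) = 0"
      show "\<forall>N\<in>F. g N = 0"
      proof (cases "\<C> = {}")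
        case False
        obtain \<N> where "\<N> \<in> \<C>" "F \<subseteq> \<N>"
          using finite_subset_Union_chain[of F \<C> A] as False C by blast
        moreover have "indep \<N>" using C \<open>\<N> \<in> \<C>\<close> A_iff unfolding subset_chain_def by blast
        ultimately show ?thesis using as unfolding indep_def by blast
      qed (use as in simp)
    qed
    moreover have "\<Union>\<C> \<subseteq> I" using C A_iff unfolding subset_chain_def by blast
    ultimately show ?thesis by (simp add: A_iff)
  qed
  have "\<exists>\<N>\<in>A. \<forall>\<N>'\<in>A. \<N> \<subseteq> \<N>' \<longrightarrow> \<N>' = \<N>" by (rule subset_Zorn'[OF chain])
  then obtain \<N> where \<N>: "\<N> \<in> A" and max: "\<And>\<N>'. \<N>' \<in> A \<Longrightarrow> \<N> \<subseteq> \<N>' \<Longrightarrow> \<N>' = \<N>"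
    by blast
  have sm: "N \<subseteq> M \<and> smod r N a" if "N \<in> I" for N using that by (simp add: I_def irreducible_mod_def)
  have S: "smod r (Sp \<N>) a" by (rule smod_Sp(1)[OF M]) (use \<N> sm A_iff in blast)
  have "N0 \<subseteq> Sp \<N>" if N0: "N0 \<in> I" for N0
  proof -
    note S0 = conjunct2[OF sm[OF N0]]
    have "smod r (N0 \<inter> Sp \<N>) a"
      by (rule smod_submodule[OF S0]) (use smodD[OF S0] smodD[OF S] in auto)
    then have "N0 \<inter> Sp \<N> = {0} \<or> N0 \<inter> Sp \<N> = N0" using irrI[OF N0] unfolding irreducible_mod_def by blast
    then show ?thesis
    proof
      assume z: "N0 \<inter> Sp \<N> = {0}"
      have "insert N0 \<N> \<in> A" using indep_insert[OF _ S z] \<N> N0 by (simp add: A_iff)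
      then have "N0 \<in> \<N>" using max[of "insert N0 \<N>"] by blast
      then show ?thesis by (rule Sp_member)
    qed blast
  qed
  moreover have "x \<in> Sp \<N>" if x: "x \<in> Sp I" and "\<And>N. N \<in> I \<Longrightarrow> N \<subseteq> Sp \<N>" for x
  proof -
    obtain F g where F: "finite F" "F \<subseteq> I" "\<forall>N\<in>F. g N \<in> N" "x = (\<Sum>N\<in>F. g N)" using SpE[OF x] .
    then show ?thesis using that(2) by (auto intro!: smod_sum[OF S])
  qed
  ultimately have "M \<subseteq> Sp \<N>" using gen[folded I_def] by blast
  then have "\<forall>x\<in>M. \<exists>F g. finite F \<and> F \<subseteq> \<N> \<and> (\<forall>N\<in>F. g N \<in> N) \<and> x = (\<Sum>N\<in>F. g N)"
    unfolding Sp_def by (simp only: subset_eq mem_Collect_eq)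
  moreover have "\<forall>N\<in>\<N>. N \<subseteq> M \<and> irreducible_mod r N a" using \<N> by (auto simp: A_iff I_def)
  moreover have "indep \<N>" using \<N> by (simp add: A_iff)
  ultimately show ?thesis unfolding compl_red_def indep_def by (intro exI[of _ \<N>] conjI)
qed

section \<open>Weight modules as sums of irreducible submodules\<close>

lemma weight_component_simples:
  assumes M: "smod r M a" and m: "m \<in> M"
  shows "\<exists>Ps. (\<forall>P\<in>set Ps. hsimple r P \<and> fd P) \<and> a (kproj r \<kappa>) m = sum_list (map (\<lambda>P. a (pr r P) m) Ps)"
proof -
  obtain Ps where Ps: "\<forall>P\<in>set Ps. hsimple r P \<and> fd P" "pr r (Om r \<kappa>) = sum_list (map (pr r) Ps)"
    using pr_sum_of_simples[OF hsub_Om fd_Om] by blast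
  have "\<And>f. f \<in> set (map (pr r) Ps) \<Longrightarrow> f \<in> Send r" using Ps pr_Send hsimple_hsub by auto
  from sum_list_act[of r M a m "map (pr r) Ps", OF M m this]
  have "a (kproj r \<kappa>) m = sum_list (map (\<lambda>P. a (pr r P) m) Ps)"
    unfolding kproj_eq_pr Ps(2) map_map comp_def by (rule conjunct2)
  with Ps(1) show ?thesis by blast
qed

lemma weight_modE:
  assumes "weight_mod r M a" "x \<in> M"
  obtains F f where "finite F" "\<forall>\<kappa>\<in>F. f \<kappa> \<in> a (kproj r \<kappa>) ` M" "x = (\<Sum>\<kappa>\<in>F. f \<kappa>)"
proof -
  from bspec[OF conjunct1[OF assms(1)[unfolded weight_mod_def]] assms(2)] that show ?thesis
    by (elim exE conjE)
qed

lemma weight_module_sum_of_simples: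
  assumes M: "smod r M a" and W: "weight_mod r M a" and x: "x \<in> M"
  shows "x \<in> Sp {N. N \<subseteq> M \<and> irreducible_mod r N a}"
proof -
  let ?I = "{N. N \<subseteq> M \<and> irreducible_mod r N a}"
  have S: "smod r (Sp ?I) a" by (rule smod_Sp(1)[OF M]) (auto simp: irreducible_mod_def)
  have sl: "sum_list ys \<in> Sp ?I" if "set ys \<subseteq> Sp ?I" for ys
    using that by (induction ys) (auto intro: smod_0[OF S] smod_plus[OF S])
  have w: "a (kproj r \<kappa>) m \<in> Sp ?I" if m: "m \<in> M" for m \<kappa>
  proof -
    obtain Ps where Ps: "\<forall>P\<in>set Ps. hsimple r P \<and> fd P" "a (kproj r \<kappa>) m = sum_list (map (\<lambda>P. a (pr r P) m) Ps)"
      using weight_component_simples[OF M m] by blast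
    have "a (pr r P) m \<in> Sp ?I" if P: "P \<in> set Ps" for P
    proof (cases "a (pr r P) m = 0")
      case True
      then show ?thesis using smod_0[OF S] by simp
    next
      case False
      have P': "hsimple r P" "fd P" using Ps P by auto
      have y: "a (pr r P) m \<in> M" using smod_act[OF M pr_Send[OF hsimple_hsub[OF P'(1)] P'(2)] m] .
      have "cyc r a (a (pr r P) m) \<in> ?I"
        using irreducible_pr[OF M P' m False] cyc_subset[OF M y] by blast
      from subsetD[OF Sp_member[OF this] cyc_self[OF M y]] show ?thesis .
    qed
    then show ?thesis unfolding Ps(2) by (intro sl) auto
  qed
  obtain F f where "finite F" "\<forall>\<kappa>\<in>F. f \<kappa> \<in> a (kproj r \<kappa>) ` M" "x = (\<Sum>\<kappa>\<in>F. f \<kappa>)"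
    using weight_modE[OF W x] .
  then show ?thesis using w by (auto intro!: smod_sum[OF S])
qed

subsection \<open>Weyl modules\<close>

lemma smod_Send: "smod r (Send r) (\<circ>)"
  unfolding smod_def
proof (intro conjI ballI)
  show "- \<phi> \<in> Send r" if "\<phi> \<in> Send r" for \<phi>
  proof -
    have "- \<phi> = negS \<phi>" by (auto simp: fun_eq_iff sm_apply)
    then show ?thesis using Send_scale[OF that, of "-1"] by (simp only:)
  qed
  show "\<phi> \<circ> (x + y) = (\<phi> \<circ> x) + (\<phi> \<circ> y)" if "\<phi> \<in> Send r" "x \<in> Send r" "y \<in> Send r" for \<phi> x y
    using Send_add[OF that(1) Send_Vsp'[OF that(2)] Send_Vsp'[OF that(3)]] by (simp add: fun_eq_iff)
  show "oneS r \<circ> x = x" if "x \<in> Send r" for x using Send_Vsp'[OF that] by (auto simp: oneS_def)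
qed (auto simp: comp_assoc intro: ext)

lemma zmu_Send: "\<mu> \<in> partitions r \<Longrightarrow> zmu r \<mu> \<in> Send r"
  by (simp add: zmu_eq_Phi umu_Vsp Phi_Send)

lemma zmu_image: "\<mu> \<in> partitions r \<Longrightarrow> zmu r \<mu> ` Vsp r = Pm r \<mu>"
  by (simp add: zmu_eq_Phi umu_Vsp Pm_def)

lemma zmu_mem: assumes "\<mu> \<in> partitions r" shows "zmu r \<mu> t \<in> Pm r \<mu>"
  using zmu_image[OF assms] Send_out[OF zmu_Send[OF assms], of t]
    qvs.subspace_0[OF hsub_subspace[OF hsub_Pm[OF assms]]] by (cases "t \<in> Vsp r") auto

text \<open>This gives \<open>zmu r \<mu>\<close> the shape \<open>a (pr r P) x\<close> in the
  regular module, so that \<open>irreducible_pr\<close> covers the Weyl modules too.\<close>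

lemma pr_zmu: "\<mu> \<in> partitions r \<Longrightarrow> pr r (Pm r \<mu>) \<circ> zmu r \<mu> = zmu r \<mu>"
  using pr_id[OF hsub_Pm zmu_mem] by (auto simp: fun_eq_iff)

lemma comp_zmu_zero:
  assumes "\<mu> \<in> partitions r" shows "\<phi> \<circ> zmu r \<mu> = 0 \<longleftrightarrow> (\<forall>p\<in>Pm r \<mu>. \<phi> p = 0)"
proof
  assume z: "\<phi> \<circ> zmu r \<mu> = 0"
  show "\<forall>p\<in>Pm r \<mu>. \<phi> p = 0"
  proof
    fix p assume "p \<in> Pm r \<mu>"
    then obtain t where "p = zmu r \<mu> t" using zmu_image[OF assms] by auto
    then show "\<phi> p = 0" using fun_cong[OF z, of t] by simp
  qed
qed (use zmu_mem[OF assms] in auto)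

lemma zmu_neq_0:
  assumes "\<mu> \<in> partitions r" shows "zmu r \<mu> \<noteq> 0"
proof
  assume "zmu r \<mu> = 0"
  then have "id \<circ> zmu r \<mu> = 0" by simp
  then show False using comp_zmu_zero[OF assms, of id] umu_Pm[OF assms] umu_neq_0[OF assms] by auto
qed

lemma Wmod_cyc: "Wmod r \<mu> = cyc r (\<circ>) (zmu r \<mu>)"
  by (auto simp: Wmod_def cyc_def)

lemma irreducible_Wmod:
  assumes "\<mu> \<in> partitions r" shows "irreducible_mod r (Wmod r \<mu>) (\<circ>)"
  using irreducible_pr[OF smod_Send hsimple_Pm[OF assms] fd_Pm[OF assms] zmu_Send[OF assms]]
  unfolding pr_zmu[OF assms] Wmod_cyc using zmu_neq_0[OF assms] by blast

lemma smod_Wmod: "\<mu> \<in> partitions r \<Longrightarrow> smod r (Wmod r \<mu>) (\<circ>)"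
  using irreducible_Wmod by (simp add: irreducible_mod_def)

lemma Wmod_Send: "\<mu> \<in> partitions r \<Longrightarrow> Wmod r \<mu> \<subseteq> Send r"
  unfolding Wmod_cyc by (rule cyc_subset[OF smod_Send zmu_Send])

lemma weight_Wmod:
  assumes \<mu>: "\<mu> \<in> partitions r" shows "weight_mod r (Wmod r \<mu>) (\<circ>)"
  unfolding weight_mod_def
proof (intro conjI ballI allI impI)
  fix f assume f: "f \<in> Wmod r \<mu>"
  then obtain \<phi> where \<phi>: "\<phi> \<in> Send r" "f = \<phi> \<circ> zmu r \<mu>" by (auto simp: Wmod_def)
  note u = umu_Vsp[OF \<mu>] and fS = subsetD[OF Wmod_Send[OF \<mu>] f]
  \<comment> \<open>The map \<open>f\<close> factors through the finite-dimensional
    \<open>Pm r \<mu>\<close>: its values are combinations of the finitely many vectors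
    \<open>\<phi> (HT r \<sigma> (umu r \<mu>))\<close>, so only finitely many weights
    occur.\<close>
  let ?B = "\<Union>\<sigma>\<in>perms r. {w. \<phi> (HT r \<sigma> (umu r \<mu>)) w \<noteq> 0}"
  have fin: "finite ?B" using Vsp_finite[OF Send_Vsp'[OF \<phi>(1)]] by simp
  have fx: "f x = (\<Sum>\<sigma>\<in>perms r. sm (x (wd r \<sigma>)) (\<phi> (HT r \<sigma> (umu r \<mu>))))" if "x \<in> Vsp r" for x
    using that u by (simp add: \<phi>(2) zmu_eq_Phi Phi_def Send_sum[OF \<phi>(1)] Send_sm[OF \<phi>(1)] HT_Vsp)
  have out: "f x w = 0" if "w \<notin> ?B" for x w
  proof (cases "x \<in> Vsp r")
    case True
    have "\<phi> (HT r \<sigma> (umu r \<mu>)) w = 0" if "\<sigma> \<in> perms r" for \<sigma> using \<open>w \<notin> ?B\<close> that by blast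
    then show ?thesis unfolding fx[OF True] sum_fun_apply by (simp add: sm_apply)
  qed (simp add: Send_out[OF fS])
  let ?F = "cnt ` ?B"
  have "f = (\<Sum>\<kappa>\<in>?F. kproj r \<kappa> \<circ> f)"
  proof (intro ext)
    fix x w
    have V: "f x \<in> Vsp r" using Send_Vsp'[OF fS] .
    have "(\<Sum>\<kappa>\<in>?F. kproj r \<kappa> \<circ> f) x w = (\<Sum>\<kappa>\<in>?F. if cnt w = \<kappa> then f x w else 0)"
      unfolding sum_fun_apply2 sum_fun_apply by (simp add: kproj_apply[OF V])
    also have "\<dots> = (if cnt w \<in> ?F then f x w else 0)" using fin by (simp add: sum.delta)
    also have "\<dots> = f x w" using out[of w x] by auto
    finally show "f x w = (\<Sum>\<kappa>\<in>?F. kproj r \<kappa> \<circ> f) x w" by simp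
  qed
  moreover have "?F \<subseteq> Lam r"
  proof
    fix \<kappa> assume "\<kappa> \<in> ?F"
    then obtain \<sigma> w where w: "\<phi> (HT r \<sigma> (umu r \<mu>)) w \<noteq> 0" "\<kappa> = cnt w" by blast
    have "length w = r" using Vsp_length[OF Send_Vsp'[OF \<phi>(1)] w(1)] .
    then show "\<kappa> \<in> Lam r" using cnt_Lam[of w] w(2) by simp
  qed
  ultimately show "\<exists>F g. finite F \<and> F \<subseteq> Lam r \<and> (\<forall>\<kappa>\<in>F. g \<kappa> \<in> (\<circ>) (kproj r \<kappa>) ` Wmod r \<mu>) \<and> f = (\<Sum>\<kappa>\<in>F. g \<kappa>)"
    using fin f by (intro exI[of _ ?F] exI[of _ "\<lambda>\<kappa>. kproj r \<kappa> \<circ> f"]) blast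
next
  fix F f \<kappa>
  assume A: "finite F \<and> F \<subseteq> Lam r \<and> (\<forall>\<kappa>\<in>F. f \<kappa> \<in> (\<circ>) (kproj r \<kappa>) ` Wmod r \<mu>) \<and> (\<Sum>\<kappa>\<in>F. f \<kappa>) = 0"
    and \<kappa>: "\<kappa> \<in> F"
  have z: "f \<kappa>' x w = 0" if k: "\<kappa>' \<in> F" "cnt w \<noteq> \<kappa>'" for \<kappa>' x w
  proof -
    obtain g where g: "g \<in> Wmod r \<mu>" "f \<kappa>' = kproj r \<kappa>' \<circ> g" using A k by blast
    have "g x \<in> Vsp r" using Send_Vsp' Wmod_Send[OF \<mu>] g(1) by blast
    then show ?thesis using g(2) k(2) by (simp add: kproj_apply)
  qed
  show "f \<kappa> = 0"
  proof (intro ext)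
    fix x w
    show "f \<kappa> x w = (0 :: vec \<Rightarrow> vec) x w"
    proof (cases "cnt w = \<kappa>")
      case True
      have "(\<Sum>\<kappa>'\<in>F. f \<kappa>') x w = 0" using A by simp
      then have "(\<Sum>\<kappa>'\<in>F. f \<kappa>' x w) = 0" unfolding sum_fun_apply2 sum_fun_apply .
      moreover have "(\<Sum>\<kappa>'\<in>F. f \<kappa>' x w) = (\<Sum>\<kappa>'\<in>{\<kappa>}. f \<kappa>' x w)"
      proof (rule sum.mono_neutral_right)
        show "\<forall>\<kappa>'\<in>F - {\<kappa>}. f \<kappa>' x w = 0"
        proof
          fix \<kappa>' assume "\<kappa>' \<in> F - {\<kappa>}"
          then show "f \<kappa>' x w = 0" using True by (intro z) auto
        qed
      qed (use A \<kappa> in auto)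
      ultimately show ?thesis by simp
    qed (use z \<kappa> in simp)
  qed
qed

text \<open>The isomorphism sends \<open>zmu r \<mu>\<close> to some
  \<open>\<psi> \<circ> zmu r \<nu>\<close>. The complementary projection \<open>?q\<close>
  annihilates the former, hence the latter, so \<open>\<psi>\<close> maps \<open>Pm r \<nu>\<close>
  into \<open>Pm r \<mu>\<close>, and not to zero.\<close>

lemma iso_Wmod_dominance:
  assumes \<mu>: "\<mu> \<in> partitions r" and \<nu>: "\<nu> \<in> partitions r" and iso: "iso_mod r (Wmod r \<mu>) (\<circ>) (Wmod r \<nu>) (\<circ>)"
  shows "low (omega_lam r \<mu>) k \<le> low (omega_lam r \<nu>) k"
proof -
  obtain f where f: "bij_betw f (Wmod r \<mu>) (Wmod r \<nu>)"
    "\<And>x y. x \<in> Wmod r \<mu> \<Longrightarrow> y \<in> Wmod r \<mu> \<Longrightarrow> f (x + y) = f x + f y"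
    "\<And>\<phi> x. \<phi> \<in> Send r \<Longrightarrow> x \<in> Wmod r \<mu> \<Longrightarrow> f (\<phi> \<circ> x) = \<phi> \<circ> f x"
    using iso unfolding iso_mod_def by blast
  let ?z = "zmu r \<mu>"
  have zW: "?z \<in> Wmod r \<mu>" unfolding Wmod_cyc by (rule cyc_self[OF smod_Send zmu_Send[OF \<mu>]])
  note W0 = smod_0[OF smod_Wmod[OF \<mu>]]
  have f0: "f 0 = 0" using f(2)[OF W0 W0] by simp
  have "f ?z \<in> Wmod r \<nu>" using f(1) zW by (auto simp: bij_betw_def)
  then obtain \<psi> where \<psi>: "\<psi> \<in> Send r" "f ?z = \<psi> \<circ> zmu r \<nu>" by (auto simp: Wmod_def)
  have "f ?z \<noteq> 0" using f(1) zW W0 f0 zmu_neq_0[OF \<mu>] by (metis bij_betw_def inj_onD)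
  then obtain p where p: "p \<in> Pm r \<nu>" "\<psi> p \<noteq> 0" using comp_zmu_zero[OF \<nu>] \<psi>(2) by metis
  let ?q = "oneS r + negS (pr r (Pm r \<mu>))"
  note prS = pr_Send[OF hsub_Pm[OF \<mu>] fd_Pm[OF \<mu>]]
  have q: "?q \<in> Send r" using Send_scale[OF prS] by blast
  have qx: "?q x = x - pr r (Pm r \<mu>) x" if "x \<in> Vsp r" for x
    unfolding plus_negS(2) using that by (simp add: oneS_def)
  have "?q \<circ> ?z = 0"
    unfolding comp_zmu_zero[OF \<mu>] using qx hsub_Vsp[OF hsub_Pm[OF \<mu>]] pr_id[OF hsub_Pm[OF \<mu>]] by simp
  then have "?q \<circ> (\<psi> \<circ> zmu r \<nu>) = 0" using f(3)[OF q zW] f0 \<psi>(2) by simp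
  then have "(?q \<circ> \<psi>) \<circ> zmu r \<nu> = 0" by (simp only: comp_assoc)
  then have q0: "?q (\<psi> x) = 0" if "x \<in> Pm r \<nu>" for x using comp_zmu_zero[OF \<nu>] that by (metis comp_apply)
  have "\<psi> x \<in> Pm r \<mu>" if "x \<in> Pm r \<nu>" for x
  proof -
    have V: "\<psi> x \<in> Vsp r" using \<psi>(1) by blast
    then have "\<psi> x = pr r (Pm r \<mu>) (\<psi> x)" using q0[OF that] unfolding qx[OF V] by simp
    then show ?thesis using pr_mem[OF hsub_Pm[OF \<mu>] fd_Pm[OF \<mu>] V] by simp
  qed
  then show ?thesis by (intro Pm_hom_dominance[OF \<mu> \<nu> \<psi>(1) _ p]) blast
qed

text \<open>Some projection onto a simple \<open>P\<close> acts nontrivially on the module. If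
  \<open>G\<close> identifies \<open>Pm r \<mu>\<close> with \<open>P\<close>, then
  \<open>?y\<close> and \<open>?z\<close> have the same annihilator, namely the endomorphisms that
  vanish on \<open>P\<close>; each of them generates its irreducible module.\<close>

lemma irreducible_weight_module:
  assumes M: "smod r M a" and W: "weight_mod r M a" and irr: "irreducible_mod r M a"
  shows "\<exists>\<mu>\<in>partitions r. iso_mod r M a (Wmod r \<mu>) (\<circ>)"
proof -
  obtain x where x: "x \<in> M" "x \<noteq> 0" using irr smod_0[OF M] unfolding irreducible_mod_def by blast
  obtain F f where F: "finite F" "\<forall>\<kappa>\<in>F. f \<kappa> \<in> a (kproj r \<kappa>) ` M" "x = (\<Sum>\<kappa>\<in>F. f \<kappa>)"
    using weight_modE[OF W x(1)] .
  then obtain \<kappa> where "\<kappa> \<in> F" "f \<kappa> \<noteq> 0" using x(2) by (metis sum.neutral)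
  then obtain m where m: "m \<in> M" "a (kproj r \<kappa>) m \<noteq> 0" using F(2) by auto
  obtain Ps where Ps: "\<forall>P\<in>set Ps. hsimple r P \<and> fd P" "a (kproj r \<kappa>) m = sum_list (map (\<lambda>P. a (pr r P) m) Ps)"
    using weight_component_simples[OF M m(1)] by blast
  have "\<exists>P\<in>set Ps. a (pr r P) m \<noteq> 0"
  proof (rule ccontr)
    assume "\<not> ?thesis"
    then have "sum_list (map (\<lambda>P. a (pr r P) m) Ps) = 0" by (induction Ps) auto
    then show False using Ps(2) m(2) by simp
  qed
  then obtain P where P: "hsimple r P" "fd P" "a (pr r P) m \<noteq> 0" using Ps(1) by blast
  let ?y = "a (pr r P) m"
  have y: "?y \<in> M" using smod_act[OF M pr_Send[OF hsimple_hsub[OF P(1)] P(2)] m(1)] .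
  obtain \<mu> G where \<mu>: "\<mu> \<in> partitions r" and G: "G \<in> Send r" "G ` Pm r \<mu> = P" "inj_on G (Pm r \<mu>)"
    using hsimple_classification[OF P(1)] .
  let ?z = "G \<circ> zmu r \<mu>"
  have zW: "?z \<in> Wmod r \<mu>" using G(1) by (auto simp: Wmod_def)
  have z0: "?z \<noteq> 0"
  proof
    assume "?z = 0"
    then have "G ` Pm r \<mu> \<subseteq> {0}" using comp_zmu_zero[OF \<mu>] by blast
    then show False using G(2) hsimple_nontrivial[OF P(1)] qvs.subspace_0[OF hsub_subspace[OF hsimple_hsub[OF P(1)]]] by blast
  qed
  have "a \<phi> ?y = 0 \<longleftrightarrow> \<phi> \<circ> ?z = 0" if \<phi>: "\<phi> \<in> Send r" for \<phi>
    unfolding act_pr_zero_iff(1)[OF M P(1,2) m(1) P(3) \<phi>] comp_assoc[symmetric] comp_zmu_zero[OF \<mu>]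
    using G(2) by auto
  from iso_cyc[of r M a ?y "Wmod r \<mu>" "(\<circ>)" ?z, OF M y smod_Wmod[OF \<mu>] zW this]
  have "iso_mod r M a (Wmod r \<mu>) (\<circ>)"
    unfolding irreducible_cyc[OF irr y P(3)] irreducible_cyc[OF irreducible_Wmod[OF \<mu>] zW z0] .
  then show ?thesis using \<mu> by blast
qed

theorem theorem10p8:
  fixes r :: nat
  shows "(\<forall>\<mu>\<in>partitions r. smod r (Wmod r \<mu>) (\<circ>) \<and> weight_mod r (Wmod r \<mu>) (\<circ>)
            \<and> irreducible_mod r (Wmod r \<mu>) (\<circ>))
       \<and> (\<forall>\<mu>\<in>partitions r. \<forall>\<nu>\<in>partitions r.
            iso_mod r (Wmod r \<mu>) (\<circ>) (Wmod r \<nu>) (\<circ>) \<longrightarrow> \<mu> = \<nu>)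
       \<and> (\<forall>(M :: 'm::ab_group_add set) a. smod r M a \<and> weight_mod r M a \<and> irreducible_mod r M a
            \<longrightarrow> (\<exists>\<mu>\<in>partitions r. iso_mod r M a (Wmod r \<mu>) (\<circ>)))
       \<and> (\<forall>(M :: 'n::ab_group_add set) a. smod r M a \<and> weight_mod r M a \<longrightarrow> compl_red r M a)"
proof (intro conjI ballI allI impI)
  fix \<mu> assume \<mu>: "\<mu> \<in> partitions r"
  show "smod r (Wmod r \<mu>) (\<circ>)" by (rule smod_Wmod[OF \<mu>])
  show "weight_mod r (Wmod r \<mu>) (\<circ>)" by (rule weight_Wmod[OF \<mu>])
  show "irreducible_mod r (Wmod r \<mu>) (\<circ>)" by (rule irreducible_Wmod[OF \<mu>])
next
  fix \<mu> \<nu> assume \<mu>: "\<mu> \<in> partitions r" and \<nu>: "\<nu> \<in> partitions r"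
    and iso: "iso_mod r (Wmod r \<mu>) (\<circ>) (Wmod r \<nu>) (\<circ>)"
  \<comment> \<open>Dominance holds in both directions, as isomorphism is symmetric, and the partial
    sums determine the partition.\<close>
  show "\<mu> = \<nu>"
    by (rule low_determines[OF partitions_Lam[OF \<mu>] partitions_Lam[OF \<nu>]], rule antisym)
      (rule iso_Wmod_dominance[OF \<mu> \<nu> iso] iso_Wmod_dominance[OF \<nu> \<mu> iso_mod_sym[OF smod_Wmod[OF \<mu>] iso]])+
next
  fix M :: "'m set" and a assume "smod r M a \<and> weight_mod r M a \<and> irreducible_mod r M a"
  then show "\<exists>\<mu>\<in>partitions r. iso_mod r M a (Wmod r \<mu>) (\<circ>)" using irreducible_weight_module by blast
next
  fix M :: "'n set" and a assume "smod r M a \<and> weight_mod r M a"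
  then show "compl_red r M a" using completely_reducible weight_module_sum_of_simples by blast
qed

end
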